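(* A K-polystable toric surface is uniformly K-polystable (with respect to toric test-configurations). Explicitly: let $P\subset\mathbf{R}^2$ be the moment polygon of a smooth polarised toric surface, and suppose that $\mathcal{L}(f)\ge0$ for all rational piecewise-linear convex functions $f$ on $P$, with equality if and only if $f$ is affine linear. Then there exists $\lambda>0$ such that $$\mathcal{L}(f)\ \ge\ \lambda\Vert\pi(f)\Vert_{L^2(P)}$$ for all continuous convex functions $f$ on $P$.
   Context: $P$ is defined by inequalities $h_k(x)\ge c_k$, with $h_k:\mathbf{R}^2\to\mathbf{R}$ linear and inducing primitive maps $\mathbf{Z}^2\to\mathbf{Z}$. $d\mu$ is Lebesgue measure on $P$, and $d\sigma$ is the measure on $\partial P$ which on the edge $h_r=c_r$ is the constant 1-form with $dh_r\wedge d\sigma=\pm d\mu$. For a continuous function $f$ on $P$, $$\mathcal{L}(f)=\int_{\partial P}f\,d\sigma-a\int_Pf\,d\mu,\qquad a=\frac{\mathrm{Vol}(\partial P,d\sigma)}{\mathrm{Vol}(P,d\mu)}.$$ $\pi:C(P)\to C(P)$ is the $L^2(P,d\mu)$-orthogonal projection onto the orthogonal complement of the space of affine linear functions. A rational piecewise-linear convex function $f$ defines a toric test-configuration of the surface whose (rescaled) Futaki invariant is $\mathcal{L}(f)$; K-polystability and uniform K-polystability with respect to toric test-configurations mean the two conditions on $\mathcal{L}$ displayed in the claim (the uniform version in dimension $n$ uses the $L^{n/(n-1)}$-norm, which is $L^2$ for $n=2$). *)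

theory Defs
  imports "HOL-Analysis.Analysis"
begin

definition lattice_point :: "real^2 \<Rightarrow> bool" where
  "lattice_point v \<longleftrightarrow> (\<forall>i. v $ i \<in> \<int>)"

definition primitive_covector :: "real^2 \<Rightarrow> bool" where
  "primitive_covector h \<longleftrightarrow>
     (\<exists>p q :: int. h = vector [of_int p, of_int q] \<and> coprime p q)"

definition polygon :: "nat \<Rightarrow> (nat \<Rightarrow> real^2) \<Rightarrow> (nat \<Rightarrow> real) \<Rightarrow> (real^2) set" where
  "polygon N h c = {x. \<forall>k<N. h k \<bullet> x \<ge> c k}"

definition edge :: "nat \<Rightarrow> (nat \<Rightarrow> real^2) \<Rightarrow> (nat \<Rightarrow> real) \<Rightarrow> nat \<Rightarrow> (real^2) set" where
  "edge N h c k = {x \<in> polygon N h c. h k \<bullet> x = c k}"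

text \<open>
  Moment polygons of smooth polarised toric surfaces are the Delzant lattice polygons:
  the vertices are lattice points (they come from a line bundle), and at each vertex exactly two
  edges meet, with primitive conormals forming a basis of the dual lattice (smoothness).
  The list of inequalities is irredundant: \<open>edge N h c\<close> enumerates the facets
  without repetition.
\<close>

definition moment_polygon :: "nat \<Rightarrow> (nat \<Rightarrow> real^2) \<Rightarrow> (nat \<Rightarrow> real) \<Rightarrow> bool" where
  "moment_polygon N h c \<longleftrightarrow>
     bounded (polygon N h c) \<and> interior (polygon N h c) \<noteq> {} \<and>
     (\<forall>k<N. primitive_covector (h k)) \<and>
     (\<forall>k<N. edge N h c k facet_of polygon N h c) \<and>
     inj_on (edge N h c) {..<N} \<and>
     (\<forall>v. v extreme_point_of polygon N h c \<longrightarrow>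
        lattice_point v \<and>
        (\<exists>i j. {k. k < N \<and> v \<in> edge N h c k} = {i, j} \<and>
               \<bar>det (vector [h i, h j] :: real^2^2)\<bar> = 1))"

definition rot90 :: "real^2 \<Rightarrow> real^2" where
  "rot90 v = vector [- (v $ 2), v $ 1]"

text \<open>
  The measure \<open>d\<sigma>\<close> on the line \<open>h = c\<close>: the push-forward of Lebesgue measure on
  the reals under an affine parametrisation whose velocity \<open>rot90 h\<close> is tangent to the
  line and is mapped to \<open>\<plusminus>1\<close> by every 1-form \<open>\<sigma>\<close> with
  \<open>dh \<and> \<sigma> = \<plusminus>d\<mu>\<close>; see the two lemmas below.
\<close>

definition edge_measure :: "real^2 \<Rightarrow> real \<Rightarrow> (real^2) measure" where
  "edge_measure h c =
     distr lborel borel (\<lambda>t. (c / (h \<bullet> h)) *\<^sub>R h + t *\<^sub>R rot90 h)"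

lemma inner_rot90: "h \<bullet> rot90 h = 0"
  by (simp add: rot90_def inner_vec_def sum_2)

lemma edge_form_rot90:
  fixes h :: "real^2" and \<sigma> :: "real^2 \<Rightarrow> real"
  assumes "h \<noteq> 0" and "\<bar>s\<bar> = 1"
    and wedge: "\<And>u v. (h \<bullet> u) * \<sigma> v - (h \<bullet> v) * \<sigma> u
                          = s * det (vector [u, v] :: real^2^2)"
  shows "\<bar>\<sigma> (rot90 h)\<bar> = 1"
proof -
  have "det (vector [h, rot90 h] :: real^2^2) = h \<bullet> h"
    by (simp add: det_2 rot90_def inner_vec_def sum_2)
  with wedge[of h "rot90 h"] have "(h \<bullet> h) * \<sigma> (rot90 h) = (h \<bullet> h) * s"
    by (simp add: inner_rot90)
  then show ?thesis using assms(1,2) by simp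
qed

definition boundary_integral ::
  "nat \<Rightarrow> (nat \<Rightarrow> real^2) \<Rightarrow> (nat \<Rightarrow> real) \<Rightarrow> (real^2 \<Rightarrow> real) \<Rightarrow> real" where
  "boundary_integral N h c f =
     (\<Sum>k<N. LINT x:edge N h c k|edge_measure (h k) (c k). f x)"

definition futaki ::
  "nat \<Rightarrow> (nat \<Rightarrow> real^2) \<Rightarrow> (nat \<Rightarrow> real) \<Rightarrow> (real^2 \<Rightarrow> real) \<Rightarrow> real" where
  "futaki N h c f =
     boundary_integral N h c f
     - boundary_integral N h c (\<lambda>_. 1) / measure lborel (polygon N h c)
       * (LINT x:polygon N h c|lborel. f x)"

definition affine_linear :: "(real^2 \<Rightarrow> real) \<Rightarrow> bool" where
  "affine_linear g \<longleftrightarrow> (\<exists>a b. \<forall>x. g x = a \<bullet> x + b)"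

definition affine_linear_on :: "(real^2) set \<Rightarrow> (real^2 \<Rightarrow> real) \<Rightarrow> bool" where
  "affine_linear_on P f \<longleftrightarrow> (\<exists>g. affine_linear g \<and> (\<forall>x\<in>P. f x = g x))"

text \<open>
  Rational piecewise-linear convex functions are the maxima of finitely many affine linear
  functions with rational coefficients.
\<close>

definition rational_pl_convex_on :: "(real^2) set \<Rightarrow> (real^2 \<Rightarrow> real) \<Rightarrow> bool" where
  "rational_pl_convex_on P f \<longleftrightarrow>
     (\<exists>S :: ((real^2) \<times> real) set. finite S \<and> S \<noteq> {} \<and>
        (\<forall>(a, b)\<in>S. (\<forall>i. a $ i \<in> \<rat>) \<and> b \<in> \<rat>) \<and>
        (\<forall>x\<in>P. f x = Max ((\<lambda>(a, b). a \<bullet> x + b) ` S)))"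

text \<open>
  For compact \<open>P\<close> with nonempty interior and \<open>f\<close> continuous on \<open>P\<close>,
  exactly one affine linear \<open>g\<close> makes \<open>f - g\<close> orthogonal to all affine linear
  functions.
\<close>

definition proj_affine_perp ::
  "(real^2) set \<Rightarrow> (real^2 \<Rightarrow> real) \<Rightarrow> real^2 \<Rightarrow> real" where
  "proj_affine_perp P f =
     (let g = (THE g. affine_linear g \<and>
                 (\<forall>l. affine_linear l \<longrightarrow> (LINT x:P|lborel. (f x - g x) * l x) = 0))
      in (\<lambda>x. f x - g x))"

definition L2_norm_on :: "(real^2) set \<Rightarrow> (real^2 \<Rightarrow> real) \<Rightarrow> real" where
  "L2_norm_on P f = sqrt (LINT x:P|lborel. (f x)\<^sup>2)"

end

theory Submission
  imports Defs "HOL-Computational_Algebra.Polynomial"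
begin

text \<open>
  A convex function on \<open>P\<close> is bounded above by the function with the same boundary values
  that is an affine linear function plus a sum of hinges \<open>max 0 l\<close> with disjoint creases
  (up to a small error on the boundary), and raising a function in the interior decreases
  \<open>\<L>\<close>. So it suffices to bound \<open>\<L>\<close> from below on hinges.

  A hinge whose crease crosses \<open>P\<close> has \<open>\<L> > 0\<close>: if \<open>\<L>\<close> vanished, then, as a
  function of the crease with its endpoints on two fixed edges, \<open>\<L>\<close> would be, up to a positive
  factor, a nonnegative polynomial with rational coefficients that has a zero. It has total degree
  at most 3 and no cube of one of its variables, and such a polynomial has a rational zero nearby,
  contradicting the stability assumption. By compactness \<open>\<L>\<close> dominates a multiple of the
  boundary integral on hinges; degenerating creases are controlled by
  \<open>\<integral>\<^sub>P f\<^sup>2 \<le> C (\<integral>\<^sub>\<partial>\<^sub>P f)\<^sup>2\<close>, an inequality that holds for all nonnegative convex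
  functions and also turns boundary integrals into \<open>L\<^sup>2\<close>-norms at the end.
\<close>

section \<open>Rational zeros of nonnegative polynomials\<close>

text \<open>The hypothesis tests rational hinges only. By density \<open>L \<ge> 0\<close> on all
  hinges, but strictness could be lost at an irrational crease. All data of the polygon are rational
  because the vertices are lattice points, and then the degree decides: a nonnegative rational
  polynomial of degree 4 such as (x^2 - 2)^2 + y^2 can vanish at irrational points only. Degree 3
  comes from a cone formula with apex on the crease: it turns the area integral of a hinge into edge
  integrals with weights that are affine in the apex. The L2-norm does not survive the passage to
  hinges: replacing f by a majorant F with the same boundary values lowers \<open>L\<close> by
  \<open>a\<close> times the integral of F - f, which does not control the L2-norm of F - f. The
  estimate is therefore made for a linear functional, the boundary integral minus \<open>a\<close>
  times the integral of f composed with the contraction by 1/2 towards the barycenter; the norm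
  enters only at the end. The error on the boundary comes from interpolating f at finitely many
  points of the edges.\<close>

definition ratpoly_eval :: "real \<Rightarrow> rat poly \<Rightarrow> real" where
  "ratpoly_eval x p = poly (map_poly of_rat p) x"

lemma ratpoly_eval_0 [simp]: "ratpoly_eval x 0 = 0"
  by (simp add: ratpoly_eval_def)

lemma ratpoly_eval_pCons [simp]: "ratpoly_eval x (pCons a p) = of_rat a + x * ratpoly_eval x p"
  by (cases "a = 0 \<and> p = 0") (auto simp: ratpoly_eval_def map_poly_pCons)

lemma ratpoly_eval_add [simp]: "ratpoly_eval x (p + q) = ratpoly_eval x p + ratpoly_eval x q"
proof (induction p arbitrary: q)
  case (pCons a p)
  show ?case
    by (cases q) (simp add: pCons.IH of_rat_add distrib_left del: pCons_0_0)
qed simp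

lemma ratpoly_eval_smult [simp]: "ratpoly_eval x (Polynomial.smult c p) = of_rat c * ratpoly_eval x p"
  by (induction p) (auto simp: of_rat_mult algebra_simps)

lemma ratpoly_eval_mult [simp]: "ratpoly_eval x (p * q) = ratpoly_eval x p * ratpoly_eval x q"
  by (induction p) (auto simp: algebra_simps)

lemma ratpoly_eval_diff [simp]: "ratpoly_eval x (p - q) = ratpoly_eval x p - ratpoly_eval x q"
  using ratpoly_eval_add[of x "p - q" q] by simp

lemma has_real_derivative_ratpoly_eval:
  "((\<lambda>y. ratpoly_eval y p) has_real_derivative ratpoly_eval x (pderiv p)) (at x)"
proof (induction p)
  case (pCons a p)
  show ?case
    by (auto intro!: derivative_eq_intros pCons.IH simp: pderiv_pCons)
qed simp

text \<open>Here \<open>m\<close> is a minimal polynomial of \<open>x\<close>, a nonzero annihilator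
  of least degree. Irrationality makes its degree at least 2, and \<open>pderiv m\<close> does not
  vanish at \<open>x\<close> because its degree is smaller. Hence in \<open>p = m * q\<close> the
  double root forces \<open>q\<close> to vanish at \<open>x\<close>, so \<open>m\<close> divides
  \<open>q\<close> as well.\<close>

lemma irrational_double_root_square_dvd:
  fixes x :: real and p :: "rat poly"
  assumes "x \<notin> \<rat>" "ratpoly_eval x p = 0" "ratpoly_eval x (pderiv p) = 0" "p \<noteq> 0"
  obtains m where "degree m \<ge> 2" "ratpoly_eval x m = 0" "m * m dvd p"
proof -
  define I where "I = {q. q \<noteq> 0 \<and> ratpoly_eval x q = 0}"
  have "p \<in> I" using assms by (simp add: I_def)
  define m where "m = arg_min degree (\<lambda>q. q \<in> I)"
  have mI: "m \<in> I" and mmin: "\<And>q. q \<in> I \<Longrightarrow> degree m \<le> degree q"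
    using arg_min_nat_lemma[of "\<lambda>q. q \<in> I" p degree] \<open>p \<in> I\<close> by (auto simp: m_def)
  then have m0: "m \<noteq> 0" and mx: "ratpoly_eval x m = 0" by (auto simp: I_def)
  have dvdI: "m dvd q" if "ratpoly_eval x q = 0" for q
  proof -
    have "q = q div m * m + q mod m" by simp
    then have "ratpoly_eval x q = ratpoly_eval x (q div m * m + q mod m)" by metis
    then have "ratpoly_eval x (q mod m) = 0"
      unfolding ratpoly_eval_add ratpoly_eval_mult that mx by simp
    moreover have "q mod m = 0 \<or> degree (q mod m) < degree m" using m0 by (rule degree_mod_less)
    ultimately have "q mod m = 0" using mmin[of "q mod m"] unfolding I_def by fastforce
    then show ?thesis by auto
  qed
  have deg: "degree m \<ge> 2"
  proof (rule ccontr)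
    assume "\<not> 2 \<le> degree m"
    then have "degree m \<le> 1" by simp
    then obtain a b where m: "m = [:a, b:]"
      by (metis One_nat_def degree_eq_zeroE degree_pCons_eq_if le_zero_eq not_less_eq_eq pCons_0_0 pCons_cases)
    have e: "of_rat a + x * of_rat b = (0::real)" using mx m by simp
    show False
    proof (cases "b = 0")
      case True then show False using e m m0 by auto
    next
      case False
      then have "x = of_rat (- a / b)" using e by (simp add: field_simps of_rat_divide of_rat_minus)
      then show False using assms(1) by simp
    qed
  qed
  obtain q where q: "p = m * q" using dvdI assms(2) by (auto simp: dvd_def)
  have "pderiv m \<noteq> 0" using deg by (simp add: pderiv_eq_0_iff)
  moreover have "degree (pderiv m) < degree m" using deg by (simp add: degree_pderiv)
  ultimately have "ratpoly_eval x (pderiv m) \<noteq> 0" using mmin[of "pderiv m"] by (auto simp: I_def)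
  moreover have "ratpoly_eval x (pderiv m) * ratpoly_eval x q = 0"
    using assms(3) mx by (simp add: q pderiv_mult disj_commute)
  ultimately have "ratpoly_eval x q = 0" by simp
  then have "m dvd q" by (rule dvdI)
  then have "m * m dvd p" by (simp add: q)
  then show thesis using that deg mx by blast
qed

text \<open>The square of the minimal polynomial would have degree at least 4.\<close>

lemma irrational_double_root_cubic:
  assumes "x \<notin> \<rat>" "ratpoly_eval x p = 0" "ratpoly_eval x (pderiv p) = 0" "degree p \<le> 3"
  shows "p = 0"
proof (rule ccontr)
  assume "p \<noteq> 0"
  from irrational_double_root_square_dvd[OF assms(1-3) this]
  obtain m where m: "degree m \<ge> 2" "m * m dvd p" by blast
  then have "degree (m * m) \<le> degree p" using \<open>p \<noteq> 0\<close> by (simp add: dvd_imp_degree_le)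
  moreover have "degree (m * m) = degree m + degree m" using m by (intro degree_mult_eq) auto
  ultimately show False using m assms(4) by linarith
qed

text \<open>Degree 4 leaves room only for the square of a quadratic minimal polynomial; the
  conclusion is its equation solved for the square of \<open>x\<close>.\<close>

lemma irrational_double_root_quartic:
  assumes "x \<notin> \<rat>" "ratpoly_eval x p = 0" "ratpoly_eval x (pderiv p) = 0" "degree p \<le> 4" "p \<noteq> 0"
  obtains u v where "x^2 = of_rat u + of_rat v * x"
proof -
  from irrational_double_root_square_dvd[OF assms(1-3,5)]
  obtain m where m: "degree m \<ge> 2" "ratpoly_eval x m = 0" "m * m dvd p" by blast
  then have "degree (m * m) \<le> degree p" using \<open>p \<noteq> 0\<close> by (simp add: dvd_imp_degree_le)
  moreover have "degree (m * m) = degree m + degree m" using m by (intro degree_mult_eq) auto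
  ultimately have d: "degree m = 2" using m assms(4) by linarith
  then obtain a b c where mc: "m = [:a, b, c:]"
    by (metis degree_eq_zeroE degree_pCons_eq_if numeral_2_eq_2 pCons_cases nat.inject nat.distinct(1))
  with d have "c \<noteq> 0" by (auto split: if_splits)
  have "of_rat a + x * (of_rat b + x * of_rat c) = (0::real)" using m(2) mc by simp
  then have "x^2 = of_rat (- a / c) + of_rat (- b / c) * x" using \<open>c \<noteq> 0\<close>
    by (simp add: field_simps of_rat_divide of_rat_minus power2_eq_square)
  then show thesis using that by blast
qed

lemma rational_approx: 
  fixes x e :: real assumes "e > 0" obtains q :: rat where "\<bar>of_rat q - x\<bar> < e"
proof -
  obtain r where "r \<in> \<rat>" "x < r" "r < x + e" using Rats_dense_in_real[of x "x + e"] assms by auto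
  then obtain q where "r = of_rat q" by (auto elim: Rats_cases)
  then show thesis using that[of q] \<open>x < r\<close> \<open>r < x + e\<close> by auto
qed

lemma ratpoly_double_root_if_local_min:
  assumes "ratpoly_eval x p = 0" "e > 0" "\<And>y. \<bar>y - x\<bar> < e \<Longrightarrow> ratpoly_eval y p \<ge> 0"
  shows "ratpoly_eval x (pderiv p) = 0"
  using DERIV_local_min[OF has_real_derivative_ratpoly_eval[of p x] assms(2)] assms
  by (simp add: abs_minus_commute)

lemma cubic_zero_if_irrational_local_min:
  assumes "x \<notin> \<rat>" "ratpoly_eval x p = 0" "e > 0" "\<And>y. \<bar>y - x\<bar> < e \<Longrightarrow> ratpoly_eval y p \<ge> 0"
    "degree p \<le> 3"
  shows "p = 0"
  using irrational_double_root_cubic ratpoly_double_root_if_local_min assms by blast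

lemma rational_zero_degree_3:
  fixes p :: "rat poly"
  assumes "degree p \<le> 3" "ratpoly_eval x p = 0" "e > 0"
    "\<And>y. \<bar>y - x\<bar> < e \<Longrightarrow> ratpoly_eval y p \<ge> 0"
  obtains q :: rat where "\<bar>of_rat q - x\<bar> < e" "ratpoly_eval (of_rat q) p = 0"
proof (cases "x \<in> \<rat>")
  case True
  then obtain q where "x = of_rat q" by (auto elim: Rats_cases)
  then show ?thesis using that[of q] assms by simp
next
  case False
  then have "p = 0" using cubic_zero_if_irrational_local_min assms by blast
  moreover obtain q :: rat where "\<bar>of_rat q - x\<bar> < e" using rational_approx assms(3) by blast
  ultimately show ?thesis using that by simp
qed

lemma nonneg_quadratic_zero:
  fixes a b c y e :: real
  assumes "e > 0" "a * y^2 + b * y + c = 0" "\<And>z. \<bar>z - y\<bar> < e \<Longrightarrow> a * z^2 + b * z + c \<ge> 0"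
  shows "b = - 2 * a * y" "a \<ge> 0"
proof -
  have "((\<lambda>z. a * z^2 + b * z + c) has_real_derivative (2 * a * y + b)) (at y)"
    by (auto intro!: derivative_eq_intros)
  from DERIV_local_min[OF this assms(1)] assms show b: "b = - 2 * a * y"
    by (simp add: abs_minus_commute)
  have "a * (y + e/2)^2 + b * (y + e/2) + c \<ge> 0" using assms(1) by (intro assms(3)) simp
  then have "a * (e/2)^2 \<ge> 0" using assms(2) by (simp add: b power2_eq_square algebra_simps of_rat_diff)
  then show "a \<ge> 0" using assms(1) by (simp add: zero_le_mult_iff)
qed

text \<open>
  If \<open>x0\<close> is irrational, it is a double root of the discriminant of \<open>g\<close> as a quadratic in
  \<open>y\<close>. The discriminant has degree at most 4, so it is zero or \<open>x0\<close> is quadratic over the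
  rationals. In the latter case \<open>y0\<close> lies in the field generated by \<open>x0\<close>, so \<open>(x0, y0)\<close> is on
  a rational line, and the restriction of \<open>g\<close> to it is a cubic with an irrational double root,
  hence zero.
\<close>

lemma rational_zero_cubic:
  fixes a0 a1 b0 b1 b2 c0 c1 c2 c3 :: rat and x0 y0 e :: real
  defines "g \<equiv> \<lambda>x y::real. (of_rat a0 + of_rat a1 * x) * y^2
      + (of_rat b0 + of_rat b1 * x + of_rat b2 * x^2) * y
      + (of_rat c0 + of_rat c1 * x + of_rat c2 * x^2 + of_rat c3 * x^3)"
  assumes e: "e > 0" and zero: "g x0 y0 = 0"
    and nonneg: "\<And>x y. \<bar>x - x0\<bar> < e \<Longrightarrow> \<bar>y - y0\<bar> < e \<Longrightarrow> g x y \<ge> 0"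
  obtains x y :: rat where "\<bar>of_rat x - x0\<bar> < e" "\<bar>of_rat y - y0\<bar> < e" "g (of_rat x) (of_rat y) = 0"
proof -
  define A where "A = [:a0, a1:]"
  define B where "B = [:b0, b1, b2:]"
  define C where "C = [:c0, c1, c2, c3:]"
  have g: "g x y = ratpoly_eval x A * y^2 + ratpoly_eval x B * y + ratpoly_eval x C" for x y
    by (simp add: g_def A_def B_def C_def algebra_simps power2_eq_square power3_eq_cube)
  have gx: "g x (of_rat y) = ratpoly_eval x (Polynomial.smult (y^2) A + Polynomial.smult y B + C)" for x y
    by (simp add: g of_rat_power algebra_simps)
  have dg: "degree (Polynomial.smult (y^2) A + Polynomial.smult y B + C) \<le> 3" for y
    by (intro degree_add_le) (auto simp: A_def B_def C_def)
  show thesis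
  proof (cases "x0 \<in> \<rat>")
    case True
    then obtain x where x: "x0 = of_rat x" by (auto elim: Rats_cases)
    define p where "p = [:c0 + c1 * x + c2 * x^2 + c3 * x^3, b0 + b1 * x + b2 * x^2, a0 + a1 * x:]"
    have p: "g x0 y = ratpoly_eval y p" for y
      by (simp add: g_def p_def x of_rat_add of_rat_mult of_rat_power algebra_simps power2_eq_square)
    have "degree p \<le> 3" by (simp add: p_def)
    then obtain y :: rat where "\<bar>of_rat y - y0\<bar> < e" "ratpoly_eval (of_rat y) p = 0"
      using rational_zero_degree_3[OF _ zero[unfolded p] e nonneg[of x0, unfolded p]] e by auto
    then show thesis using that[of x y] e by (simp add: x p[unfolded x])
  next
    case irr: False
    have quad: "ratpoly_eval x0 B = - 2 * ratpoly_eval x0 A * y0" "ratpoly_eval x0 A \<ge> 0"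
      using nonneg_quadratic_zero[OF e zero[unfolded g] nonneg[of x0, unfolded g]] e by auto
    show thesis
    proof (cases "ratpoly_eval x0 A = 0")
      case True
      \<comment> \<open>With leading coefficient zero at \<open>x0\<close>, nonnegativity on both
        sides of \<open>y0\<close> makes the whole restriction to \<open>x = x0\<close> vanish. So
        the restriction to any rational horizontal line near \<open>y0\<close> is a cubic with a
        zero local minimum at the irrational \<open>x0\<close>, hence identically zero.\<close>
      then have BC: "ratpoly_eval x0 B = 0" "ratpoly_eval x0 C = 0" using quad zero by (auto simp: g)
      obtain y :: rat where y: "\<bar>of_rat y - y0\<bar> < e" using rational_approx[OF e] by blast
      have "Polynomial.smult (y^2) A + Polynomial.smult y B + C = 0"
      proof (rule cubic_zero_if_irrational_local_min[OF irr _ e])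
        show "ratpoly_eval x0 (Polynomial.smult (y^2) A + Polynomial.smult y B + C) = 0"
          by (simp add: True BC)
        show "ratpoly_eval x (Polynomial.smult (y^2) A + Polynomial.smult y B + C) \<ge> 0"
          if "\<bar>x - x0\<bar> < e" for x
          using nonneg[OF that y] unfolding gx .
      qed (rule dg)
      then have "g x (of_rat y) = 0" for x by (simp only: gx ratpoly_eval_0)
      moreover obtain x :: rat where "\<bar>of_rat x - x0\<bar> < e" using rational_approx[OF e] by blast
      ultimately show thesis using that y by blast
    next
      case False
      with quad have Apos: "ratpoly_eval x0 A > 0" by simp
      have y0: "y0 = - ratpoly_eval x0 B / (2 * ratpoly_eval x0 A)" using quad False by simp
      have cont: "isCont (\<lambda>x. ratpoly_eval x p) x0" for p
        using has_real_derivative_ratpoly_eval DERIV_isCont by blast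
      \<comment> \<open>\<open>Y x\<close> is the vertex of the parabola \<open>g x\<close>, where
        the minimum in \<open>y\<close> is attained when the leading coefficient is
        positive.\<close>
      define Y where "Y = (\<lambda>x. - ratpoly_eval x B / (2 * ratpoly_eval x A))"
      have "isCont Y x0" unfolding Y_def using Apos by (intro continuous_intros cont) auto
      then have "\<forall>\<^sub>F x in at x0. \<bar>Y x - y0\<bar> < e"
        using tendstoD[OF _ e, of Y "Y x0" "at x0"] y0 by (simp add: isCont_def dist_real_def Y_def)
      moreover have "\<forall>\<^sub>F x in at x0. ratpoly_eval x A > 0"
        using order_tendstoD(1)[OF cont[of A, unfolded isCont_def] Apos] .
      ultimately have "\<forall>\<^sub>F x in at x0. \<bar>Y x - y0\<bar> < e \<and> ratpoly_eval x A > 0"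
        by (rule eventually_conj)
      then obtain d where d: "d > 0" "\<And>x. x \<noteq> x0 \<Longrightarrow> \<bar>x - x0\<bar> < d \<Longrightarrow> \<bar>Y x - y0\<bar> < e \<and> ratpoly_eval x A > 0"
        by (auto simp: eventually_at dist_real_def)
      then have d2: "\<bar>Y x - y0\<bar> < e" "ratpoly_eval x A > 0" if "\<bar>x - x0\<bar> < d" for x
        using that d(2)[of x] Apos y0 e by (cases "x = x0"; simp add: Y_def)+
      \<comment> \<open>Minus the discriminant in \<open>y\<close>. It is nonnegative near
        \<open>x0\<close> because \<open>g\<close> takes the value \<open>D / (4 * A)\<close> at the
        vertex. Both \<open>A * C\<close> and \<open>B * B\<close> have degree at most 4; this is
        where the shape of \<open>g\<close> enters.\<close>
      define D where "D = Polynomial.smult 4 (A * C) - B * B"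
      have Deval: "ratpoly_eval x D = 4 * ratpoly_eval x A * ratpoly_eval x C - (ratpoly_eval x B)^2" for x
        by (simp add: D_def power2_eq_square)
      have gD: "g x (Y x) = ratpoly_eval x D / (4 * ratpoly_eval x A)" if "ratpoly_eval x A > 0" for x
        using that by (simp add: g Y_def Deval field_simps power2_eq_square)
      have D0: "ratpoly_eval x0 D = 0" using gD[of x0] zero Apos y0 by (simp add: Y_def)
      have "ratpoly_eval x D \<ge> 0" if "\<bar>x - x0\<bar> < min d e" for x
        using gD[of x] d2[of x] nonneg[of x "Y x"] that by (simp add: zero_le_divide_iff)
      then have D': "ratpoly_eval x0 (pderiv D) = 0"
        using ratpoly_double_root_if_local_min[OF D0, of "min d e"] d e by auto
      have dD: "degree D \<le> 4"
        unfolding D_def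
        by (intro degree_diff_le order.trans[OF degree_smult_le] order.trans[OF degree_mult_le])
          (auto simp: A_def B_def C_def)
      show thesis
      proof (cases "D = 0")
        case True
        \<comment> \<open>Now \<open>g\<close> vanishes along the graph of \<open>Y\<close>, and
          \<open>Y\<close> is rational at rational arguments.\<close>
        obtain x :: rat where x: "\<bar>of_rat x - x0\<bar> < min d e" using rational_approx d(1) e
          by (metis min_less_iff_conj)
        define y where "y = - (b0 + b1 * x + b2 * x^2) / (2 * (a0 + a1 * x))"
        have Yy: "Y (of_rat x) = of_rat y"
          by (simp add: Y_def y_def A_def B_def of_rat_divide of_rat_minus of_rat_add of_rat_diff of_rat_mult of_rat_power
              power2_eq_square algebra_simps of_rat_diff)
        have "g (of_rat x) (Y (of_rat x)) = 0" using gD[of "of_rat x"] d2[of "of_rat x"] x True by simp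
        then show thesis using that[of x y] x d2[of "of_rat x"] by (simp add: Yy)
      next
        case Dn0: False
        obtain u v where uv: "x0^2 = of_rat u + of_rat v * x0"
          using irrational_double_root_quartic[OF irr D0 D' dD Dn0] by blast
        \<comment> \<open>The conjugate of \<open>x0\<close> is \<open>v - x0\<close>, and
          \<open>M\<close> is the norm of \<open>a0 + a1 * x0\<close>. Multiplying by the conjugate
          clears the denominator of \<open>y0\<close> and gives \<open>y0 = p + q * x0\<close> with
          rational \<open>p\<close> and \<open>q\<close>.\<close>
        define M where "M = a0^2 + a0 * a1 * v - a1^2 * u"
        have M: "(of_rat a0 + of_rat a1 * x0) * (of_rat a0 + of_rat a1 * (of_rat v - x0)) = of_rat M"
        proof -
          have "(of_rat a0 + of_rat a1 * x0) * (of_rat a0 + of_rat a1 * (of_rat v - x0)) =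
            of_rat a0 ^ 2 + of_rat a0 * of_rat a1 * of_rat v + of_rat a1 ^2 * (of_rat v * x0 - x0^2)"
            by (simp add: algebra_simps power2_eq_square)
          then show ?thesis
            by (simp add: uv M_def of_rat_add of_rat_diff of_rat_mult of_rat_power algebra_simps)
        qed
        have conj_ne: "of_rat a0 + of_rat a1 * (of_rat v - x0) \<noteq> 0"
        proof
          assume eq: "of_rat a0 + of_rat a1 * (of_rat v - x0) = 0"
          show False
          proof (cases "a1 = 0")
            case True then show False using eq False by (simp add: A_def)
          next
            case False
            then have "x0 = of_rat (a0 / a1 + v)" using eq
              by (simp add: field_simps of_rat_add of_rat_divide of_rat_mult)
            then show False using irr by simp
          qed
        qed
        have A0: "ratpoly_eval x0 A = of_rat a0 + of_rat a1 * x0" by (simp add: A_def)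
        have M0: "M \<noteq> 0" using M conj_ne False A0 by auto
        define B0 where "B0 = b0 + b2 * u"
        define B1 where "B1 = b1 + b2 * v"
        have B0: "ratpoly_eval x0 B = of_rat B0 + of_rat B1 * x0"
        proof -
          have "ratpoly_eval x0 B = of_rat b0 + of_rat b1 * x0 + of_rat b2 * x0^2"
            by (simp add: B_def algebra_simps power2_eq_square)
          then show ?thesis by (simp add: uv B0_def B1_def of_rat_add of_rat_mult algebra_simps)
        qed
        define N0 where "N0 = B0 * (a0 + a1 * v) - B1 * a1 * u"
        define N1 where "N1 = B1 * a0 - B0 * a1"
        define p where "p = - N0 / (2 * M)"
        define q where "q = - N1 / (2 * M)"
        have num: "(of_rat B0 + of_rat B1 * x0) * (of_rat a0 + of_rat a1 * (of_rat v - x0)) =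
            of_rat N0 + of_rat N1 * x0"
        proof -
          have "(of_rat B0 + of_rat B1 * x0) * (of_rat a0 + of_rat a1 * (of_rat v - x0)) =
            of_rat B0 * (of_rat a0 + of_rat a1 * of_rat v) - of_rat B1 * of_rat a1 * (x0^2 - of_rat v * x0)
             + (of_rat B1 * of_rat a0 - of_rat B0 * of_rat a1) * x0"
            by (simp add: algebra_simps power2_eq_square)
          then show ?thesis
            by (simp add: uv N0_def N1_def of_rat_add of_rat_diff of_rat_mult algebra_simps)
        qed
        have "y0 = - ((of_rat B0 + of_rat B1 * x0) * (of_rat a0 + of_rat a1 * (of_rat v - x0)))
            / (2 * ((of_rat a0 + of_rat a1 * x0) * (of_rat a0 + of_rat a1 * (of_rat v - x0))))"
          using conj_ne False y0 by (simp add: A0 B0 minus_divide_left)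
        then have y0pq: "y0 = of_rat p + of_rat q * x0"
          unfolding num M using M0
          by (simp add: p_def q_def of_rat_divide of_rat_minus of_rat_mult field_simps)
        define r where "r = A * [:p, q:] * [:p, q:] + B * [:p, q:] + C"
        have r: "g x (of_rat p + of_rat q * x) = ratpoly_eval x r" for x
          unfolding g r_def ratpoly_eval_add ratpoly_eval_mult ratpoly_eval_pCons ratpoly_eval_0
          by (simp add: algebra_simps power2_eq_square)
        have dr: "degree r \<le> 3"
          unfolding r_def
          by (intro degree_add_le order.trans[OF degree_mult_le])
            (auto simp: A_def B_def C_def intro!: order.trans[OF add_mono[OF degree_mult_le order.refl]])
        define k :: real where "k = \<bar>of_rat q\<bar>"
        have k: "k \<ge> 0" by (simp add: k_def del: abs_of_rat)
        \<comment> \<open>Small enough that the line of slope \<open>q\<close> through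
          \<open>(x0, y0)\<close> stays in the box of size \<open>e\<close>.\<close>
        define e' where "e' = e / (1 + k)"
        have e': "e' > 0" "e' \<le> e" using e k by (auto simp: e'_def field_simps)
        have near: "\<bar>of_rat p + of_rat q * x - y0\<bar> < e" if "\<bar>x - x0\<bar> < e'" for x
        proof -
          have "\<bar>of_rat p + of_rat q * x - y0\<bar> = k * \<bar>x - x0\<bar>"
            unfolding y0pq k_def abs_mult[symmetric] by (simp add: algebra_simps)
          also have "\<dots> \<le> k * e'" using that k by (intro mult_left_mono) auto
          also have "\<dots> < e" using e k by (simp add: e'_def field_simps)
          finally show ?thesis .
        qed
        have "r = 0"
        proof (rule cubic_zero_if_irrational_local_min[OF irr _ e'(1) _ dr])
          show "ratpoly_eval x0 r = 0" using zero r[of x0] y0pq by simp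
          show "ratpoly_eval y r \<ge> 0" if "\<bar>y - x0\<bar> < e'" for y
            using nonneg[of y] near[OF that] that e' r by force
        qed
        moreover obtain x :: rat where x: "\<bar>of_rat x - x0\<bar> < e'" using rational_approx e'(1) by blast
        ultimately have "g (of_rat x) (of_rat (p + q * x)) = 0"
          using r[of "of_rat x"] by (simp add: of_rat_add of_rat_mult)
        then show thesis using that[of x "p + q * x"] x near[OF x] e'
          by (simp add: of_rat_add of_rat_mult)
      qed
    qed
  qed
qed

section \<open>Hinge interpolation of convex functions\<close>

lemma affine_linear_add:
  assumes "affine_linear f" "affine_linear g" shows "affine_linear (\<lambda>x. f x + g x)"
proof -
  obtain a b a' b' where "\<forall>x. f x = a \<bullet> x + b" "\<forall>x. g x = a' \<bullet> x + b'"
    using assms unfolding affine_linear_def by blast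
  then have "\<forall>x. f x + g x = (a + a') \<bullet> x + (b + b')" by (simp add: inner_add_left)
  then show ?thesis unfolding affine_linear_def by blast
qed

lemma affine_linear_cmult:
  assumes "affine_linear f" shows "affine_linear (\<lambda>x. c * f x)"
proof -
  obtain a b where "\<forall>x. f x = a \<bullet> x + b" using assms unfolding affine_linear_def by blast
  then have "\<forall>x. c * f x = (c *\<^sub>R a) \<bullet> x + c * b" by (simp add: algebra_simps)
  then show ?thesis unfolding affine_linear_def by blast
qed

lemma affine_linear_diff:
  assumes "affine_linear f" "affine_linear g" shows "affine_linear (\<lambda>x. f x - g x)"
  using affine_linear_add[OF assms(1) affine_linear_cmult[OF assms(2), of "-1"]] by simp

lemma affine_linear_combination:
  assumes "affine_linear g" "u + v + w = 1"
  shows "g (u *\<^sub>R x + v *\<^sub>R y + w *\<^sub>R z) = u * g x + v * g y + w * g z"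
proof -
  obtain a b where g: "\<forall>x. g x = a \<bullet> x + b" using assms unfolding affine_linear_def by blast
  have "u * b + v * b + w * b = b" using assms(2) by (metis distrib_right mult_1)
  then show ?thesis by (simp add: g algebra_simps)
qed

lemma affine_linear_combination2:
  assumes "affine_linear g" "u + v = 1"
  shows "g (u *\<^sub>R x + v *\<^sub>R y) = u * g x + v * g y"
  using affine_linear_combination[OF assms(1), of u v 0 x y x] assms(2) by simp

lemma affine_linear_convex_on:
  assumes "affine_linear g" "convex S" shows "convex_on S g"
  using assms(2) by (auto simp: convex_on_def affine_linear_combination2[OF assms(1)])

lemma convex_on_diff_affine_linear:
  assumes "convex_on S f" "affine_linear g" shows "convex_on S (\<lambda>x. f x - g x)"
  using convex_on_add[OF assms(1) affine_linear_convex_on[OF affine_linear_cmult[OF assms(2), of "-1"]]]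
    assms(1) by (simp add: convex_on_def)

lemma affine_linear_nonpos_hull:
  assumes "affine_linear g" "\<And>q. q \<in> Q \<Longrightarrow> g q \<le> 0" "x \<in> convex hull Q" shows "g x \<le> 0"
proof -
  obtain a b where g: "\<forall>x. g x = a \<bullet> x + b" using assms unfolding affine_linear_def by blast
  have "convex hull Q \<subseteq> {x. a \<bullet> x \<le> - b}"
    using assms(2) g by (intro hull_minimal convex_halfspace_le) force
  then show ?thesis using assms(3) g by force
qed

lemma convex_on_nonpos_3:
  assumes f: "convex_on S f" and S: "x \<in> S" "y \<in> S" "z \<in> S"
    and uvw: "0 \<le> u" "0 \<le> v" "0 \<le> w" "u + v + w = 1"
    and "f x \<le> 0" "f y \<le> 0" "f z \<le> 0"
  shows "f (u *\<^sub>R x + v *\<^sub>R y + w *\<^sub>R z) \<le> 0"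
proof -
  have "convex {x \<in> S. f x \<le> 0}" unfolding convex_def
    using convex_lower[OF f] convex_on_imp_convex[OF f] by (force simp: convex_def)
  moreover have "{x, y, z} \<subseteq> {x \<in> S. f x \<le> 0}" using S assms by auto
  ultimately have "convex hull {x, y, z} \<subseteq> {x \<in> S. f x \<le> 0}" by (rule hull_minimal[rotated])
  moreover have "u *\<^sub>R x + v *\<^sub>R y + w *\<^sub>R z \<in> convex hull {x, y, z}"
    unfolding convex_hull_3 using uvw by blast
  ultimately show ?thesis by blast
qed

text \<open>The triangle \<open>z\<close>, \<open>z'\<close>, \<open>q\<close> has barycentric
  coordinates \<open>l / l q\<close>, \<open>- l1\<close>, \<open>- l2\<close>. The minus signs make
  \<open>l1\<close> positive beyond the chord from \<open>z\<close> to \<open>q\<close> and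
  \<open>l2\<close> positive beyond the chord from \<open>z'\<close> to \<open>q\<close>, so that on
  the two new caps they take over the role of \<open>l\<close>.\<close>

lemma barycentric_real2:
  fixes z z' q :: "real^2"
  assumes l: "affine_linear l" and "l z = 0" "l z' = 0" "z \<noteq> z'" "l q \<noteq> 0"
  obtains l1 l2 where "affine_linear l1" "affine_linear l2"
    "l1 z = 0" "l1 q = 0" "l1 z' = -1" "l2 z' = 0" "l2 q = 0" "l2 z = -1"
    "\<And>x. x = (l x / l q) *\<^sub>R q + (- l1 x) *\<^sub>R z' + (- l2 x) *\<^sub>R z"
    "\<And>x. l x / l q + - l1 x + - l2 x = 1"
proof -
  obtain a b where ab: "\<And>x. l x = a \<bullet> x + b" using l unfolding affine_linear_def by blast
  define d where "d = z' - z"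
  \<comment> \<open>The gradient of \<open>l\<close> is orthogonal to \<open>d\<close>, hence equal
    to \<open>k *\<^sub>R rot90 d\<close>.\<close>
  define k where "k = (a$2 * d$1 - a$1 * d$2) / ((d$1)^2 + (d$2)^2)"
  have nd: "(d$1)^2 + (d$2)^2 \<noteq> 0"
    using assms(4) by (auto simp: d_def vec_eq_iff forall_2 sum_power2_eq_zero_iff)
  have ad: "a$1 * d$1 + a$2 * d$2 = 0"
    using assms(2,3) by (simp add: ab d_def inner_vec_def sum_2 algebra_simps)
  have a1: "a$1 = - k * d$2"
  proof -
    have "a$1 * ((d$1)^2 + (d$2)^2) = - (a$2 * d$1 - a$1 * d$2) * d$2 + (a$1 * d$1 + a$2 * d$2) * d$1"
      by (simp add: algebra_simps power2_eq_square)
    then show ?thesis using nd ad by (simp add: k_def field_simps)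
  qed
  have a2: "a$2 = k * d$1"
  proof -
    have "a$2 * ((d$1)^2 + (d$2)^2) = (a$2 * d$1 - a$1 * d$2) * d$1 + (a$1 * d$1 + a$2 * d$2) * d$2"
      by (simp add: algebra_simps power2_eq_square)
    then show ?thesis using nd ad by (simp add: k_def field_simps)
  qed
  have lx: "l x = k * (d$1 * (x$2 - z$2) - d$2 * (x$1 - z$1))" for x
  proof -
    have "l x = l x - l z" using assms(2) by simp
    also have "\<dots> = a$1 * (x$1 - z$1) + a$2 * (x$2 - z$2)"
      by (simp add: ab inner_vec_def sum_2 algebra_simps)
    finally show ?thesis by (simp add: a1 a2 algebra_simps)
  qed
  \<comment> \<open>Twice the signed area of the triangle \<open>z\<close>, \<open>z'\<close>,
    \<open>q\<close>; the coordinates are quotients of such areas.\<close>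
  define D where "D = d$1 * (q$2 - z$2) - d$2 * (q$1 - z$1)"
  have kD: "k \<noteq> 0" "D \<noteq> 0" using assms(5) by (auto simp: lx D_def)
  define n1 where "n1 = (\<lambda>x::real^2. (x$1 - z$1) * (q$2 - z$2) - (x$2 - z$2) * (q$1 - z$1))"
  define n2 where "n2 = (\<lambda>x::real^2. (x$1 - q$1) * (z'$2 - q$2) - (x$2 - q$2) * (z'$1 - q$1))"
  define l1 where "l1 = (\<lambda>x. (- 1 / D) * n1 x)"
  define l2 where "l2 = (\<lambda>x. (- 1 / D) * n2 x)"
  have coords: "affine_linear (\<lambda>x. (x$1 - p1) * r - (x$2 - p2) * s)" for p1 p2 r s
    unfolding affine_linear_def
    by (rule exI[of _ "vector [r, - s]"], rule exI[of _ "p2 * s - p1 * r"])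
      (simp add: inner_vec_def sum_2 algebra_simps)
  have aff: "affine_linear l1" "affine_linear l2"
    unfolding l1_def l2_def n1_def n2_def by (intro affine_linear_cmult coords)+
  have nl: "- l1 x = n1 x / D" "- l2 x = n2 x / D" for x by (simp_all add: l1_def l2_def)
  have L: "l x / l q = (d$1 * (x$2 - z$2) - d$2 * (x$1 - z$1)) / D" for x
    using kD by (simp add: lx D_def)
  have sm: "l x / l q + - l1 x + - l2 x = 1" for x
  proof -
    have "(d$1 * (x$2 - z$2) - d$2 * (x$1 - z$1)) + n1 x + n2 x = D"
      by (simp add: D_def d_def n1_def n2_def algebra_simps)
    then show ?thesis using kD(2) by (simp add: L nl add_divide_distrib[symmetric] del: add_uminus_conv_diff)
  qed
  have rep: "x = (l x / l q) *\<^sub>R q + (- l1 x) *\<^sub>R z' + (- l2 x) *\<^sub>R z" for x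
  proof -
    have "x$i = ((d$1 * (x$2 - z$2) - d$2 * (x$1 - z$1)) / D) * q$i + n1 x / D * z'$i + n2 x / D * z$i" for i :: 2
    proof -
      have "D * x$i = (d$1 * (x$2 - z$2) - d$2 * (x$1 - z$1)) * q$i + n1 x * z'$i + n2 x * z$i"
        using exhaust_2[of i] by (auto simp: D_def d_def n1_def n2_def algebra_simps)
      then have "(D * x$i) / D = ((d$1 * (x$2 - z$2) - d$2 * (x$1 - z$1)) * q$i + n1 x * z'$i + n2 x * z$i) / D"
        by (rule arg_cong)
      then show ?thesis using kD(2) by (simp only: add_divide_distrib times_divide_eq_left) simp
    qed
    then show ?thesis unfolding vec_eq_iff L nl vector_add_component vector_scaleR_component real_scaleR_def by blast
  qed
  have vals: "l1 z = 0" "l1 q = 0" "l1 z' = -1" "l2 z' = 0" "l2 q = 0" "l2 z = -1"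
    using kD by (simp_all add: l1_def l2_def n1_def n2_def field_simps) (simp_all add: D_def d_def algebra_simps)
  show thesis using that[OF aff vals rep sm] .
qed

text \<open>Coefficients are nonnegative, so convexity and lower bounds for single hinges pass to
  sums by rule induction. The position of the creases is not recorded.\<close>

inductive hinge_sum :: "(real^2 \<Rightarrow> real) \<Rightarrow> bool" where
  zero: "hinge_sum (\<lambda>_. 0)"
| hinge: "hinge_sum g \<Longrightarrow> affine_linear l \<Longrightarrow> c \<ge> 0 \<Longrightarrow> hinge_sum (\<lambda>x. c * max 0 (l x) + g x)"

lemma hinge_sum_add: "hinge_sum f \<Longrightarrow> hinge_sum g \<Longrightarrow> hinge_sum (\<lambda>x. f x + g x)"
  by (induction rule: hinge_sum.induct) (auto intro: hinge_sum.intros simp: add.assoc)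

lemma hinge_sum_nonneg: "hinge_sum g \<Longrightarrow> g x \<ge> 0"
  by (induction rule: hinge_sum.induct) auto

lemma convex_on_hinge: "affine_linear l \<Longrightarrow> convex S \<Longrightarrow> convex_on S (\<lambda>x. max 0 (l x))"
proof (rule convex_onI)
  fix t :: real and x y :: "real^2" assume l: "affine_linear l" and t: "0 < t" "t < 1"
  have "l ((1 - t) *\<^sub>R x + t *\<^sub>R y) = (1 - t) * l x + t * l y"
    by (rule affine_linear_combination2[OF l]) simp
  also have "\<dots> \<le> (1 - t) * max 0 (l x) + t * max 0 (l y)"
    using t by (intro add_mono mult_left_mono) auto
  finally show "max 0 (l ((1 - t) *\<^sub>R x + t *\<^sub>R y)) \<le> (1 - t) * max 0 (l x) + t * max 0 (l y)"
    using t by simp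
qed

lemma hinge_sum_convex_on: "hinge_sum g \<Longrightarrow> convex S \<Longrightarrow> convex_on S g"
proof (induction rule: hinge_sum.induct)
  case zero
  then show ?case by (simp add: convex_on_def)
next
  case (hinge g l c)
  then show ?case by (intro convex_on_add convex_on_cmul convex_on_hinge) auto
qed

text \<open>
  Subtract from \<open>f\<close> the largest multiple of \<open>l\<close> that stays below \<open>f\<close> on \<open>Q\<close>. The
  difference vanishes at some point \<open>q\<close>, and the chords from \<open>z\<close> to \<open>q\<close> and from
  \<open>q\<close> to \<open>z'\<close> cut off two disjoint caps with fewer points. The affine linear function \<open>u\<close> in
  the hypotheses is a supporting line: the points of \<open>Q\<close> are on the boundary of \<open>P\<close>.
\<close>

lemma cap_interpolation:
  fixes P Q :: "(real^2) set"
  assumes fin: "finite Q" and P: "P = convex hull Q"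
    and supp: "\<And>q. q \<in> Q \<Longrightarrow> \<exists>u. affine_linear u \<and> u q = 0 \<and> (\<forall>x\<in>P. 0 \<le> u x) \<and> (\<exists>x. u x \<noteq> 0)"
  shows "affine_linear l \<Longrightarrow> z \<in> Q \<Longrightarrow> z' \<in> Q \<Longrightarrow> z \<noteq> z' \<Longrightarrow> l z = 0 \<Longrightarrow> l z' = 0 \<Longrightarrow>
    y \<in> P \<Longrightarrow> l y < 0 \<Longrightarrow> convex_on P f \<Longrightarrow> (\<And>q. q \<in> Q \<Longrightarrow> l q > 0 \<Longrightarrow> f q \<ge> 0) \<Longrightarrow>
    f z = 0 \<Longrightarrow> f z' = 0 \<Longrightarrow>
    \<exists>H. hinge_sum H \<and> (\<forall>x\<in>P. l x \<le> 0 \<longrightarrow> H x = 0) \<and> (\<forall>q\<in>Q. l q > 0 \<longrightarrow> H q = f q) \<and>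
        (\<forall>x\<in>P. l x > 0 \<longrightarrow> f x \<le> H x)"
\<comment> \<open>The number of sample points strictly inside the cap drops, since \<open>q\<close>
  lies on both new chords.\<close>
proof (induction "card {q\<in>Q. l q > 0}" arbitrary: l z z' y f rule: less_induct)
  case less
  note l = less.prems(1) and zz = less.prems(2-6) and y = less.prems(7,8) and f = less.prems(9-12)
  have QP: "Q \<subseteq> P" using P hull_subset by metis
  show ?case
  proof (cases "{q\<in>Q. l q > 0} = {}")
    case True
    then have "\<forall>x\<in>P. l x \<le> 0" using affine_linear_nonpos_hull[OF l, of Q] P by force
    then show ?thesis using True by (intro exI[of _ "\<lambda>_. 0"]) (force intro: hinge_sum.zero)
  next
    case False
    \<comment> \<open>With the least quotient of \<open>f\<close> by \<open>l\<close> as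
      coefficient, the multiple of \<open>l\<close> touches \<open>f\<close> at \<open>q\<close> and
      stays below \<open>f\<close> at every sample point of the cap.\<close>
    obtain q where q: "q \<in> Q" "l q > 0" and qmin: "\<And>x. x \<in> Q \<Longrightarrow> l x > 0 \<Longrightarrow> f q / l q \<le> f x / l x"
      using ex_is_arg_min_if_finite[OF _ False, of "\<lambda>x. f x / l x"] fin
      by (auto simp: is_arg_min_linorder)
    define c where "c = f q / l q"
    have c: "c \<ge> 0" using f(2)[OF q] q by (simp add: c_def)
    define f' where "f' = (\<lambda>x. f x - c * l x)"
    have f'c: "convex_on P f'"
      unfolding f'_def by (intro convex_on_diff_affine_linear f affine_linear_cmult l)
    have f'z: "f' z = 0" "f' z' = 0" "f' q = 0" using zz f q by (simp_all add: f'_def c_def)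
    have f'n: "f' x \<ge> 0" if "x \<in> Q" "l x > 0" for x
      using qmin[OF that] that by (simp add: f'_def c_def field_simps)
    from q(2) have "l q \<noteq> 0" by simp
    from barycentric_real2[OF l zz(4,5,3) this] obtain l1 l2 where l12: "affine_linear l1" "affine_linear l2"
      and v1: "l1 z = 0" "l1 q = 0" "l1 z' = -1" and v2: "l2 z' = 0" "l2 q = 0" "l2 z = -1"
      and rep: "\<And>x. x = (l x / l q) *\<^sub>R q + (- l1 x) *\<^sub>R z' + (- l2 x) *\<^sub>R z"
      and sm: "\<And>x. l x / l q + - l1 x + - l2 x = 1" by blast
    have urep: "u x = (l x / l q) * u q + (- l1 x) * u z' + (- l2 x) * u z" if "affine_linear u" for u x
      using arg_cong[OF rep, of u x] affine_linear_combination[OF that sm[of x], of q z' z] by (rule trans)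
    \<comment> \<open>A function supporting \<open>P\<close> that vanishes at both \<open>z\<close>
      and \<open>z'\<close> would be a positive multiple of \<open>l\<close>, hence negative at
      \<open>y\<close>. This is the purpose of the point \<open>y\<close> on the far side of the
      chord.\<close>
    have no_supp: False if u: "affine_linear u" "u z = 0" "u z' = 0" "\<forall>x\<in>P. 0 \<le> u x" "\<exists>x. u x \<noteq> 0" for u
    proof -
      have ux: "u x = (l x / l q) * u q" for x using urep[OF u(1), of x] unfolding u(2,3) by simp
      have "u q \<noteq> 0"
      proof
        assume "u q = 0"
        then have "u x = 0" for x using ux[of x] by (metis mult_zero_right)
        then show False using u(5) by blast
      qed
      then have "u q > 0" using u(4) q QP by force
      then have "l y / l q * u q < 0" using y q by (intro mult_neg_pos divide_neg_pos)
      then have "u y < 0" using ux[of y] by (rule back_subst[where P="\<lambda>t. t < 0", OF _ sym])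
      then show False using u(4) y by force
    qed
    \<comment> \<open>The two new caps are disjoint: at a point beyond both chords, the supporting
      function at \<open>q\<close> yields three nonnegative terms with sum zero.\<close>
    have sep: "l1 x \<le> 0 \<or> l2 x \<le> 0" if x: "x \<in> P" for x
    proof (rule ccontr)
      assume "\<not> ?thesis"
      then have pos: "l1 x > 0" "l2 x > 0" by auto
      obtain u where u: "affine_linear u" "u q = 0" "\<forall>x\<in>P. 0 \<le> u x" "\<exists>x. u x \<noteq> 0"
        using supp q(1) by blast
      have "u x + l1 x * u z' + l2 x * u z = 0" using urep[OF u(1), of x] unfolding u(2) by simp
      moreover have "u x \<ge> 0" "u z' \<ge> 0" "u z \<ge> 0" using u(3) x zz QP by auto
      ultimately have "l1 x * u z' = 0" "l2 x * u z = 0"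
        using mult_nonneg_nonneg[of "l1 x" "u z'"] mult_nonneg_nonneg[of "l2 x" "u z"] pos by linarith+
      then have "u z = 0" "u z' = 0" using pos by simp_all
      then show False using no_supp[OF u(1)] u(3,4) by blast
    qed
    \<comment> \<open>Each new cap lies inside the old one. The argument is the same with the
      supporting function at the end \<open>w\<close> of the chord, and it is stated for both chords
      at once.\<close>
    have low: "m1 x \<le> 0" if x: "x \<in> P" "l x \<le> 0" and w: "w \<in> Q" "w' \<in> Q" and m: "m1 = l1 \<and> m2 = l2 \<and> w = z \<and> w' = z'
       \<or> m1 = l2 \<and> m2 = l1 \<and> w = z' \<and> w' = z" for x m1 m2 w w'
    proof (rule ccontr)
      assume "\<not> m1 x \<le> 0"
      then have pos: "m1 x > 0" by simp
      obtain u where u: "affine_linear u" "u w = 0" "\<forall>x\<in>P. 0 \<le> u x" "\<exists>x. u x \<noteq> 0"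
        using supp w by blast
      have "u x + (- (l x / l q)) * u q + m1 x * u w' = 0"
        using m
      proof
        assume "m1 = l1 \<and> m2 = l2 \<and> w = z \<and> w' = z'"
        then have e: "m1 = l1" "w' = z'" "u z = 0" using u(2) by auto
        show ?thesis unfolding e(1,2) using urep[OF u(1), of x] unfolding e(3) by linarith
      next
        assume "m1 = l2 \<and> m2 = l1 \<and> w = z' \<and> w' = z"
        then have e: "m1 = l2" "w' = z" "u z' = 0" using u(2) by auto
        show ?thesis unfolding e(1,2) using urep[OF u(1), of x] unfolding e(3) by linarith
      qed
      moreover have "u x \<ge> 0" "u w' \<ge> 0" "u q \<ge> 0" using u(3) x w q QP by auto
      moreover have "- (l x / l q) * u q \<ge> 0" using x q \<open>u q \<ge> 0\<close>
        by (simp add: divide_nonpos_pos mult_nonpos_nonneg)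
      ultimately have "m1 x * u w' = 0"
        using mult_nonneg_nonneg[of "m1 x" "u w'"] pos by linarith
      then have "u w' = 0" using pos by simp
      then have "u z = 0" "u z' = 0" using u(2) m by blast+
      then show False using no_supp[OF u(1)] u(3,4) by blast
    qed
    have low1: "l1 x \<le> 0" "l2 x \<le> 0" if "x \<in> P" "l x \<le> 0" for x
      by (rule low[OF that zz(1,2), of l1 l2], simp) (rule low[OF that zz(2,1), of l2 l1], simp)
    have sub': "{x\<in>Q. m x > 0} \<subset> {x\<in>Q. l x > 0}" if "m q = 0" "\<And>x. x \<in> P \<Longrightarrow> l x \<le> 0 \<Longrightarrow> m x \<le> 0"
      for m :: "real^2 \<Rightarrow> real"
    proof (rule psubsetI)
      show "{x\<in>Q. m x > 0} \<subseteq> {x\<in>Q. l x > 0}"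
      proof safe
        fix x assume "x \<in> Q" "m x > 0"
        then show "l x > 0" using that(2)[of x] QP by force
      qed
      show "{x\<in>Q. m x > 0} \<noteq> {x\<in>Q. l x > 0}"
      proof
        assume "{x\<in>Q. m x > 0} = {x\<in>Q. l x > 0}"
        then have "q \<in> {x\<in>Q. m x > 0}" using q by simp
        then show False using that(1) by simp
      qed
    qed
    note sub = sub'[of l1, OF v1(2) low1(1)] sub'[of l2, OF v2(2) low1(2)]
    have cards: "card {x\<in>Q. l1 x > 0} < card {x\<in>Q. l x > 0}" "card {x\<in>Q. l2 x > 0} < card {x\<in>Q. l x > 0}"
      using sub fin by (auto intro: psubset_card_mono)
    have zq: "z \<noteq> q" "z' \<noteq> q" using zz q by auto
    have "z' \<in> P" "z \<in> P" using zz QP by auto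
    obtain H1 where H1: "hinge_sum H1" "\<forall>x\<in>P. l1 x \<le> 0 \<longrightarrow> H1 x = 0" "\<forall>x\<in>Q. l1 x > 0 \<longrightarrow> H1 x = f' x"
        "\<forall>x\<in>P. l1 x > 0 \<longrightarrow> f' x \<le> H1 x"
    proof -
      have "l1 z' < 0" using v1 by simp
      moreover have "f' x \<ge> 0" if "x \<in> Q" "l1 x > 0" for x
        using f'n[OF that(1)] sub(1) that by blast
      ultimately show thesis
        using less.hyps[OF cards(1) l12(1) zz(1) q(1) zq(1) v1(1,2) \<open>z' \<in> P\<close> _ f'c _ f'z(1,3)] that
        by blast
    qed
    obtain H2 where H2: "hinge_sum H2" "\<forall>x\<in>P. l2 x \<le> 0 \<longrightarrow> H2 x = 0" "\<forall>x\<in>Q. l2 x > 0 \<longrightarrow> H2 x = f' x"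
        "\<forall>x\<in>P. l2 x > 0 \<longrightarrow> f' x \<le> H2 x"
    proof -
      have "l2 z < 0" using v2 by simp
      moreover have "f' x \<ge> 0" if "x \<in> Q" "l2 x > 0" for x
        using f'n[OF that(1)] sub(2) that by blast
      ultimately show thesis
        using less.hyps[OF cards(2) l12(2) zz(2) q(1) zq(2) v2(1,2) \<open>z \<in> P\<close> _ f'c _ f'z(2,3)] that
        by blast
    qed
    define H where "H = (\<lambda>x. c * max 0 (l x) + (H1 x + H2 x))"
    \<comment> \<open>Between the chords \<open>x\<close> lies in the triangle \<open>z\<close>,
      \<open>z'\<close>, \<open>q\<close>, and \<open>f'\<close> vanishes at its corners.\<close>
    have tri: "f' x \<le> 0" if "x \<in> P" "l x > 0" "l1 x \<le> 0" "l2 x \<le> 0" for x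
    proof -
      have "f' ((l x / l q) *\<^sub>R q + (- l1 x) *\<^sub>R z' + (- l2 x) *\<^sub>R z) \<le> 0"
        using that q zz QP f'z sm[of x] by (intro convex_on_nonpos_3[OF f'c]) auto
      then show ?thesis unfolding rep[of x, symmetric] .
    qed
    show ?thesis
    proof (intro exI[of _ H] conjI ballI impI)
      show "hinge_sum H" unfolding H_def by (rule hinge_sum.hinge[OF hinge_sum_add[OF H1(1) H2(1)] l c])
      show "H x = 0" if "x \<in> P" "l x \<le> 0" for x
        using that low1[OF that] H1(2) H2(2) by (simp add: H_def)
      show "H x = f x" if x: "x \<in> Q" "l x > 0" for x
      proof -
        have xP: "x \<in> P" using x QP by auto
        have "H1 x + H2 x = f' x"
        proof (cases "l1 x > 0 \<or> l2 x > 0")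
          case True
          then consider "l1 x > 0" "l2 x \<le> 0" | "l2 x > 0" "l1 x \<le> 0" using sep[OF xP] by fastforce
          then show ?thesis
          proof cases
            case 1
            then have "H1 x = f' x" "H2 x = 0" using H1(3) H2(2) x(1) xP by blast+
            then show ?thesis by simp
          next
            case 2
            then have "H2 x = f' x" "H1 x = 0" using H2(3) H1(2) x(1) xP by blast+
            then show ?thesis by simp
          qed
        next
          case False
          then have n: "l1 x \<le> 0" "l2 x \<le> 0" by simp_all
          then have "H1 x = 0" "H2 x = 0" using H1(2) H2(2) xP by blast+
          then show ?thesis using tri[OF xP x(2) n] f'n[OF x] by simp
        qed
        then show ?thesis using x(2) by (simp add: H_def f'_def)
      qed
      show "f x \<le> H x" if x: "x \<in> P" "l x > 0" for x
      proof -
        have "f' x \<le> H1 x + H2 x"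
        proof -
          consider "l1 x > 0" | "l2 x > 0" | "l1 x \<le> 0" "l2 x \<le> 0" by linarith
          then have "f' x \<le> H1 x \<or> f' x \<le> H2 x \<or> f' x \<le> 0"
            using tri[OF x] H1(4) H2(4) x(1) by cases blast+
          then show ?thesis
            using hinge_sum_nonneg[OF H1(1), of x] hinge_sum_nonneg[OF H2(1), of x] by linarith
        qed
        then show ?thesis using x(2) by (simp add: H_def f'_def)
      qed
    qed
  qed
qed

text \<open>The recursion on caps needs a point of \<open>P\<close> on the far side of the chord, so
  it cannot start at an edge. Instead \<open>T\<close> interpolates \<open>f\<close> at
  \<open>z\<close>, \<open>z'\<close> on the edge and at a third point \<open>q\<close>; the
  coefficient of \<open>l\<close> in \<open>T\<close> may have either sign, because \<open>T\<close>
  is not a hinge. The rest of the work happens in the caps beyond the chords from \<open>q\<close>.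
  The hypothesis \<open>edge\<close> says that \<open>z\<close> is an extreme sample point on its
  line and \<open>z'\<close> the one next to it.\<close>

lemma hinge_interpolation:
  fixes P Q :: "(real^2) set"
  assumes fin: "finite Q" and P: "P = convex hull Q"
    and supp: "\<And>q. q \<in> Q \<Longrightarrow> \<exists>u. affine_linear u \<and> u q = 0 \<and> (\<forall>x\<in>P. 0 \<le> u x) \<and> (\<exists>x. u x \<noteq> 0)"
    and l: "affine_linear l" "\<And>x. x \<in> P \<Longrightarrow> 0 \<le> l x"
    and zz: "z \<in> Q" "z' \<in> Q" "z \<noteq> z'" "l z = 0" "l z' = 0"
    and q0: "q0 \<in> Q" "l q0 \<noteq> 0"
    and edge: "\<And>q. q \<in> Q \<Longrightarrow> l q = 0 \<Longrightarrow> q \<noteq> z \<Longrightarrow> \<exists>t\<ge>1. q = z + t *\<^sub>R (z' - z)"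
    and f: "convex_on P f"
  obtains T H where "affine_linear T" "hinge_sum H" "\<And>q. q \<in> Q \<Longrightarrow> f q = T q + H q"
    "\<And>x. x \<in> P \<Longrightarrow> f x \<le> T x + H x"
proof -
  have QP: "Q \<subseteq> P" using P hull_subset by metis
  obtain m1 m2 where m: "affine_linear m1" "affine_linear m2" "m1 z = 0" "m1 z' = -1" "m2 z' = 0" "m2 z = -1"
    using barycentric_real2[OF l(1) zz(4,5,3) q0(2)] by metis
  define T0 where "T0 = (\<lambda>x. (- f z') * m1 x + (- f z) * m2 x)"
  have T0: "affine_linear T0" "T0 z = f z" "T0 z' = f z'"
    unfolding T0_def by (intro affine_linear_add affine_linear_cmult m) (simp_all add: m)
  have ne: "{x\<in>Q. l x > 0} \<noteq> {}" using q0 l(2)[of q0] QP by force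
  obtain q where q: "q \<in> Q" "l q > 0"
    and qmin: "\<And>x. x \<in> Q \<Longrightarrow> l x > 0 \<Longrightarrow> (f q - T0 q) / l q \<le> (f x - T0 x) / l x"
    using ex_is_arg_min_if_finite[OF _ ne, of "\<lambda>x. (f x - T0 x) / l x"] fin
    by (auto simp: is_arg_min_linorder)
  define c where "c = (f q - T0 q) / l q"
  define T where "T = (\<lambda>x. T0 x + c * l x)"
  have T: "affine_linear T" unfolding T_def by (intro affine_linear_add T0 affine_linear_cmult l)
  define f' where "f' = (\<lambda>x. f x - T x)"
  have f'c: "convex_on P f'" unfolding f'_def by (rule convex_on_diff_affine_linear[OF f T])
  have f'z: "f' z = 0" "f' z' = 0" "f' q = 0" using zz T0 q by (simp_all add: f'_def T_def c_def)
  have f'n: "f' x \<ge> 0" if x: "x \<in> Q" for x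
  proof (cases "l x > 0")
    case True
    then show ?thesis using qmin[OF x True] by (simp add: f'_def T_def c_def field_simps)
  next
    case False
    then have lx: "l x = 0" using l(2)[of x] x QP by force
    show ?thesis
    proof (cases "x = z")
      case True
      then show ?thesis using f'z by simp
    next
      case False
      \<comment> \<open>The point \<open>z'\<close> lies between \<open>z\<close> and
        \<open>x\<close>. As \<open>f'\<close> vanishes at \<open>z\<close> and \<open>z'\<close>,
        convexity makes it nonnegative at \<open>x\<close>.\<close>
      then obtain t where t: "t \<ge> 1" "x = z + t *\<^sub>R (z' - z)" using edge[OF x lx] by blast
      have "(1/t) *\<^sub>R x = (1/t) *\<^sub>R z + (z' - z)" using t(1) by (simp add: t(2) scaleR_add_right)
      then have zeq: "z' = (1 - 1/t) *\<^sub>R z + (1/t) *\<^sub>R x" by (simp add: scaleR_diff_left)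
      have "f' ((1 - 1/t) *\<^sub>R z + (1/t) *\<^sub>R x) \<le> (1 - 1/t) * f' z + (1/t) * f' x"
        by (rule convex_onD[OF f'c]) (use t zz x QP in auto)
      then have "f' z' \<le> (1 - 1/t) * f' z + (1/t) * f' x" by (simp only: zeq[symmetric])
      then show ?thesis using t(1) unfolding f'z(1,2) by (simp add: zero_le_divide_iff)
    qed
  qed
  from q(2) have "l q \<noteq> 0" by simp
  from barycentric_real2[OF l(1) zz(4,5,3) this] obtain l1 l2 where l12: "affine_linear l1" "affine_linear l2"
    and v1: "l1 z = 0" "l1 q = 0" "l1 z' = -1" and v2: "l2 z' = 0" "l2 q = 0" "l2 z = -1"
    and rep: "\<And>x. x = (l x / l q) *\<^sub>R q + (- l1 x) *\<^sub>R z' + (- l2 x) *\<^sub>R z"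
    and sm: "\<And>x. l x / l q + - l1 x + - l2 x = 1" by blast
  have urep: "u x = (l x / l q) * u q + (- l1 x) * u z' + (- l2 x) * u z" if "affine_linear u" for u x
    using arg_cong[OF rep, of u x] affine_linear_combination[OF that sm[of x], of q z' z] by (rule trans)
  have sep: "l1 x \<le> 0 \<or> l2 x \<le> 0" if x: "x \<in> P" for x
  proof (rule ccontr)
    assume "\<not> ?thesis"
    then have pos: "l1 x > 0" "l2 x > 0" by auto
    obtain u where u: "affine_linear u" "u q = 0" "\<forall>x\<in>P. 0 \<le> u x" "\<exists>x. u x \<noteq> 0"
      using supp q(1) by blast
    have "u x + l1 x * u z' + l2 x * u z = 0" using urep[OF u(1), of x] unfolding u(2) by simp
    moreover have "u x \<ge> 0" "u z' \<ge> 0" "u z \<ge> 0" using u(3) x zz QP by auto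
    ultimately have "l1 x * u z' = 0" "l2 x * u z = 0"
      using mult_nonneg_nonneg[of "l1 x" "u z'"] mult_nonneg_nonneg[of "l2 x" "u z"] pos by linarith+
    then have u0: "u z = 0" "u z' = 0" using pos by simp_all
    have "u y = 0" for y using urep[OF u(1), of y] unfolding u(2) u0 by simp
    then show False using u(4) by blast
  qed
  have zq: "z \<noteq> q" "z' \<noteq> q" using zz q by auto
  have PP: "z' \<in> P" "z \<in> P" using zz QP by auto
  obtain H1 where H1: "hinge_sum H1" "\<forall>x\<in>P. l1 x \<le> 0 \<longrightarrow> H1 x = 0" "\<forall>x\<in>Q. l1 x > 0 \<longrightarrow> H1 x = f' x"
      "\<forall>x\<in>P. l1 x > 0 \<longrightarrow> f' x \<le> H1 x"
  proof -
    have "l1 z' < 0" using v1 by simp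
    then show thesis
      using cap_interpolation[OF fin P supp l12(1) zz(1) q(1) zq(1) v1(1,2) PP(1) _ f'c f'n f'z(1,3)] that
      by blast
  qed
  obtain H2 where H2: "hinge_sum H2" "\<forall>x\<in>P. l2 x \<le> 0 \<longrightarrow> H2 x = 0" "\<forall>x\<in>Q. l2 x > 0 \<longrightarrow> H2 x = f' x"
      "\<forall>x\<in>P. l2 x > 0 \<longrightarrow> f' x \<le> H2 x"
  proof -
    have "l2 z < 0" using v2 by simp
    then show thesis
      using cap_interpolation[OF fin P supp l12(2) zz(2) q(1) zq(2) v2(1,2) PP(2) _ f'c f'n f'z(2,3)] that
      by blast
  qed
  have tri: "f' x \<le> 0" if "x \<in> P" "l1 x \<le> 0" "l2 x \<le> 0" for x
  proof -
    have "f' ((l x / l q) *\<^sub>R q + (- l1 x) *\<^sub>R z' + (- l2 x) *\<^sub>R z) \<le> 0"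
      using that q zz QP f'z sm[of x] l(2)[OF that(1)] by (intro convex_on_nonpos_3[OF f'c]) auto
    then show ?thesis unfolding rep[of x, symmetric] .
  qed
  show thesis
  proof (rule that[OF T hinge_sum_add[OF H1(1) H2(1)]])
    fix x assume x: "x \<in> Q"
    then have xP: "x \<in> P" using QP by auto
    have "H1 x + H2 x = f' x"
    proof (cases "l1 x > 0 \<or> l2 x > 0")
      case True
      then consider "l1 x > 0" "l2 x \<le> 0" | "l2 x > 0" "l1 x \<le> 0" using sep[OF xP] by fastforce
      then show ?thesis
      proof cases
        case 1
        then have "H1 x = f' x" "H2 x = 0" using H1(3) H2(2) x(1) xP by blast+
        then show ?thesis by simp
      next
        case 2
        then have "H2 x = f' x" "H1 x = 0" using H2(3) H1(2) x(1) xP by blast+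
        then show ?thesis by simp
      qed
    next
      case False
      then have n: "l1 x \<le> 0" "l2 x \<le> 0" by simp_all
      then have "H1 x = 0" "H2 x = 0" using H1(2) H2(2) xP by blast+
      then show ?thesis using tri[OF xP n] f'n[OF x] by simp
    qed
    then show "f x = T x + (H1 x + H2 x)" by (simp add: f'_def)
  next
    fix x assume x: "x \<in> P"
    have "f' x \<le> H1 x + H2 x"
    proof -
      consider "l1 x > 0" | "l2 x > 0" | "l1 x \<le> 0" "l2 x \<le> 0" by linarith
      then have "f' x \<le> H1 x \<or> f' x \<le> H2 x \<or> f' x \<le> 0"
        using tri[OF x] H1(4) H2(4) x(1) by cases blast+
      then show ?thesis
        using hinge_sum_nonneg[OF H1(1), of x] hinge_sum_nonneg[OF H2(1), of x] by linarith
    qed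
    then show "f x \<le> T x + (H1 x + H2 x)" by (simp add: f'_def)
  qed
qed

section \<open>Moment polygons\<close>

lemma inner_real2: "(x::real^2) \<bullet> y = x$1 * y$1 + x$2 * y$2"
  by (simp add: inner_vec_def sum_2)

lemma rot90_inner_rot90: "rot90 h \<bullet> rot90 h = h \<bullet> h"
  by (simp add: rot90_def inner_real2)

lemma rot90_decomposition:
  assumes "h \<noteq> 0"
  shows "x = ((h \<bullet> x) / (h \<bullet> h)) *\<^sub>R h + ((rot90 h \<bullet> x) / (h \<bullet> h)) *\<^sub>R rot90 h"
proof -
  have nz: "h$1 * h$1 + h$2 * h$2 \<noteq> 0"
    using assms by (metis inner_eq_zero_iff inner_real2)
  show ?thesis
    unfolding vec_eq_iff forall_2 using nz
    by (auto simp: rot90_def inner_real2 divide_simps) (simp_all add: algebra_simps)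
qed

section \<open>Edges of the polygon as parameter intervals\<close>

locale moment =
  fixes N :: nat and h :: "nat \<Rightarrow> real^2" and c :: "nat \<Rightarrow> real"
  assumes moment_polygon: "moment_polygon N h c"
begin

abbreviation P :: "(real^2) set" where "P \<equiv> polygon N h c"

abbreviation E :: "nat \<Rightarrow> (real^2) set" where "E \<equiv> edge N h c"

text \<open>The parametrisation by which \<open>edge_measure\<close> is defined; it turns boundary
  integrals into integrals over intervals.\<close>

definition \<gamma> :: "nat \<Rightarrow> real \<Rightarrow> real^2" where
  "\<gamma> k t = (c k / (h k \<bullet> h k)) *\<^sub>R h k + t *\<^sub>R rot90 (h k)"

lemma P_iff: "x \<in> P \<longleftrightarrow> (\<forall>k<N. c k \<le> h k \<bullet> x)"
  by (simp add: polygon_def)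

lemma P_Inter: "P = (\<Inter>k\<in>{..<N}. {x. h k \<bullet> x \<ge> c k})"
  by (auto simp: polygon_def)

lemma convex_P: "convex P"
  unfolding P_Inter by (intro convex_INT convex_halfspace_ge)

lemma closed_P: "closed P"
  unfolding P_Inter by (intro closed_INT ballI closed_halfspace_ge)

lemma compact_P: "compact P"
  using closed_P moment_polygon by (simp add: compact_eq_bounded_closed moment_polygon_def)

lemma interior_P: "interior P \<noteq> {}" and bounded_P: "bounded P"
  using moment_polygon by (simp_all add: moment_polygon_def)

lemma P_nonempty: "P \<noteq> {}" using interior_P interior_subset by blast

lemma h_nonzero: assumes "k < N" shows "h k \<noteq> 0"
proof
  assume "h k = 0"
  obtain p q :: int where "h k = vector [of_int p, of_int q]" "coprime p q"
    using moment_polygon assms unfolding moment_polygon_def primitive_covector_def by blast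
  then have "p = 0" "q = 0" "coprime p q" using \<open>h k = 0\<close> by (auto simp: vec_eq_iff forall_2)
  then show False by simp
qed

lemma h_pos: "k < N \<Longrightarrow> h k \<bullet> h k > 0" using h_nonzero by simp

lemma inner_gamma: "k < N \<Longrightarrow> h k \<bullet> \<gamma> k t = c k"
  using h_nonzero by (simp add: \<gamma>_def inner_add_right inner_rot90)

lemma inner_gamma_diff: "x \<bullet> \<gamma> k s - x \<bullet> \<gamma> k t = (s - t) * (x \<bullet> rot90 (h k))"
  by (simp add: \<gamma>_def algebra_simps)

lemma gamma_affine: "u + v = 1 \<Longrightarrow> \<gamma> k (u * s + v * t) = u *\<^sub>R \<gamma> k s + v *\<^sub>R \<gamma> k t"
proof -
  assume uv: "u + v = 1"
  define w where "w = (c k / (h k \<bullet> h k)) *\<^sub>R h k"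
  have "u *\<^sub>R w + v *\<^sub>R w = w" using uv by (metis scaleR_add_left scaleR_one)
  then show ?thesis unfolding \<gamma>_def w_def[symmetric] by (simp add: algebra_simps)
qed

lemma gamma_inj: "k < N \<Longrightarrow> \<gamma> k s = \<gamma> k t \<longleftrightarrow> s = t"
  using h_nonzero[of k] rot90_inner_rot90[of "h k"] by (auto simp: \<gamma>_def)

lemma on_line: assumes "k < N" "h k \<bullet> x = c k" obtains t where "x = \<gamma> k t"
  using rot90_decomposition[OF h_nonzero[OF assms(1)], of x] assms(2) that by (auto simp: \<gamma>_def)

lemma continuous_gamma: "continuous_on S (\<gamma> k)"
  unfolding \<gamma>_def by (intro continuous_intros)

lemma E_facet: "k < N \<Longrightarrow> E k facet_of P"
  using moment_polygon by (simp add: moment_polygon_def)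

text \<open>Closedness, boundedness and convexity of \<open>P\<close> give a compact interval; a
  facet of a polygon with interior has affine dimension 1, which excludes anything smaller.\<close>

lemma gamma_preimage: assumes k: "k < N" shows "\<exists>a b. a < b \<and> {t. \<gamma> k t \<in> P} = {a..b}"
proof -
  define S where "S = {t. \<gamma> k t \<in> P}"
  have S: "S = \<gamma> k -` P" by (auto simp: S_def)
  have clo: "closed S" unfolding S by (intro continuous_closed_vimage closed_P)
    (use continuous_gamma[of UNIV k] in \<open>simp add: continuous_on_eq_continuous_at\<close>)
  obtain B where B: "\<And>x. x \<in> P \<Longrightarrow> norm x \<le> B" using bounded_P by (auto simp: bounded_iff)
  have "norm t \<le> B * norm (rot90 (h k)) / (h k \<bullet> h k)" if "t \<in> S" for t
  proof -
    have "rot90 (h k) \<bullet> \<gamma> k t = t * (h k \<bullet> h k)"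
      using inner_rot90[of "h k"] by (simp add: \<gamma>_def inner_add_right rot90_inner_rot90 inner_commute)
    then have "\<bar>t * (h k \<bullet> h k)\<bar> \<le> norm (rot90 (h k)) * norm (\<gamma> k t)"
      using Cauchy_Schwarz_ineq2 by metis
    also have "\<dots> \<le> norm (rot90 (h k)) * B" using B that by (intro mult_left_mono) (auto simp: S_def)
    finally show ?thesis using h_pos[OF k] by (simp add: abs_mult field_simps)
  qed
  then have "bounded S" unfolding bounded_iff by blast
  then have comp: "compact S" using clo by (simp add: compact_eq_bounded_closed)
  have "convex S"
    unfolding convex_alt S_def
  proof clarify
    fix s t u :: real assume "\<gamma> k s \<in> P" "\<gamma> k t \<in> P" "0 \<le> u" "u \<le> 1"
    then show "\<gamma> k ((1 - u) *\<^sub>R s + u *\<^sub>R t) \<in> P"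
      using gamma_affine[of "1 - u" u k s t] convexD[OF convex_P, of "\<gamma> k s" "\<gamma> k t" "1 - u" u] by simp
  qed
  then obtain a b where ab: "S = {a..b}"
    using comp connected_compact_interval_1[of S] convex_connected by (auto simp: cbox_interval)
  have Eim: "E k = \<gamma> k ` S"
  proof
    show "E k \<subseteq> \<gamma> k ` S"
    proof
      fix x assume "x \<in> E k"
      then have x: "x \<in> P" "h k \<bullet> x = c k" by (auto simp: edge_def)
      obtain t where "x = \<gamma> k t" using on_line[OF k x(2)] .
      then show "x \<in> \<gamma> k ` S" using x(1) by (simp add: S_def)
    qed
    show "\<gamma> k ` S \<subseteq> E k" using inner_gamma[OF k] by (auto simp: edge_def S_def)
  qed
  have ad: "aff_dim (E k) = 1" "E k \<noteq> {}"
    using E_facet[OF k] aff_dim_nonempty_interior[OF interior_P] by (auto simp: facet_of_def)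
  have "a < b"
  proof (rule ccontr)
    assume "\<not> a < b"
    then have "S \<subseteq> {a}" by (auto simp: ab)
    then have "E k \<subseteq> {\<gamma> k a}" using Eim by auto
    then have "aff_dim (E k) \<le> aff_dim {\<gamma> k a}" by (rule aff_dim_subset)
    then show False using ad by simp
  qed
  then show ?thesis using ab S_def by blast
qed

definition lo :: "nat \<Rightarrow> real" where "lo k = Inf {t. \<gamma> k t \<in> P}"
definition hi :: "nat \<Rightarrow> real" where "hi k = Sup {t. \<gamma> k t \<in> P}"

lemma lo_hi: assumes k: "k < N" shows "lo k < hi k" "\<gamma> k t \<in> P \<longleftrightarrow> lo k \<le> t \<and> t \<le> hi k"
proof -
  obtain a b where ab: "a < b" "{t. \<gamma> k t \<in> P} = {a..b}" using gamma_preimage[OF k] by blast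
  then have "lo k = a" "hi k = b" by (simp_all add: lo_def hi_def)
  then show "lo k < hi k" "\<gamma> k t \<in> P \<longleftrightarrow> lo k \<le> t \<and> t \<le> hi k" using ab by auto
qed

lemma E_eq: assumes k: "k < N" shows "E k = \<gamma> k ` {lo k..hi k}"
proof
  show "E k \<subseteq> \<gamma> k ` {lo k..hi k}"
  proof
    fix x assume "x \<in> E k"
    then have x: "x \<in> P" "h k \<bullet> x = c k" by (auto simp: edge_def)
    obtain t where "x = \<gamma> k t" using on_line[OF k x(2)] .
    then show "x \<in> \<gamma> k ` {lo k..hi k}" using x(1) lo_hi(2)[OF k] by simp
  qed
  show "\<gamma> k ` {lo k..hi k} \<subseteq> E k"
    using inner_gamma[OF k] lo_hi(2)[OF k] by (simp add: edge_def image_subset_iff)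
qed

lemma E_subset: "E k \<subseteq> P" by (auto simp: edge_def)

lemma gamma_in_E: "k < N \<Longrightarrow> \<gamma> k t \<in> E k \<longleftrightarrow> lo k \<le> t \<and> t \<le> hi k"
  using inner_gamma[of k t] lo_hi(2)[of k t] by (simp add: edge_def)

lemma extreme_point_E:
  assumes k: "k < N" shows "\<gamma> k t extreme_point_of E k \<longleftrightarrow> t = lo k \<or> t = hi k"
proof
  assume ex: "\<gamma> k t extreme_point_of E k"
  then have t: "lo k \<le> t" "t \<le> hi k" using gamma_in_E[OF k] by (auto simp: extreme_point_of_def)
  show "t = lo k \<or> t = hi k"
  proof (rule ccontr)
    assume "\<not> ?thesis"
    then have t': "lo k < t" "t < hi k" using t by auto
    define u where "u = (t - lo k) / (hi k - lo k)"
    have u: "0 < u" "u < 1" "t = (1 - u) * lo k + u * hi k"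
    proof -
      have "u * (hi k - lo k) = t - lo k" using t' by (simp add: u_def)
      then show "t = (1 - u) * lo k + u * hi k" by (simp add: algebra_simps)
    qed (use t' in \<open>auto simp: u_def\<close>)
    then have "\<gamma> k t = (1 - u) *\<^sub>R \<gamma> k (lo k) + u *\<^sub>R \<gamma> k (hi k)"
      using gamma_affine[of "1 - u" u] by simp
    moreover have "\<gamma> k (lo k) \<noteq> \<gamma> k (hi k)" using gamma_inj[OF k] lo_hi(1)[OF k] by simp
    ultimately have "\<gamma> k t \<in> open_segment (\<gamma> k (lo k)) (\<gamma> k (hi k))"
      using u by (auto simp: in_segment)
    moreover have "\<gamma> k (lo k) \<in> E k" "\<gamma> k (hi k) \<in> E k"
      using gamma_in_E[OF k] lo_hi(1)[OF k] by simp_all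
    moreover have "\<forall>a\<in>E k. \<forall>b\<in>E k. \<gamma> k t \<notin> open_segment a b"
      using ex by (simp add: extreme_point_of_def)
    ultimately show False by meson
  qed
next
  assume t: "t = lo k \<or> t = hi k"
  show "\<gamma> k t extreme_point_of E k"
    unfolding extreme_point_of_def
  proof (rule conjI, goal_cases)
    case 1
    show ?case using t lo_hi(1)[OF k] gamma_in_E[OF k, of t] by linarith
  next
    case 2
    show ?case
    proof (rule ballI, rule ballI, rule notI)
    fix a b assume ab: "a \<in> E k" "b \<in> E k" "\<gamma> k t \<in> open_segment a b"
    then obtain r s where r: "a = \<gamma> k r" "lo k \<le> r" "r \<le> hi k" and s: "b = \<gamma> k s" "lo k \<le> s" "s \<le> hi k"
      unfolding E_eq[OF k] by auto
    obtain u where u: "0 < u" "u < 1" "\<gamma> k t = (1 - u) *\<^sub>R a + u *\<^sub>R b" "a \<noteq> b"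
      using ab(3) by (auto simp: in_segment)
    then have "\<gamma> k t = \<gamma> k ((1 - u) * r + u * s)" using gamma_affine[of "1 - u" u] r s by simp
    then have teq: "t = (1 - u) * r + u * s" using gamma_inj[OF k] by blast
    have "r \<noteq> s" using u(4) unfolding r(1) s(1) by blast
    have sum0: "(1 - u) * (r - t) + u * (s - t) = 0" using teq by (simp add: algebra_simps)
    from t have "(1 - u) * (r - t) = 0 \<and> u * (s - t) = 0"
    proof
      assume "t = lo k"
      then have "(1 - u) * (r - t) \<ge> 0" "u * (s - t) \<ge> 0"
        using u(1,2) r(2) s(2) by (auto intro!: mult_nonneg_nonneg)
      then show ?thesis using sum0 by linarith
    next
      assume "t = hi k"
      then have "(1 - u) * (r - t) \<le> 0" "u * (s - t) \<le> 0"
        using u(1,2) r(3) s(3) by (auto intro!: mult_nonneg_nonpos)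
      then show ?thesis using sum0 by linarith
    qed
    then have "r = t" "s = t" using u(1,2) by simp_all
    then show False using \<open>r \<noteq> s\<close> by simp
  qed
  qed
qed

lemma extreme_point_P:
  assumes k: "k < N" shows "\<gamma> k t extreme_point_of P \<longleftrightarrow> t = lo k \<or> t = hi k"
proof -
  have "E k face_of P" using E_facet[OF k] by (simp add: facet_of_def)
  then have "\<gamma> k t extreme_point_of E k \<longleftrightarrow> \<gamma> k t extreme_point_of P \<and> \<gamma> k t \<in> E k"
    by (rule extreme_point_of_face)
  moreover have "\<gamma> k t extreme_point_of P \<Longrightarrow> \<gamma> k t \<in> E k"
    using inner_gamma[OF k] by (simp add: extreme_point_of_def edge_def)
  ultimately show ?thesis using extreme_point_E[OF k] by blast
qed

text \<open>By the Delzant condition a vertex lies on some listed edge, and there it can only be an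
  endpoint.\<close>

lemma extreme_point_obtain:
  assumes "v extreme_point_of P" obtains k where "k < N" "v = \<gamma> k (lo k) \<or> v = \<gamma> k (hi k)"
proof -
  obtain i j where "{k. k < N \<and> v \<in> E k} = {i, j}"
    using assms moment_polygon unfolding moment_polygon_def by blast
  then have "i \<in> {k. k < N \<and> v \<in> E k}" by simp
  then have i: "i < N" "v \<in> E i" by simp_all
  then obtain t where "v = \<gamma> i t" unfolding E_eq[OF i(1)] by blast
  with assms have "t = lo i \<or> t = hi i" using extreme_point_P[OF i(1), of t] by simp
  then show thesis using that[OF i(1)] \<open>v = \<gamma> i t\<close> by blast
qed

lemma lattice_vertex:
  assumes "k < N" shows "lattice_point (\<gamma> k (lo k))" "lattice_point (\<gamma> k (hi k))"
  using extreme_point_P[OF assms] moment_polygon unfolding moment_polygon_def by blast+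

lemma P_hull: "P = convex hull {x. x extreme_point_of P}"
  by (rule Krein_Milman_Minkowski[OF compact_P convex_P])

text \<open>Two common points make the conormals proportional, so the two edges are the same set,
  and the enumeration of the edges is injective.\<close>

lemma edge_unique:
  assumes ij: "i < N" "j < N" and st: "s \<noteq> t" and "\<gamma> i s \<in> E j" "\<gamma> i t \<in> E j"
  shows "i = j"
proof -
  have e: "h j \<bullet> \<gamma> i s = c j" "h j \<bullet> \<gamma> i t = c j" using assms by (auto simp: edge_def)
  then have "(s - t) * (h j \<bullet> rot90 (h i)) = 0" using inner_gamma_diff[of "h j" i s t] by simp
  then have o: "rot90 (h i) \<bullet> h j = 0" using st by (simp add: inner_commute)
  define m where "m = (h i \<bullet> h j) / (h i \<bullet> h i)"
  have hj: "h j = m *\<^sub>R h i"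
    using rot90_decomposition[OF h_nonzero[OF ij(1)], of "h j"] o by (simp add: m_def)
  then have m: "m \<noteq> 0" using h_nonzero[OF ij(2)] by auto
  have cj: "c j = m * c i" using e(1) inner_gamma[OF ij(1), of s] by (simp add: hj)
  have "E i = E j" using m by (auto simp: edge_def hj cj)
  then show ?thesis using moment_polygon ij by (auto simp: moment_polygon_def inj_on_def)
qed

text \<open>The exit time is the smallest quotient of slack by speed among the inequalities that
  decrease along \<open>v\<close>; boundedness of \<open>P\<close> provides at least one. The strict
  sign in \<open>h k \<bullet> v < 0\<close> records that the ray leaves transversally.\<close>

lemma ray_exit:
  assumes x: "x \<in> P" and v: "v \<noteq> 0"
  obtains t k where "t \<ge> 0" "k < N" "x + t *\<^sub>R v \<in> E k" "h k \<bullet> v < 0"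
proof -
  define K where "K = {k. k < N \<and> h k \<bullet> v < 0}"
  have "K \<noteq> {}"
  proof
    assume "K = {}"
    then have nn: "h k \<bullet> v \<ge> 0" if "k < N" for k using that by (force simp: K_def)
    obtain B where B: "\<And>x. x \<in> P \<Longrightarrow> norm x \<le> B" using bounded_P by (auto simp: bounded_iff)
    define t where "t = (B + norm x + 1) / norm v"
    have "B \<ge> 0" using B[OF x] norm_ge_zero order_trans by blast
    then have t: "t \<ge> 0" by (simp add: t_def)
    have "x + t *\<^sub>R v \<in> P" using x t nn unfolding P_iff by (simp add: inner_add_right add_increasing2)
    then have "norm (x + t *\<^sub>R v) \<le> B" by (rule B)
    moreover have "norm (t *\<^sub>R v) \<le> norm (x + t *\<^sub>R v) + norm x"
      using norm_triangle_ineq4[of "x + t *\<^sub>R v" x] by simp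
    moreover have "norm (t *\<^sub>R v) = B + norm x + 1" using v \<open>B \<ge> 0\<close> by (simp add: t_def)
    ultimately show False by simp
  qed
  moreover have "finite K" by (simp add: K_def)
  ultimately obtain k where k: "k \<in> K"
    and kmin: "\<And>j. j \<in> K \<Longrightarrow> (h k \<bullet> x - c k) / (- (h k \<bullet> v)) \<le> (h j \<bullet> x - c j) / (- (h j \<bullet> v))"
    using ex_is_arg_min_if_finite[of K "\<lambda>k. (h k \<bullet> x - c k) / (- (h k \<bullet> v))"]
    unfolding is_arg_min_linorder by blast
  define t where "t = (h k \<bullet> x - c k) / (- (h k \<bullet> v))"
  have kN: "k < N" "h k \<bullet> v < 0" using k by (auto simp: K_def)
  have t: "t \<ge> 0" using x kN unfolding P_iff t_def by (simp add: divide_nonneg_neg)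
  have "x + t *\<^sub>R v \<in> P" unfolding P_iff
  proof (intro allI impI)
    fix j assume j: "j < N"
    show "c j \<le> h j \<bullet> (x + t *\<^sub>R v)"
    proof (cases "j \<in> K")
      case True
      then have "0 < - (h j \<bullet> v)" by (simp add: K_def)
      moreover have "t \<le> (h j \<bullet> x - c j) / (- (h j \<bullet> v))" using kmin[OF True] by (simp add: t_def)
      ultimately have "t * (- (h j \<bullet> v)) \<le> h j \<bullet> x - c j"
        by (rule pos_le_divide_eq[THEN iffD1])
      then show ?thesis by (simp add: inner_add_right)
    next
      case False
      then have "h j \<bullet> v \<ge> 0" using j by (simp add: K_def)
      then show ?thesis using x j t unfolding P_iff by (simp add: inner_add_right add_increasing2)
    qed
  qed
  moreover have "h k \<bullet> (x + t *\<^sub>R v) = c k" using kN(2) by (simp add: inner_add_right inner_diff_right t_def)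
  ultimately show thesis using that[OF t kN(1) _ kN(2)] by (simp add: edge_def)
qed

end

section \<open>The boundary and area functionals\<close>

lemma set_integrable_compact:
  fixes f :: "'a::euclidean_space \<Rightarrow> real"
  assumes "compact S" "continuous_on S f" shows "set_integrable lborel S f"
  using borel_integrable_compact[OF assms] by (simp add: set_integrable_def)

lemma affine_linear_continuous_on: "affine_linear f \<Longrightarrow> continuous_on S f"
proof -
  assume "affine_linear f"
  then obtain a b where "\<forall>x. f x = a \<bullet> x + b" unfolding affine_linear_def by blast
  then have "f = (\<lambda>x. a \<bullet> x + b)" by auto
  then show ?thesis by (auto intro!: continuous_intros)
qed

context moment
begin

definition J :: "nat \<Rightarrow> (real^2 \<Rightarrow> real) \<Rightarrow> real" where
  "J k f = (LINT t:{lo k..hi k}|lborel. f (\<gamma> k t))"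

definition B :: "(real^2 \<Rightarrow> real) \<Rightarrow> real" where "B f = (\<Sum>k<N. J k f)"

definition V :: "(real^2 \<Rightarrow> real) \<Rightarrow> real" where "V f = (LINT x:P|lborel. f x)"

definition a :: real where "a = B (\<lambda>_. 1) / V (\<lambda>_. 1)"

definition L :: "(real^2 \<Rightarrow> real) \<Rightarrow> real" where "L f = B f - a * V f"

lemma gamma_P: "k < N \<Longrightarrow> lo k \<le> t \<Longrightarrow> t \<le> hi k \<Longrightarrow> \<gamma> k t \<in> P"
  using lo_hi(2) by blast

lemma continuous_on_gamma:
  assumes "continuous_on P f" "k < N" shows "continuous_on {lo k..hi k} (\<lambda>t. f (\<gamma> k t))"
  by (rule continuous_on_compose2[OF assms(1) continuous_gamma]) (use gamma_P[OF assms(2)] in auto)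

lemma set_integrable_gamma:
  fixes f :: "real^2 \<Rightarrow> real"
  assumes "continuous_on P f" "k < N" shows "set_integrable lborel {lo k..hi k} (\<lambda>t. f (\<gamma> k t))"
  by (rule set_integrable_compact[OF compact_Icc continuous_on_gamma[OF assms]])

lemma set_integrable_P:
  fixes f :: "real^2 \<Rightarrow> real"
  shows "continuous_on P f \<Longrightarrow> set_integrable lborel P f"
  by (rule set_integrable_compact[OF compact_P])

lemma J_add: "continuous_on P f \<Longrightarrow> continuous_on P g \<Longrightarrow> k < N \<Longrightarrow> J k (\<lambda>x. f x + g x) = J k f + J k g"
  unfolding J_def by (intro set_integral_add set_integrable_gamma)

lemma J_cmult: "J k (\<lambda>x. r * f x) = r * J k f"
  unfolding J_def by simp

lemma J_mono:
  assumes "continuous_on P f" "continuous_on P g" "k < N" "\<And>x. x \<in> E k \<Longrightarrow> f x \<le> g x"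
  shows "J k f \<le> J k g"
  unfolding J_def
  by (intro set_integral_mono set_integrable_gamma assms) (simp add: gamma_in_E[OF assms(3)])

lemma J_cong:
  assumes "k < N" "\<And>x. x \<in> E k \<Longrightarrow> f x = g x" shows "J k f = J k g"
  unfolding J_def
  by (intro set_lebesgue_integral_cong) (auto simp: gamma_in_E[OF assms(1)] assms(2))

lemma J_const: "k < N \<Longrightarrow> J k (\<lambda>_. r) = (hi k - lo k) * r"
  using lo_hi(1)[of k] by (simp add: J_def set_integral_const)

lemma V_add: "continuous_on P f \<Longrightarrow> continuous_on P g \<Longrightarrow> V (\<lambda>x. f x + g x) = V f + V g"
  unfolding V_def by (intro set_integral_add set_integrable_P)

lemma V_cmult: "V (\<lambda>x. r * f x) = r * V f"
  unfolding V_def by simp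

lemma V_mono:
  assumes "continuous_on P f" "continuous_on P g" "\<And>x. x \<in> P \<Longrightarrow> f x \<le> g x" shows "V f \<le> V g"
  unfolding V_def by (intro set_integral_mono set_integrable_P assms)

lemma V_cong: assumes "\<And>x. x \<in> P \<Longrightarrow> f x = g x" shows "V f = V g"
  unfolding V_def using closed_P by (intro set_lebesgue_integral_cong) (auto simp: assms)

lemma V_const: "V (\<lambda>_. r) = measure lborel P * r"
  using emeasure_compact_finite[OF compact_P] closed_P by (simp add: V_def set_integral_const)

lemma B_add: "continuous_on P f \<Longrightarrow> continuous_on P g \<Longrightarrow> B (\<lambda>x. f x + g x) = B f + B g"
  by (simp add: B_def J_add sum.distrib)

lemma B_cmult: "B (\<lambda>x. r * f x) = r * B f"
  by (simp add: B_def J_cmult sum_distrib_left)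

lemma B_mono:
  assumes "continuous_on P f" "continuous_on P g" "\<And>k x. k < N \<Longrightarrow> x \<in> E k \<Longrightarrow> f x \<le> g x"
  shows "B f \<le> B g"
  unfolding B_def by (intro sum_mono J_mono assms) auto

lemma B_cong: "(\<And>x. x \<in> P \<Longrightarrow> f x = g x) \<Longrightarrow> B f = B g"
  unfolding B_def using E_subset by (intro sum.cong J_cong) auto

lemma L_add: "continuous_on P f \<Longrightarrow> continuous_on P g \<Longrightarrow> L (\<lambda>x. f x + g x) = L f + L g"
  by (simp add: L_def B_add V_add algebra_simps)

lemma L_cmult: "L (\<lambda>x. r * f x) = r * L f"
  by (simp add: L_def B_cmult V_cmult algebra_simps)

lemma edge_integral:
  assumes k: "k < N" and f: "continuous_on P f"
  shows "(LINT x:E k|edge_measure (h k) (c k). f x) = J k f"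
proof -
  have "compact (E k)" unfolding E_eq[OF k] by (intro compact_continuous_image continuous_gamma compact_Icc)
  then have "E k \<in> sets borel" by (rule borel_compact)
  then have meas: "(\<lambda>x. indicator (E k) x *\<^sub>R f x) \<in> borel_measurable borel"
    using borel_measurable_continuous_on_indicator continuous_on_subset[OF f E_subset] by blast
  have "edge_measure (h k) (c k) = distr lborel borel (\<gamma> k)"
    by (simp add: edge_measure_def \<gamma>_def[abs_def])
  then have "(LINT x:E k|edge_measure (h k) (c k). f x) = (LINT t|lborel. indicator (E k) (\<gamma> k t) *\<^sub>R f (\<gamma> k t))"
    unfolding set_lebesgue_integral_def using meas
    by (simp add: integral_distr borel_measurable_continuous_onI[OF continuous_gamma])
  also have "\<dots> = J k f"
    unfolding J_def set_lebesgue_integral_def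
    by (intro Bochner_Integration.integral_cong) (auto simp: indicator_def gamma_in_E[OF k])
  finally show ?thesis .
qed

lemma boundary_integral_eq: "continuous_on P f \<Longrightarrow> boundary_integral N h c f = B f"
  by (simp add: boundary_integral_def B_def edge_integral)

lemma futaki_eq: "continuous_on P f \<Longrightarrow> futaki N h c f = L f"
  by (simp add: futaki_def boundary_integral_eq L_def V_const a_def) (simp add: V_def)

text \<open>The point \<open>x\<close> may lie on the boundary. It is in the closure of the
  interior, so the set where \<open>f\<close> is positive contains a nonempty open set, which cannot
  be null.\<close>

lemma V_pos:
  assumes f: "continuous_on P f" "\<And>x. x \<in> P \<Longrightarrow> f x \<ge> 0" and x: "x \<in> P" "f x > 0"
  shows "V f > 0"
proof -
  have "V f \<ge> 0" using V_mono[of "\<lambda>_. 0" f] f V_const[of 0] by simp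
  moreover have "V f \<noteq> 0"
  proof
    assume "V f = 0"
    have int: "integrable lborel (\<lambda>x. indicator P x *\<^sub>R f x)"
      using set_integrable_P[OF f(1)] by (simp add: set_integrable_def)
    have "AE x in lborel. indicator P x *\<^sub>R f x = 0"
      using \<open>V f = 0\<close> integral_nonneg_eq_0_iff_AE[OF int] f(2)
      by (auto simp: V_def set_lebesgue_integral_def indicator_def)
    then obtain Z where Z: "{x \<in> space lborel. \<not> indicator P x *\<^sub>R f x = 0} \<subseteq> Z" "emeasure lborel Z = 0" "Z \<in> sets lborel"
      by (rule AE_E)
    then have "negligible Z" by (simp add: negligible_iff_null_sets null_sets_def)
    obtain d where d: "d > 0" "\<And>y. y \<in> P \<Longrightarrow> dist y x < d \<Longrightarrow> dist (f y) (f x) < f x"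
      using f(1) x unfolding continuous_on_iff by blast
    have "x \<in> closure (interior P)"
      using convex_closure_interior[OF convex_P interior_P] x closure_subset by blast
    then obtain y where "y \<in> interior P" "dist y x < d" using d(1) closure_approachable by blast
    then have ne: "interior P \<inter> ball x d \<noteq> {}" by (auto simp: dist_commute)
    have "interior P \<inter> ball x d \<subseteq> Z"
    proof
      fix y assume "y \<in> interior P \<inter> ball x d"
      then have y: "y \<in> P" "dist y x < d" using interior_subset by (auto simp: dist_commute)
      then have "f y > 0" using d(2)[OF y] by (simp add: dist_real_def)
      then show "y \<in> Z" using Z(1) y by auto
    qed
    then have "negligible (interior P \<inter> ball x d)" using \<open>negligible Z\<close> negligible_subset by blast
    then show False using ne open_not_negligible[of "interior P \<inter> ball x d"] by blast
  qed
  ultimately show ?thesis by simp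
qed

lemma V1_pos: "V (\<lambda>_. 1) > 0"
  using V_pos[of "\<lambda>_. 1"] P_nonempty by (metis ex_in_conv continuous_on_const zero_le_one zero_less_one)

lemma N_pos: "N > 0"
proof -
  obtain x where x: "x \<in> P" using P_nonempty by blast
  have "axis 1 1 \<noteq> (0::real^2)" by (simp add: axis_eq_0_iff)
  from ray_exit[OF x this] show ?thesis by (metis gr_zeroI not_less_zero)
qed

lemma B1_pos: "B (\<lambda>_. 1) > 0"
  unfolding B_def using N_pos lo_hi(1) by (intro sum_pos) (auto simp: J_const)

lemma a_pos: "a > 0" using V1_pos B1_pos by (simp add: a_def)

lemma V_nonneg: "continuous_on P f \<Longrightarrow> (\<And>x. x \<in> P \<Longrightarrow> f x \<ge> 0) \<Longrightarrow> V f \<ge> 0"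
  using V_mono[of "\<lambda>_. 0" f] V_const[of 0] by simp

lemma J_nonneg: "continuous_on P f \<Longrightarrow> k < N \<Longrightarrow> (\<And>x. x \<in> P \<Longrightarrow> f x \<ge> 0) \<Longrightarrow> J k f \<ge> 0"
  using J_mono[of "\<lambda>_. 0" f k] J_const[of k 0] E_subset[of k] by auto

lemma B_nonneg: "continuous_on P f \<Longrightarrow> (\<And>x. x \<in> P \<Longrightarrow> f x \<ge> 0) \<Longrightarrow> B f \<ge> 0"
  unfolding B_def by (intro sum_nonneg J_nonneg) auto

lemma nn_integral_P:
  assumes "continuous_on P f" "\<And>x. x \<in> P \<Longrightarrow> f x \<ge> 0"
  shows "(\<integral>\<^sup>+x. indicator P x * ennreal (f x) \<partial>lborel) = ennreal (V f)"
proof -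
  have "(\<integral>\<^sup>+x. ennreal (indicator P x *\<^sub>R f x) \<partial>lborel) = ennreal (V f)"
    unfolding V_def set_lebesgue_integral_def
    using set_integrable_P[OF assms(1)] assms(2)
    by (intro nn_integral_eq_integral) (auto simp: set_integrable_def indicator_def)
  moreover have "ennreal (indicator P x *\<^sub>R f x) = indicator P x * ennreal (f x)" for x
    by (simp add: indicator_def)
  ultimately show ?thesis by simp
qed

lemma nn_integral_J:
  assumes "continuous_on P f" "\<And>x. x \<in> P \<Longrightarrow> f x \<ge> 0" "k < N"
  shows "(\<integral>\<^sup>+t. indicator {lo k..hi k} t * ennreal (f (\<gamma> k t)) \<partial>lborel) = ennreal (J k f)"
proof -
  have "(\<integral>\<^sup>+t. ennreal (indicator {lo k..hi k} t *\<^sub>R f (\<gamma> k t)) \<partial>lborel) = ennreal (J k f)"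
    unfolding J_def set_lebesgue_integral_def
    using set_integrable_gamma[OF assms(1,3)] assms(2) gamma_P[OF assms(3)]
    by (intro nn_integral_eq_integral) (auto simp: set_integrable_def indicator_def)
  moreover have "ennreal (indicator {lo k..hi k} t *\<^sub>R f (\<gamma> k t)) = indicator {lo k..hi k} t * ennreal (f (\<gamma> k t))" for t
    by (simp add: indicator_def)
  ultimately show ?thesis by simp
qed

lemma measurable_edge_fun:
  fixes f :: "real^2 \<Rightarrow> real"
  assumes "continuous_on P f" "k < N"
  shows "(\<lambda>t. indicator {lo k..hi k} t * ennreal (f (\<gamma> k t))) \<in> borel_measurable borel"
proof -
  have "(\<lambda>t. indicator {lo k..hi k} t *\<^sub>R f (\<gamma> k t)) \<in> borel_measurable borel"
    by (intro borel_measurable_continuous_on_indicator continuous_on_gamma assms) simp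
  then have "(\<lambda>t. ennreal (indicator {lo k..hi k} t *\<^sub>R f (\<gamma> k t))) \<in> borel_measurable borel" by measurable
  moreover have "ennreal (indicator {lo k..hi k} t *\<^sub>R f (\<gamma> k t)) = indicator {lo k..hi k} t * ennreal (f (\<gamma> k t))" for t
    by (simp add: indicator_def)
  ultimately show ?thesis by simp
qed

end

section \<open>Integration in the plane\<close>

lemma vector2_axis: "vector [x, y] = x *\<^sub>R axis 1 1 + y *\<^sub>R (axis 2 1 :: real^2)"
  by (simp add: vec_eq_iff forall_2 axis_def)

lemma measurable_vector2 [measurable]:
  "(\<lambda>p. vector [fst p, snd p] :: real^2) \<in> borel_measurable (borel \<Otimes>\<^sub>M borel)"
  unfolding vector2_axis borel_prod
  by (intro borel_measurable_continuous_onI continuous_intros)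

lemma measurable_vector2' [measurable (raw)]:
  assumes "f \<in> borel_measurable M" "g \<in> borel_measurable M"
  shows "(\<lambda>x. vector [f x, g x] :: real^2) \<in> borel_measurable M"
  unfolding vector2_axis using assms by measurable

text \<open>Comparison on boxes identifies Lebesgue measure with a product measure, which makes
  iterated integration available.\<close>

lemma lborel_real2:
  "(lborel :: (real^2) measure) = distr (lborel \<Otimes>\<^sub>M lborel) borel (\<lambda>p. vector [fst p, snd p])"
proof (rule lborel_eqI)
  fix l u :: "real^2" assume le: "\<And>b. b \<in> Basis \<Longrightarrow> l \<bullet> b \<le> u \<bullet> b"
  have ax: "axis i 1 \<in> (Basis :: (real^2) set)" for i by (auto simp: Basis_vec_def)
  have le': "l $ i \<le> u $ i" for i using le[OF ax[of i]] by (simp add: inner_axis)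
  have B: "(Basis :: (real^2) set) = {axis 1 1, axis 2 1}"
    unfolding Basis_vec_def by (auto simp: UNIV_2)
  have ne: "axis 1 1 \<noteq> (axis 2 1 :: real^2)" by (simp add: axis_eq_axis)
  have box: "(\<lambda>p. vector [fst p, snd p]) -` box l u \<inter> space (lborel \<Otimes>\<^sub>M lborel) = {l$1<..<u$1} \<times> {l$2<..<u$2}"
    by (auto simp: box_def B inner_axis space_pair_measure)
  have "emeasure (distr (lborel \<Otimes>\<^sub>M lborel) borel (\<lambda>p. vector [fst p, snd p])) (box l u)
      = emeasure (lborel \<Otimes>\<^sub>M lborel) ({l$1<..<u$1} \<times> {l$2<..<u$2})"
    unfolding box[symmetric] by (rule emeasure_distr) (auto simp: measurable_vector2 cong: measurable_cong_sets)
  also have "\<dots> = ennreal (u$1 - l$1) * ennreal (u$2 - l$2)"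
    using le' by (subst lborel.emeasure_pair_measure_Times) auto
  also have "\<dots> = (\<Prod>b\<in>Basis. (u - l) \<bullet> b)"
    using le' ne by (simp add: B inner_axis ennreal_mult)
  finally show "emeasure (distr (lborel \<Otimes>\<^sub>M lborel) borel (\<lambda>p. vector [fst p, snd p])) (box l u) = (\<Prod>b\<in>Basis. (u - l) \<bullet> b)" .
qed simp

lemma nn_integral_real2:
  fixes f :: "real^2 \<Rightarrow> ennreal"
  assumes [measurable]: "f \<in> borel_measurable borel"
  shows "(\<integral>\<^sup>+x. f x \<partial>lborel) = (\<integral>\<^sup>+x. \<integral>\<^sup>+y. f (vector [x, y]) \<partial>lborel \<partial>lborel)"
proof -
  have "(\<integral>\<^sup>+x. f x \<partial>lborel) = (\<integral>\<^sup>+p. f (vector [fst p, snd p]) \<partial>(lborel \<Otimes>\<^sub>M lborel))"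
    by (subst lborel_real2, rule nn_integral_distr) measurable
  also have "\<dots> = (\<integral>\<^sup>+x. \<integral>\<^sup>+y. f (vector [fst (x, y), snd (x, y)]) \<partial>lborel \<partial>lborel)"
    by (rule lborel.nn_integral_fst[symmetric]) measurable
  finally show ?thesis by simp
qed

text \<open>One variable at a time: for fixed \<open>r\<close> the substitution in \<open>v\<close>
  produces the second coordinate with factor \<open>w2\<close>; after exchanging the integrals, the
  substitution in \<open>r\<close> produces the first coordinate with factor \<open>d\<close>. The
  product of the factors is the determinant.\<close>

lemma nn_integral_plane_affine_aux:
  fixes g :: "real \<Rightarrow> real \<Rightarrow> ennreal"
  assumes [measurable]: "(\<lambda>p. g (fst p) (snd p)) \<in> borel_measurable (borel \<Otimes>\<^sub>M borel)"
    and w2: "w2 \<noteq> 0" and D: "u1 * w2 - u2 * w1 \<noteq> 0"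
  shows "(\<integral>\<^sup>+x. \<integral>\<^sup>+y. g x y \<partial>lborel \<partial>lborel) = ennreal \<bar>u1 * w2 - u2 * w1\<bar> *
    (\<integral>\<^sup>+r. \<integral>\<^sup>+v. g (p1 + r * u1 + v * w1) (p2 + r * u2 + v * w2) \<partial>lborel \<partial>lborel)"
proof -
  define d where "d = (u1 * w2 - u2 * w1) / w2"
  have d: "d \<noteq> 0" using D w2 by (simp add: d_def)
  have [measurable]: "(\<lambda>x. g (a x) (b x)) \<in> borel_measurable M"
    if "a \<in> borel_measurable M" "b \<in> borel_measurable M" for a b and M :: "'c measure"
    using measurable_compose[OF measurable_Pair[OF that] assms(1)] by simp
  have "ennreal \<bar>w2\<bar> * (\<integral>\<^sup>+r. \<integral>\<^sup>+v. g (p1 + r * u1 + v * w1) (p2 + r * u2 + v * w2) \<partial>lborel \<partial>lborel)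
     = (\<integral>\<^sup>+r. ennreal \<bar>w2\<bar> * (\<integral>\<^sup>+v. g (p1 + r * u1 + v * w1) (p2 + r * u2 + v * w2) \<partial>lborel) \<partial>lborel)"
    by (rule nn_integral_cmult[symmetric]) measurable
  also have "\<dots> = (\<integral>\<^sup>+r. (\<integral>\<^sup>+y. g (p1 + r * u1 + (y - p2 - r * u2) / w2 * w1) y \<partial>lborel) \<partial>lborel)"
  proof (rule nn_integral_cong)
    fix r :: real
    show "ennreal \<bar>w2\<bar> * (\<integral>\<^sup>+v. g (p1 + r * u1 + v * w1) (p2 + r * u2 + v * w2) \<partial>lborel)
       = (\<integral>\<^sup>+y. g (p1 + r * u1 + (y - p2 - r * u2) / w2 * w1) y \<partial>lborel)"
      using w2 by (subst nn_integral_real_affine[where t = "p2 + r * u2" and c = w2]) (auto simp: mult.commute)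
  qed
  also have "\<dots> = (\<integral>\<^sup>+y. (\<integral>\<^sup>+r. g (p1 + r * u1 + (y - p2 - r * u2) / w2 * w1) y \<partial>lborel) \<partial>lborel)"
    by (rule lborel_pair.Fubini'[symmetric]) measurable
  finally have 1: "ennreal \<bar>w2\<bar> * (\<integral>\<^sup>+r. \<integral>\<^sup>+v. g (p1 + r * u1 + v * w1) (p2 + r * u2 + v * w2) \<partial>lborel \<partial>lborel)
     = (\<integral>\<^sup>+y. (\<integral>\<^sup>+r. g (p1 + r * u1 + (y - p2 - r * u2) / w2 * w1) y \<partial>lborel) \<partial>lborel)" .
  have "(\<integral>\<^sup>+x. \<integral>\<^sup>+y. g x y \<partial>lborel \<partial>lborel) = (\<integral>\<^sup>+y. \<integral>\<^sup>+x. g x y \<partial>lborel \<partial>lborel)"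
    by (rule lborel_pair.Fubini'[symmetric]) measurable
  also have "\<dots> = (\<integral>\<^sup>+y. ennreal \<bar>d\<bar> * (\<integral>\<^sup>+r. g (p1 + r * u1 + (y - p2 - r * u2) / w2 * w1) y \<partial>lborel) \<partial>lborel)"
  proof (rule nn_integral_cong)
    fix y :: real
    have e: "p1 + (y - p2) / w2 * w1 + d * r = p1 + r * u1 + (y - p2 - r * u2) / w2 * w1" for r
      using w2 by (simp add: d_def field_simps)
    have "(\<integral>\<^sup>+x. g x y \<partial>lborel) =
      ennreal \<bar>d\<bar> * (\<integral>\<^sup>+r. g (p1 + (y - p2) / w2 * w1 + d * r) y \<partial>lborel)"
      by (rule nn_integral_real_affine[OF _ d]) measurable
    then show "(\<integral>\<^sup>+x. g x y \<partial>lborel) =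
      ennreal \<bar>d\<bar> * (\<integral>\<^sup>+r. g (p1 + r * u1 + (y - p2 - r * u2) / w2 * w1) y \<partial>lborel)"
      unfolding e .
  qed
  also have "\<dots> = ennreal \<bar>d\<bar> * (\<integral>\<^sup>+y. (\<integral>\<^sup>+r. g (p1 + r * u1 + (y - p2 - r * u2) / w2 * w1) y \<partial>lborel) \<partial>lborel)"
    by (rule nn_integral_cmult) measurable
  also have "\<dots> = ennreal (\<bar>d\<bar> * \<bar>w2\<bar>) * (\<integral>\<^sup>+r. \<integral>\<^sup>+v. g (p1 + r * u1 + v * w1) (p2 + r * u2 + v * w2) \<partial>lborel \<partial>lborel)"
    unfolding 1[symmetric] by (simp add: ennreal_mult mult.assoc)
  also have "\<bar>d\<bar> * \<bar>w2\<bar> = \<bar>u1 * w2 - u2 * w1\<bar>" using w2 by (simp add: d_def abs_divide)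
  finally show ?thesis .
qed

lemma nn_integral_real2_affine:
  fixes f :: "real^2 \<Rightarrow> ennreal" and p u w :: "real^2"
  assumes [measurable]: "f \<in> borel_measurable borel" and D: "u$1 * w$2 - u$2 * w$1 \<noteq> 0"
  shows "(\<integral>\<^sup>+x. f x \<partial>lborel) = ennreal \<bar>u$1 * w$2 - u$2 * w$1\<bar> *
    (\<integral>\<^sup>+r. \<integral>\<^sup>+v. f (p + r *\<^sub>R u + v *\<^sub>R w) \<partial>lborel \<partial>lborel)"
proof -
  have vec: "p + r *\<^sub>R u + v *\<^sub>R w = vector [p$1 + r * u$1 + v * w$1, p$2 + r * u$2 + v * w$2]" for r v
    by (simp add: vec_eq_iff forall_2)
  show ?thesis
  proof (cases "w$2 = 0")
    case False
    show ?thesis unfolding nn_integral_real2[OF assms(1)] vec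
      by (rule nn_integral_plane_affine_aux[OF _ False D]) measurable
  next
    case True
    then have w1: "w$1 \<noteq> 0" using D by auto
    have D': "u$2 * w$1 - u$1 * w$2 \<noteq> 0" using D by simp
    have "(\<integral>\<^sup>+x. \<integral>\<^sup>+y. f (vector [x, y]) \<partial>lborel \<partial>lborel) = (\<integral>\<^sup>+y. \<integral>\<^sup>+x. f (vector [x, y]) \<partial>lborel \<partial>lborel)"
      by (rule lborel_pair.Fubini'[symmetric]) measurable
    also have "\<dots> = ennreal \<bar>u$2 * w$1 - u$1 * w$2\<bar> *
      (\<integral>\<^sup>+r. \<integral>\<^sup>+v. f (vector [p$1 + r * u$1 + v * w$1, p$2 + r * u$2 + v * w$2]) \<partial>lborel \<partial>lborel)"
      by (rule nn_integral_plane_affine_aux[OF _ w1 D']) measurable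
    finally show ?thesis unfolding nn_integral_real2[OF assms(1)] vec by (simp add: abs_minus_commute)
  qed
qed

section \<open>The L2 norm and the boundary integral\<close>

context moment
begin

text \<open>\<open>A y\<close> sums the values of \<open>w\<close> at boundary points with
  \<open>j\<close>-th coordinate \<open>y\<close>. On the segment through \<open>x\<close> in
  direction \<open>i\<close> a convex function is at most the larger of its values at the two ends,
  which are such points. Integration over \<open>y\<close> turns the sum into edge integrals, with
  the speed of \<open>\<gamma> k\<close> in direction \<open>j\<close> as factor.\<close>

lemma slice_bound:
  fixes i j :: 2
  assumes w: "continuous_on P w" "\<And>x. x \<in> P \<Longrightarrow> w x \<ge> 0" "convex_on P w" and ij: "i \<noteq> j"
  obtains A :: "real \<Rightarrow> ennreal" where "A \<in> borel_measurable borel"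
    "\<And>x. x \<in> P \<Longrightarrow> ennreal (w x) \<le> A (x $ j)"
    "(\<integral>\<^sup>+y. A y \<partial>lborel) \<le> ennreal ((\<Sum>k<N. \<bar>h k $ i\<bar>) * B w)"
proof -
  define F where "F = (\<lambda>k t. indicator {lo k..hi k} t * ennreal (w (\<gamma> k t)))"
  have F: "F k \<in> borel_measurable borel" if "k < N" for k
    unfolding F_def by (rule measurable_edge_fun[OF w(1) that])
  define s where "s = (\<lambda>k. rot90 (h k) $ j)"
  \<comment> \<open>The value 0 drops the edges parallel to axis \<open>i\<close>; the exits
    provided by \<open>ray_exit\<close> are on other edges.\<close>
  define G where "G = (\<lambda>k y. if s k \<noteq> 0 then F k ((y - \<gamma> k 0 $ j) / s k) else 0)"
  define A where "A = (\<lambda>y. \<Sum>k<N. G k y)"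
  have sabs: "\<bar>s k\<bar> = \<bar>h k $ i\<bar>" for k
    using ij exhaust_2[of i] exhaust_2[of j] by (auto simp: s_def rot90_def)
  have gj: "\<gamma> k t $ j = \<gamma> k 0 $ j + s k * t" for k t by (simp add: \<gamma>_def s_def)
  have G: "G k \<in> borel_measurable borel" if "k < N" for k
    using F[OF that] unfolding G_def by measurable
  have A: "A \<in> borel_measurable borel" unfolding A_def using G by measurable
  have single: "ennreal (w y) \<le> A (y $ j)" if k: "k < N" and y: "y \<in> E k" "h k $ i \<noteq> 0" for k y
  proof -
    obtain t where t: "y = \<gamma> k t" "lo k \<le> t" "t \<le> hi k" using y unfolding E_eq[OF k] by auto
    have s: "s k \<noteq> 0" using y(2) sabs[of k] by auto
    have "(y $ j - \<gamma> k 0 $ j) / s k = t" using s unfolding t(1) gj[of k t] by simp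
    then have "G k (y $ j) = ennreal (w y)" using s t by (simp add: G_def F_def)
    moreover have "G k (y $ j) \<le> A (y $ j)" unfolding A_def by (rule member_le_sum) (use k in auto)
    ultimately show ?thesis by simp
  qed
  define e :: "real^2" where "e = axis i 1"
  have e: "e \<noteq> 0" "- e \<noteq> 0" by (simp_all add: e_def axis_eq_0_iff)
  have ej: "e $ j = 0" using ij by (simp add: e_def axis_def)
  have he: "h k \<bullet> e = h k $ i" for k by (simp add: e_def inner_axis)
  have pointwise: "ennreal (w x) \<le> A (x $ j)" if x: "x \<in> P" for x
  proof -
    obtain t1 k1 where 1: "t1 \<ge> 0" "k1 < N" "x + t1 *\<^sub>R e \<in> E k1" "h k1 \<bullet> e < 0"
      using ray_exit[OF x e(1)] by blast
    obtain t2 k2 where 2: "t2 \<ge> 0" "k2 < N" "x + t2 *\<^sub>R (- e) \<in> E k2" "h k2 \<bullet> (- e) < 0"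
      using ray_exit[OF x e(2)] by blast
    have le1: "ennreal (w (x + t1 *\<^sub>R e)) \<le> A (x $ j)"
      using single[OF 1(2,3)] 1(4) ej by (simp add: he)
    have le2: "ennreal (w (x + t2 *\<^sub>R (- e))) \<le> A (x $ j)"
      using single[OF 2(2,3)] 2(4) ej by (simp add: he)
    have "w x \<le> max (w (x + t1 *\<^sub>R e)) (w (x + t2 *\<^sub>R (- e)))"
    proof (cases "t1 + t2 = 0")
      case True
      then have "t1 = 0" using 1(1) 2(1) by simp
      then show ?thesis by simp
    next
      case False
      then have pos: "t1 + t2 > 0" using 1(1) 2(1) by simp
      have "(t2 / (t1 + t2)) *\<^sub>R (x + t1 *\<^sub>R e) + (t1 / (t1 + t2)) *\<^sub>R (x + t2 *\<^sub>R (- e))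
        = (t2 / (t1 + t2) + t1 / (t1 + t2)) *\<^sub>R x"
        by (simp add: algebra_simps)
      also have "t2 / (t1 + t2) + t1 / (t1 + t2) = 1" using pos by (simp add: add_divide_distrib[symmetric])
      finally have xe: "(t2 / (t1 + t2)) *\<^sub>R (x + t1 *\<^sub>R e) + (t1 / (t1 + t2)) *\<^sub>R (x + t2 *\<^sub>R (- e)) = x" by simp
      have "w ((t2 / (t1 + t2)) *\<^sub>R (x + t1 *\<^sub>R e) + (t1 / (t1 + t2)) *\<^sub>R (x + t2 *\<^sub>R (- e)))
        \<le> max (w (x + t1 *\<^sub>R e)) (w (x + t2 *\<^sub>R (- e)))"
        by (rule convex_lower[OF w(3)])
          (use 1 2 pos E_subset in \<open>auto simp: add_divide_distrib[symmetric]\<close>)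
      then show ?thesis unfolding xe .
    qed
    then have "ennreal (w x) \<le> ennreal (max (w (x + t1 *\<^sub>R e)) (w (x + t2 *\<^sub>R (- e))))" by (rule ennreal_leI)
    also have "\<dots> \<le> A (x $ j)" using le1 le2 by (auto simp: max_def)
    finally show ?thesis .
  qed
  have Gint: "(\<integral>\<^sup>+y. G k y \<partial>lborel) = ennreal (\<bar>h k $ i\<bar> * J k w)" if k: "k < N" for k
  proof (cases "s k = 0")
    case True
    then show ?thesis using sabs[of k] by (simp add: G_def)
  next
    case False
    have "(\<integral>\<^sup>+y. G k y \<partial>lborel) = ennreal \<bar>s k\<bar> * (\<integral>\<^sup>+t. G k (\<gamma> k 0 $ j + s k * t) \<partial>lborel)"
      by (rule nn_integral_real_affine[OF G[OF k] False])
    also have "(\<integral>\<^sup>+t. G k (\<gamma> k 0 $ j + s k * t) \<partial>lborel) = (\<integral>\<^sup>+t. F k t \<partial>lborel)"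
      using False by (simp add: G_def)
    also have "\<dots> = ennreal (J k w)" unfolding F_def by (rule nn_integral_J[OF w(1,2) k])
    finally show ?thesis by (simp add: sabs ennreal_mult J_nonneg[OF w(1) k w(2)])
  qed
  have "(\<integral>\<^sup>+y. A y \<partial>lborel) = (\<Sum>k<N. ennreal (\<bar>h k $ i\<bar> * J k w))"
    unfolding A_def using G by (subst nn_integral_sum) (auto simp: Gint)
  also have "\<dots> = ennreal (\<Sum>k<N. \<bar>h k $ i\<bar> * J k w)"
    by (rule sum_ennreal) (auto intro!: mult_nonneg_nonneg J_nonneg[OF w(1) _ w(2)])
  also have "\<dots> \<le> ennreal ((\<Sum>k<N. \<bar>h k $ i\<bar>) * B w)"
  proof (rule ennreal_leI)
    have "(\<Sum>k<N. \<bar>h k $ i\<bar> * J k w) \<le> (\<Sum>k<N. \<bar>h k $ i\<bar> * B w)"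
    proof (intro sum_mono mult_left_mono)
      fix k assume "k \<in> {..<N}"
      then show "J k w \<le> B w" unfolding B_def
        by (intro member_le_sum) (auto intro!: J_nonneg[OF w(1) _ w(2)])
    qed auto
    then show "(\<Sum>k<N. \<bar>h k $ i\<bar> * J k w) \<le> (\<Sum>k<N. \<bar>h k $ i\<bar>) * B w" by (simp add: sum_distrib_right)
  qed
  finally show thesis using that[OF A pointwise] by blast
qed

text \<open>The Loomis--Whitney argument: \<open>w x \<le> A1 (x $ 2)\<close> and \<open>w x \<le> A2 (x $ 1)\<close>, so
  the integral of \<open>w\<^sup>2\<close> is at most the product of the integrals of \<open>A1\<close> and \<open>A2\<close>.\<close>

definition CG :: real where "CG = (\<Sum>k<N. \<bar>h k $ 1\<bar>) * (\<Sum>k<N. \<bar>h k $ 2\<bar>)"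

lemma CG_nonneg: "CG \<ge> 0" unfolding CG_def by (intro mult_nonneg_nonneg sum_nonneg) auto

lemma V_square_le:
  assumes w: "continuous_on P w" "\<And>x. x \<in> P \<Longrightarrow> w x \<ge> 0" "convex_on P w"
  shows "V (\<lambda>x. (w x)^2) \<le> CG * (B w)^2"
proof -
  obtain A1 where A1: "A1 \<in> borel_measurable borel" "\<And>x. x \<in> P \<Longrightarrow> ennreal (w x) \<le> A1 (x $ 2)"
    "(\<integral>\<^sup>+y. A1 y \<partial>lborel) \<le> ennreal ((\<Sum>k<N. \<bar>h k $ 1\<bar>) * B w)"
    using slice_bound[OF w, of 1 2] by auto
  obtain A2 where A2: "A2 \<in> borel_measurable borel" "\<And>x. x \<in> P \<Longrightarrow> ennreal (w x) \<le> A2 (x $ 1)"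
    "(\<integral>\<^sup>+y. A2 y \<partial>lborel) \<le> ennreal ((\<Sum>k<N. \<bar>h k $ 2\<bar>) * B w)"
    using slice_bound[OF w, of 2 1] by auto
  note [measurable] = A1(1) A2(1)
  have Bw: "B w \<ge> 0" by (rule B_nonneg[OF w(1,2)])
  have c2: "continuous_on P (\<lambda>x. (w x)^2)" by (intro continuous_intros w)
  have "ennreal (V (\<lambda>x. (w x)^2)) = (\<integral>\<^sup>+x. indicator P x * ennreal ((w x)^2) \<partial>lborel)"
    by (rule nn_integral_P[symmetric, OF c2]) simp
  also have "\<dots> \<le> (\<integral>\<^sup>+x. A1 ((x::real^2) $ 2) * A2 (x $ 1) \<partial>lborel)"
  proof (rule nn_integral_mono)
    fix x :: "real^2"
    show "indicator P x * ennreal ((w x)^2) \<le> A1 (x $ 2) * A2 (x $ 1)"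
    proof (cases "x \<in> P")
      case True
      then have "ennreal ((w x)^2) = ennreal (w x) * ennreal (w x)"
        using w(2) by (simp add: power2_eq_square ennreal_mult)
      also have "\<dots> \<le> A1 (x $ 2) * A2 (x $ 1)" using A1(2)[OF True] A2(2)[OF True] by (rule mult_mono) auto
      finally show ?thesis using True by simp
    qed simp
  qed
  also have "\<dots> = (\<integral>\<^sup>+s. \<integral>\<^sup>+y. A1 y * A2 s \<partial>lborel \<partial>lborel)"
    by (subst nn_integral_real2) (simp_all)
  also have "\<dots> = (\<integral>\<^sup>+s. (\<integral>\<^sup>+y. A1 y \<partial>lborel) * A2 s \<partial>lborel)"
    by (intro nn_integral_cong nn_integral_multc) measurable
  also have "\<dots> = (\<integral>\<^sup>+y. A1 y \<partial>lborel) * (\<integral>\<^sup>+s. A2 s \<partial>lborel)"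
    by (rule nn_integral_cmult) measurable
  also have "\<dots> \<le> ennreal ((\<Sum>k<N. \<bar>h k $ 1\<bar>) * B w) * ennreal ((\<Sum>k<N. \<bar>h k $ 2\<bar>) * B w)"
    by (intro mult_mono A1 A2) auto
  also have "\<dots> = ennreal (((\<Sum>k<N. \<bar>h k $ 1\<bar>) * B w) * ((\<Sum>k<N. \<bar>h k $ 2\<bar>) * B w))"
    using Bw by (intro ennreal_mult[symmetric] mult_nonneg_nonneg sum_nonneg) auto
  also have "((\<Sum>k<N. \<bar>h k $ 1\<bar>) * B w) * ((\<Sum>k<N. \<bar>h k $ 2\<bar>) * B w) = CG * (B w)^2"
    by (simp add: CG_def power2_eq_square)
  finally show ?thesis using CG_nonneg by (simp add: ennreal_le_iff)
qed

end

section \<open>The cone formula\<close>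

lemma null_set_hyperplane: "(a :: 'a::euclidean_space) \<noteq> 0 \<Longrightarrow> {x. a \<bullet> x = b} \<in> null_sets lborel"
  using negligible_hyperplane[of a b] closed_hyperplane[of a b]
  by (simp add: negligible_iff_null_sets null_sets_completion_iff)

context moment
begin

text \<open>The triangle spanned by \<open>p\<close> and edge \<open>k\<close>, without
  \<open>p\<close>. It is written in terms of the radial coordinate, which is 0 at \<open>p\<close>
  and 1 on the edge, to make measurability immediate.\<close>

definition sector :: "real^2 \<Rightarrow> nat \<Rightarrow> (real^2) set" where
  "sector p k = {x. 0 < (h k \<bullet> p - h k \<bullet> x) / (h k \<bullet> p - c k) \<and> (h k \<bullet> p - h k \<bullet> x) / (h k \<bullet> p - c k) \<le> 1 \<and>
     p + (1 / ((h k \<bullet> p - h k \<bullet> x) / (h k \<bullet> p - c k))) *\<^sub>R (x - p) \<in> P}"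

lemma sector_measurable [measurable]: "sector p k \<in> sets borel"
proof -
  have [measurable]: "P \<in> sets borel" using closed_P by simp
  show ?thesis unfolding sector_def by measurable
qed

lemma sector_iff:
  assumes "k < N" "h k \<bullet> p - c k > 0"
  shows "x \<in> sector p k \<longleftrightarrow> (\<exists>r y. 0 < r \<and> r \<le> 1 \<and> y \<in> E k \<and> x = p + r *\<^sub>R (y - p))"
proof
  assume x: "x \<in> sector p k"
  define r where "r = (h k \<bullet> p - h k \<bullet> x) / (h k \<bullet> p - c k)"
  define y where "y = p + (1 / r) *\<^sub>R (x - p)"
  have r: "0 < r" "r \<le> 1" "y \<in> P" using x by (simp_all add: sector_def r_def y_def)
  have "x - p = r *\<^sub>R (y - p)" using r by (simp add: y_def)
  then have xe: "x = p + r *\<^sub>R (y - p)" by (simp add: algebra_simps)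
  have "r * (h k \<bullet> p - c k) = h k \<bullet> p - h k \<bullet> x" using assms by (simp add: r_def)
  then have "r * (h k \<bullet> y - c k) = 0" unfolding xe by (simp add: algebra_simps)
  then have "y \<in> E k" using r by (simp add: edge_def)
  then show "\<exists>r y. 0 < r \<and> r \<le> 1 \<and> y \<in> E k \<and> x = p + r *\<^sub>R (y - p)" using r xe by blast
next
  assume "\<exists>r y. 0 < r \<and> r \<le> 1 \<and> y \<in> E k \<and> x = p + r *\<^sub>R (y - p)"
  then obtain r y where ry: "0 < r" "r \<le> 1" "y \<in> P" "h k \<bullet> y = c k" and x: "x = p + r *\<^sub>R (y - p)"
    by (auto simp: edge_def)
  have hx: "h k \<bullet> x = h k \<bullet> p + r * (c k - h k \<bullet> p)"
    by (simp only: x inner_add_right inner_scaleR_right inner_diff_right ry(4))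
  have "h k \<bullet> p - h k \<bullet> x = r * (h k \<bullet> p - c k)" unfolding hx by argo
  then have r: "(h k \<bullet> p - h k \<bullet> x) / (h k \<bullet> p - c k) = r" using assms by simp
  have "p + (1 / r) *\<^sub>R (x - p) = y" using ry by (simp add: x)
  then show "x \<in> sector p k" unfolding sector_def mem_Collect_eq r using ry by simp
qed

text \<open>In the coordinates \<open>p + r *\<^sub>R u + v *\<^sub>R w\<close> the Jacobian is
  \<open>h k \<bullet> p - c k\<close>. The slice at \<open>r\<close> is the edge scaled by
  \<open>r\<close>, and \<open>m\<close> is scaled by \<open>r\<close> too; the factor 1/3 is the
  integral of \<open>r^2\<close> over the unit interval.\<close>

lemma sector_integral:
  fixes m :: "real^2 \<Rightarrow> real"
  assumes k: "k < N" and H: "h k \<bullet> p - c k > 0"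
    and m: "continuous_on UNIV m" "\<And>x. m x \<ge> 0" "\<And>r x. r \<ge> 0 \<Longrightarrow> m (p + r *\<^sub>R (x - p)) = r * m x"
  shows "(\<integral>\<^sup>+x. indicator (sector p k) x * ennreal (m x) \<partial>lborel) = ennreal ((h k \<bullet> p - c k) / 3 * J k m)"
proof -
  have [measurable]: "m \<in> borel_measurable borel" using m(1) by (rule borel_measurable_continuous_onI)
  define u where "u = \<gamma> k 0 - p"
  define w where "w = rot90 (h k)"
  have hw: "h k \<bullet> w = 0" by (simp add: w_def inner_rot90)
  have hu: "h k \<bullet> u = - (h k \<bullet> p - c k)" using inner_gamma[OF k, of 0] by (simp add: u_def inner_diff_right)
  have D: "u$1 * w$2 - u$2 * w$1 = - (h k \<bullet> p - c k)"
    unfolding hu[symmetric] by (simp add: w_def rot90_def inner_real2)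
  have cP: "continuous_on P m" using m(1) continuous_on_subset by blast
  have Jn: "J k m \<ge> 0" by (rule J_nonneg[OF cP k m(2)])
  define F where "F = (\<lambda>x. indicator (sector p k) x * ennreal (m x))"
  have [measurable]: "F \<in> borel_measurable borel" unfolding F_def by measurable
  have Fx: "F (p + r *\<^sub>R u + v *\<^sub>R w) = indicator {0<..1} r * (indicator {lo k..hi k} (v / r) * ennreal (r * m (\<gamma> k (v / r))))" for r v
  proof -
    have "h k \<bullet> p - h k \<bullet> (p + r *\<^sub>R u + v *\<^sub>R w) = r * (h k \<bullet> p - c k)"
      unfolding inner_add_right inner_scaleR_right hu hw by argo
    then have rr: "(h k \<bullet> p - h k \<bullet> (p + r *\<^sub>R u + v *\<^sub>R w)) / (h k \<bullet> p - c k) = r" using H by simp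
    show ?thesis
    proof (cases "0 < r \<and> r \<le> 1")
      case True
      have "(1 / r) *\<^sub>R ((p + r *\<^sub>R u + v *\<^sub>R w) - p) = u + (v / r) *\<^sub>R w"
        using True by (simp add: scaleR_add_right)
      then have y: "p + (1 / r) *\<^sub>R ((p + r *\<^sub>R u + v *\<^sub>R w) - p) = \<gamma> k (v / r)"
        by (simp add: u_def w_def \<gamma>_def)
      have "p + r *\<^sub>R u + v *\<^sub>R w = p + r *\<^sub>R (\<gamma> k (v / r) - p)"
        using True by (simp add: y[symmetric])
      then have mm: "m (p + r *\<^sub>R u + v *\<^sub>R w) = r * m (\<gamma> k (v / r))"
        using m(3)[of r "\<gamma> k (v / r)"] True by (simp only: less_imp_le)
      have "p + r *\<^sub>R u + v *\<^sub>R w \<in> sector p k \<longleftrightarrow> v / r \<in> {lo k..hi k}"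
        unfolding sector_def mem_Collect_eq rr y using True lo_hi(2)[OF k] by simp
      then show ?thesis unfolding F_def mm using True by (simp add: indicator_def)
    next
      case False
      then have "p + r *\<^sub>R u + v *\<^sub>R w \<notin> sector p k" unfolding sector_def mem_Collect_eq rr by blast
      then show ?thesis using False by (simp add: F_def indicator_def)
    qed
  qed
  have inner: "(\<integral>\<^sup>+v. F (p + r *\<^sub>R u + v *\<^sub>R w) \<partial>lborel) = ennreal (r^2) * indicator {0..1} r * ennreal (J k m)" for r
  proof (cases "0 < r \<and> r \<le> 1")
    case True
    have [measurable]: "(\<lambda>v. F (p + r *\<^sub>R u + v *\<^sub>R w)) \<in> borel_measurable borel" by measurable
    have "(\<integral>\<^sup>+v. F (p + r *\<^sub>R u + v *\<^sub>R w) \<partial>lborel)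
      = ennreal \<bar>r\<bar> * (\<integral>\<^sup>+t. F (p + r *\<^sub>R u + (0 + r * t) *\<^sub>R w) \<partial>lborel)"
      using True by (intro nn_integral_real_affine) auto
    also have "(\<integral>\<^sup>+t. F (p + r *\<^sub>R u + (0 + r * t) *\<^sub>R w) \<partial>lborel)
      = (\<integral>\<^sup>+t. ennreal r * (indicator {lo k..hi k} t * ennreal (m (\<gamma> k t))) \<partial>lborel)"
      unfolding Fx using True by (intro nn_integral_cong) (simp add: ennreal_mult m(2) mult_ac)
    also have "\<dots> = ennreal r * ennreal (J k m)"
      unfolding nn_integral_J[OF cP m(2) k, symmetric]
      by (rule nn_integral_cmult) (use measurable_edge_fun[OF cP k] in simp)
    finally show ?thesis using True by (simp add: power2_eq_square ennreal_mult mult.assoc)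
  next
    case False
    then have "F (p + r *\<^sub>R u + v *\<^sub>R w) = 0" for v unfolding Fx by (auto simp: indicator_def)
    moreover have "ennreal (r^2) * indicator {0..1} r = 0" using False by (cases "r = 0") (auto simp: indicator_def)
    ultimately show ?thesis by simp
  qed
  have third: "(\<integral>\<^sup>+r. ennreal (r^2) * indicator {0..1} r \<partial>lborel) = ennreal (1/3)"
  proof -
    have "(\<integral>\<^sup>+r. ennreal (r^2) * indicator {0..1} r \<partial>lborel) = ennreal (1^3 / 3 - 0^3/3)"
      by (rule nn_integral_FTC_Icc[where F = "\<lambda>r. r^3 / 3"]) (auto intro!: derivative_eq_intros simp: has_real_derivative_iff_has_vector_derivative[symmetric])
    then show ?thesis by simp
  qed
  have "(\<integral>\<^sup>+x. F x \<partial>lborel) = ennreal \<bar>u$1 * w$2 - u$2 * w$1\<bar> *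
      (\<integral>\<^sup>+r. \<integral>\<^sup>+v. F (p + r *\<^sub>R u + v *\<^sub>R w) \<partial>lborel \<partial>lborel)"
    using H D by (intro nn_integral_real2_affine) auto
  also have "\<bar>u$1 * w$2 - u$2 * w$1\<bar> = h k \<bullet> p - c k" using H unfolding D by simp
  also have "(\<integral>\<^sup>+r. \<integral>\<^sup>+v. F (p + r *\<^sub>R u + v *\<^sub>R w) \<partial>lborel \<partial>lborel) = ennreal (1/3) * ennreal (J k m)"
    unfolding inner third[symmetric] by (rule nn_integral_multc) measurable
  also have "ennreal (h k \<bullet> p - c k) * (ennreal (1/3) * ennreal (J k m)) = ennreal ((h k \<bullet> p - c k) * (1/3 * J k m))"
    using H Jn by (simp add: ennreal_mult del: times_divide_eq_left)
  finally show ?thesis by (simp add: F_def)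
qed

text \<open>Almost every ray from \<open>p\<close> leaves \<open>P\<close> through exactly one edge.
  The exceptional set \<open>Z\<close> consists of \<open>p\<close> and the lines joining
  \<open>p\<close> to common points of two edges not through \<open>p\<close>.\<close>

lemma sector_partition:
  assumes p: "p \<in> P"
  shows "AE x in lborel. (indicator P x :: ennreal) = (\<Sum>k\<in>{k. k < N \<and> h k \<bullet> p - c k > 0}. indicator (sector p k) x)"
proof -
  define K where "K = {k. k < N \<and> h k \<bullet> p - c k > 0}"
  define Z where "Z = {p} \<union> (\<Union>i\<in>K. \<Union>j\<in>K - {i}. \<Union>e\<in>E i \<inter> E j. {x. rot90 (e - p) \<bullet> x = rot90 (e - p) \<bullet> p})"
  have finK: "finite K" by (simp add: K_def)
  have lines: "(\<Union>e\<in>E i \<inter> E j. {x. rot90 (e - p) \<bullet> x = rot90 (e - p) \<bullet> p}) \<in> null_sets lborel"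
    if i: "i \<in> K" and j: "j \<in> K - {i}" for i j
  proof -
    have iN: "i < N" "j < N" "i \<noteq> j" using i j by (auto simp: K_def)
    have one: "e = e'" if ee: "e \<in> E i \<inter> E j" "e' \<in> E i \<inter> E j" for e e'
    proof -
      obtain s t where st: "e = \<gamma> i s" "e' = \<gamma> i t" using ee unfolding E_eq[OF iN(1)] by blast
      show ?thesis
      proof (rule ccontr)
        assume "e \<noteq> e'"
        then have "s \<noteq> t" using st by auto
        then show False using edge_unique[OF iN(1,2)] ee st iN(3) by blast
      qed
    qed
    show ?thesis
    proof (cases "E i \<inter> E j = {}")
      case True
      then show ?thesis by simp
    next
      case False
      then obtain e where e: "e \<in> E i \<inter> E j" by blast
      then have "E i \<inter> E j = {e}" using one by blast
      moreover have "e \<noteq> p" using e i by (auto simp: K_def edge_def)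
      then have "rot90 (e - p) \<noteq> 0" using rot90_inner_rot90[of "e - p"] by auto
      ultimately show ?thesis using null_set_hyperplane by simp
    qed
  qed
  have "Z \<in> null_sets lborel" unfolding Z_def
  proof (intro null_sets.Un null_sets.finite_UN[OF finK])
    fix i assume i: "i \<in> K"
    show "(\<Union>j\<in>K - {i}. \<Union>e\<in>E i \<inter> E j. {x. rot90 (e - p) \<bullet> x = rot90 (e - p) \<bullet> p}) \<in> null_sets lborel"
      by (intro null_sets.finite_UN finite_Diff finK lines i)
  qed (simp add: finite_imp_null_set_lborel)
  then have "AE x in lborel. x \<notin> Z" by (rule AE_not_in)
  then show ?thesis
    unfolding K_def[symmetric]
  proof (rule AE_mp, intro AE_I2 impI)
    fix x assume xZ: "x \<notin> Z"
    show "(indicator P x :: ennreal) = (\<Sum>k\<in>K. indicator (sector p k) x)"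
    proof (cases "x \<in> P")
      case False
      have "x \<notin> sector p k" if kK: "k \<in> K" for k
      proof
        assume "x \<in> sector p k"
        then obtain r y where ry: "0 < r" "r \<le> 1" "y \<in> E k" "x = p + r *\<^sub>R (y - p)"
          using sector_iff kK unfolding K_def by blast
        then have "x = (1 - r) *\<^sub>R p + r *\<^sub>R y" by (simp add: algebra_simps)
        moreover have "y \<in> P" using ry E_subset by blast
        ultimately have "x \<in> P" using convexD[OF convex_P p, of y "1 - r" r] ry by simp
        then show False using False by simp
      qed
      then show ?thesis using False by (simp add: indicator_def)
    next
      case True
      have xp: "x - p \<noteq> 0" using xZ by (auto simp: Z_def)
      obtain t k where tk: "t \<ge> 0" "k < N" "x + t *\<^sub>R (x - p) \<in> E k" "h k \<bullet> (x - p) < 0"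
        using ray_exit[OF True xp] by blast
      define y where "y = x + t *\<^sub>R (x - p)"
      have yp: "y - p = (1 + t) *\<^sub>R (x - p)" by (simp add: y_def algebra_simps)
      have "h k \<bullet> p - c k = h k \<bullet> p - h k \<bullet> y" using tk(3) by (simp add: edge_def y_def)
      also have "\<dots> = - (h k \<bullet> (y - p))" by (simp add: inner_diff_right)
      also have "\<dots> = (1 + t) * (- (h k \<bullet> (x - p)))" unfolding yp by simp
      also have "\<dots> > 0" using tk by (intro mult_pos_pos) auto
      finally have kK: "k \<in> K" using tk by (simp add: K_def)
      have "x = p + (1 / (1 + t)) *\<^sub>R (y - p)" using tk(1) unfolding yp by simp
      moreover have "0 < 1 / (1 + t)" "1 / (1 + t) \<le> 1" using tk(1) by simp_all
      ultimately have xk: "x \<in> sector p k"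
        using sector_iff[of k p x] kK tk(3) unfolding K_def y_def by blast
      have uniq: "x \<notin> sector p j" if j: "j \<in> K" "j \<noteq> k" for j
      proof
        assume "x \<in> sector p j"
        then obtain r' y' where 2: "0 < r'" "r' \<le> 1" "y' \<in> E j" "x = p + r' *\<^sub>R (y' - p)"
          using sector_iff j(1) unfolding K_def by blast
        obtain r y where 1: "0 < r" "r \<le> 1" "y \<in> E k" "x = p + r *\<^sub>R (y - p)"
          using sector_iff xk kK unfolding K_def by blast
        have rel: "r *\<^sub>R (y - p) = r' *\<^sub>R (y' - p)" using 1(4) 2(4) by simp
        \<comment> \<open>Both \<open>z\<close> and \<open>z'\<close> are on the same ray from
          \<open>p\<close>. The inequality of edge \<open>i\<close> is an equality at
          \<open>z\<close>, so the point \<open>z'\<close> of \<open>P\<close> cannot lie further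
          out. Used in both directions, this identifies the two exit points.\<close>
        have key: "s \<le> s'" if K: "i \<in> K" and yy: "z \<in> E i" "z' \<in> P" and s: "s *\<^sub>R (z - p) = s' *\<^sub>R (z' - p)" "0 < s'" for i s s' and z z' :: "real^2"
        proof -
          have "h i \<bullet> (s *\<^sub>R (z - p)) = h i \<bullet> (s' *\<^sub>R (z' - p))" using s by simp
          then have "s * (h i \<bullet> p - c i) = s' * (h i \<bullet> p - h i \<bullet> z')"
            using yy(1) by (simp add: edge_def algebra_simps)
          also have "\<dots> \<le> s' * (h i \<bullet> p - c i)"
            using yy(2) s K by (intro mult_left_mono) (auto simp: P_iff K_def)
          finally have "s * (h i \<bullet> p - c i) \<le> s' * (h i \<bullet> p - c i)" .
          then show ?thesis using K by (simp add: K_def)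
        qed
        have "r = r'" using key[OF kK 1(3) _ rel 2(1)] key[OF j(1) 2(3) _ rel[symmetric] 1(1)] 1(3) 2(3) E_subset
          by force
        then have "y = y'" using rel 1(1) by simp
        then have "y \<in> E k \<inter> E j" using 1 2 by simp
        moreover have "rot90 (y - p) \<bullet> x = rot90 (y - p) \<bullet> p"
          using inner_rot90[of "y - p"] by (simp add: 1(4) inner_add_right inner_commute)
        ultimately have "x \<in> Z" unfolding Z_def using kK j by blast
        then show False using xZ by simp
      qed
      have "(\<Sum>j\<in>K. indicator (sector p j) x) = (\<Sum>j\<in>K. if j = k then 1 else 0 :: ennreal)"
        using xk uniq by (intro sum.cong) (auto simp: indicator_def)
      also have "\<dots> = 1" using kK finK by simp
      finally show ?thesis using True by simp
    qed
  qed
qed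

text \<open>Homogeneity of degree 1 about \<open>p\<close> reduces each sector to its edge. For a
  hinge with \<open>p\<close> on the crease this replaces integration over a cut polygon by
  one-dimensional integrals.\<close>

theorem cone_formula:
  fixes m :: "real^2 \<Rightarrow> real"
  assumes p: "p \<in> P"
    and m: "continuous_on UNIV m" "\<And>x. m x \<ge> 0" "\<And>r x. r \<ge> 0 \<Longrightarrow> m (p + r *\<^sub>R (x - p)) = r * m x"
  shows "V m = (\<Sum>k<N. (h k \<bullet> p - c k) / 3 * J k m)"
proof -
  define K where "K = {k. k < N \<and> h k \<bullet> p - c k > 0}"
  have [measurable]: "m \<in> borel_measurable borel" using m(1) by (rule borel_measurable_continuous_onI)
  have cP: "continuous_on P m" using m(1) continuous_on_subset by blast
  have nn: "(h k \<bullet> p - c k) / 3 * J k m \<ge> 0" if "k < N" for k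
    using p that J_nonneg[OF cP that m(2)] by (auto simp: P_iff)
  have "ennreal (V m) = (\<integral>\<^sup>+x. indicator P x * ennreal (m x) \<partial>lborel)"
    by (rule nn_integral_P[OF cP m(2), symmetric])
  also have "\<dots> = (\<integral>\<^sup>+x. (\<Sum>k\<in>K. indicator (sector p k) x * ennreal (m x)) \<partial>lborel)"
    unfolding sum_distrib_right[symmetric]
    by (rule nn_integral_cong_AE) (use sector_partition[OF p] in \<open>auto simp: K_def\<close>)
  also have "\<dots> = (\<Sum>k\<in>K. \<integral>\<^sup>+x. indicator (sector p k) x * ennreal (m x) \<partial>lborel)"
    by (rule nn_integral_sum) measurable
  also have "\<dots> = (\<Sum>k\<in>K. ennreal ((h k \<bullet> p - c k) / 3 * J k m))"
    by (intro sum.cong sector_integral m) (auto simp: K_def)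
  also have "\<dots> = ennreal (\<Sum>k\<in>K. (h k \<bullet> p - c k) / 3 * J k m)"
    using nn by (intro sum_ennreal) (auto simp: K_def)
  also have "(\<Sum>k\<in>K. (h k \<bullet> p - c k) / 3 * J k m) = (\<Sum>k<N. (h k \<bullet> p - c k) / 3 * J k m)"
  proof (rule sum.mono_neutral_left)
    show "\<forall>i\<in>{..<N} - K. (h i \<bullet> p - c i) / 3 * J i m = 0"
    proof
      fix i assume "i \<in> {..<N} - K"
      then have "h i \<bullet> p - c i = 0" using p unfolding P_iff K_def by force
      then show "(h i \<bullet> p - c i) / 3 * J i m = 0" by simp
    qed
  qed (auto simp: K_def)
  finally have "ennreal (V m) = ennreal (\<Sum>k<N. (h k \<bullet> p - c k) / 3 * J k m)" .
  moreover have "(\<Sum>k<N. (h k \<bullet> p - c k) / 3 * J k m) \<ge> 0" by (intro sum_nonneg nn) simp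
  ultimately show ?thesis using V_nonneg[OF cP m(2)] by (metis ennreal_inj)
qed

end

section \<open>Integrals of hinge functions\<close>

lemma has_integral_affine_real:
  fixes u v p q :: real assumes "p \<le> q"
  shows "((\<lambda>t. u + v * t) has_integral (q - p) * ((u + v * p) + (u + v * q)) / 2) {p..q}"
proof -
  have "((\<lambda>t. u + v * t) has_integral ((u * q + v * q^2 / 2) - (u * p + v * p^2 / 2))) {p..q}"
    using assms
    by (intro fundamental_theorem_of_calculus)
      (auto intro!: derivative_eq_intros simp flip: has_real_derivative_iff_has_vector_derivative)
  moreover have "(u * q + v * q^2 / 2) - (u * p + v * p^2 / 2) = (q - p) * ((u + v * p) + (u + v * q)) / 2"
    by (simp add: field_simps power2_eq_square)
  ultimately show ?thesis by simp
qed

lemma has_integral_hinge_real: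
  fixes u v p q :: real
  assumes pq: "p < q" and neg: "u + v * p < 0" and pos: "0 < u + v * q"
  shows "((\<lambda>t. max 0 (u + v * t)) has_integral (q - p) * (u + v * q)^2 / (2 * ((u + v * q) - (u + v * p)))) {p..q}"
    and "((\<lambda>t. max 0 (- (u + v * t))) has_integral (q - p) * (u + v * p)^2 / (2 * ((u + v * q) - (u + v * p)))) {p..q}"
proof -
  have "v * (q - p) > 0" using neg pos by (simp add: algebra_simps)
  then have v: "v > 0" using pq by (simp add: zero_less_mult_iff)
  define r where "r = - u / v"
  have r: "u + v * r = 0" using v by (simp add: r_def)
  have uvt: "u + v * t = v * (t - r)" for t using v by (simp add: r_def field_simps)
  have "v * (p - r) < 0" "0 < v * (q - r)" using neg pos by (simp_all only: uvt)
  then have pr: "p < r" "r < q" using v by (simp_all add: mult_less_0_iff zero_less_mult_iff)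
  have "((\<lambda>t. max 0 (u + v * t)) has_integral 0) {p..r}"
    by (rule has_integral_eq[OF _ has_integral_0]) (use v in \<open>auto simp: uvt max_def mult_le_0_iff zero_le_mult_iff\<close>)
  moreover have "((\<lambda>t. max 0 (u + v * t)) has_integral (q - r) * (u + v * q) / 2) {r..q}"
    using has_integral_affine_real[of r q u v] pr
    by (subst has_integral_cong[where g = "\<lambda>t. u + v * t"]) (use v r in \<open>auto simp: uvt max_def mult_le_0_iff\<close>)
  ultimately have "((\<lambda>t. max 0 (u + v * t)) has_integral (0 + (q - r) * (u + v * q) / 2)) {p..q}"
    using pr by (intro has_integral_combine[of p r q]) auto
  moreover have "(q - r) * (u + v * q) / 2 = (q - p) * (u + v * q)^2 / (2 * ((u + v * q) - (u + v * p)))"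
    using v pq unfolding uvt by (simp add: field_simps power2_eq_square)
  ultimately show I1: "((\<lambda>t. max 0 (u + v * t)) has_integral (q - p) * (u + v * q)^2 / (2 * ((u + v * q) - (u + v * p)))) {p..q}" by simp
  have "((\<lambda>t. max 0 (u + v * t) - (u + v * t)) has_integral
      (q - p) * (u + v * q)^2 / (2 * ((u + v * q) - (u + v * p))) - (q - p) * ((u + v * p) + (u + v * q)) / 2) {p..q}"
    by (intro has_integral_diff I1 has_integral_affine_real) (use pq in simp)
  moreover have "max 0 (u + v * t) - (u + v * t) = max 0 (- (u + v * t))" for t by simp
  moreover have "(q - p) * B^2 / (2 * (B - A)) - (q - p) * (A + B) / 2 = (q - p) * A^2 / (2 * (B - A))"
    if "A < 0" "0 < B" for A B :: real
    using that by (simp add: field_simps power2_eq_square)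
  note this[OF neg pos]
  ultimately show "((\<lambda>t. max 0 (- (u + v * t))) has_integral (q - p) * (u + v * p)^2 / (2 * ((u + v * q) - (u + v * p)))) {p..q}" by simp
qed

definition hinge_fun :: "real^2 \<Rightarrow> real \<Rightarrow> real^2 \<Rightarrow> real" where "hinge_fun a b x = max 0 (a \<bullet> x + b)"

lemma continuous_hinge_fun: "continuous_on S (hinge_fun a b)"
  unfolding hinge_fun_def by (intro continuous_intros)

lemma hinge_fun_nonneg: "hinge_fun a b x \<ge> 0" by (simp add: hinge_fun_def)

section \<open>Edge integrals of hinges and rationality of the polygon data\<close>

definition rat_vec :: "real^2 \<Rightarrow> bool" where "rat_vec v \<longleftrightarrow> (\<forall>i. v $ i \<in> \<rat>)"

lemma rat_vec_inner: "rat_vec u \<Longrightarrow> rat_vec v \<Longrightarrow> u \<bullet> v \<in> \<rat>"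
  by (simp add: rat_vec_def inner_real2)

lemma rat_vec_add: "rat_vec u \<Longrightarrow> rat_vec v \<Longrightarrow> rat_vec (u + v)"
  by (simp add: rat_vec_def)

lemma rat_vec_diff: "rat_vec u \<Longrightarrow> rat_vec v \<Longrightarrow> rat_vec (u - v)"
  by (simp add: rat_vec_def)

lemma rat_vec_scaleR: "r \<in> \<rat> \<Longrightarrow> rat_vec v \<Longrightarrow> rat_vec (r *\<^sub>R v)"
  by (simp add: rat_vec_def)

lemma rat_vec_rot90: "rat_vec v \<Longrightarrow> rat_vec (rot90 v)"
  by (simp add: rat_vec_def rot90_def forall_2)

context moment
begin

lemma J_integral:
  fixes f :: "real^2 \<Rightarrow> real"
  assumes "continuous_on P f" "k < N" "((\<lambda>t. f (\<gamma> k t)) has_integral I) {lo k..hi k}"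
  shows "J k f = I"
  using set_borel_integral_eq_integral(2)[OF set_integrable_gamma[OF assms(1,2)]] assms(3)
  by (simp add: J_def integral_unique)

lemma affine_gamma:
  assumes k: "k < N"
  obtains u v where "\<And>t. al \<bullet> \<gamma> k t + bl = u + v * t"
  by (rule that[of "al \<bullet> \<gamma> k 0 + bl" "al \<bullet> rot90 (h k)"]) (simp add: \<gamma>_def algebra_simps)

lemma J_affine:
  assumes k: "k < N"
  shows "J k (\<lambda>x. al \<bullet> x + bl) = (hi k - lo k) * ((al \<bullet> \<gamma> k (lo k) + bl) + (al \<bullet> \<gamma> k (hi k) + bl)) / 2"
proof -
  obtain u v where uv: "\<And>t. al \<bullet> \<gamma> k t + bl = u + v * t" using affine_gamma[OF k] by blast
  show ?thesis unfolding uv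
    by (rule J_integral[OF _ k]) (use lo_hi(1)[OF k] has_integral_affine_real[of "lo k" "hi k" u v] in \<open>auto simp: uv intro!: continuous_intros\<close>)
qed

lemma affine_on_edge:
  assumes k: "k < N" and t: "lo k \<le> t" "t \<le> hi k"
  obtains r where "0 \<le> r" "r \<le> 1"
    "al \<bullet> \<gamma> k t + bl = (1 - r) * (al \<bullet> \<gamma> k (lo k) + bl) + r * (al \<bullet> \<gamma> k (hi k) + bl)"
proof -
  obtain u v where uv: "\<And>t. al \<bullet> \<gamma> k t + bl = u + v * t" using affine_gamma[OF k] by blast
  define r where "r = (t - lo k) / (hi k - lo k)"
  have r: "0 \<le> r" "r \<le> 1" using t lo_hi(1)[OF k] by (auto simp: r_def)
  have "r * (hi k - lo k) = t - lo k" using lo_hi(1)[OF k] by (simp add: r_def)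
  then have "t = (1 - r) * lo k + r * hi k" by (simp add: algebra_simps)
  then have "al \<bullet> \<gamma> k t + bl = (1 - r) * (al \<bullet> \<gamma> k (lo k) + bl) + r * (al \<bullet> \<gamma> k (hi k) + bl)"
  proof -
    assume teq: "t = (1 - r) * lo k + r * hi k"
    show ?thesis unfolding uv by (subst teq) (simp add: algebra_simps)
  qed
  then show thesis using that r by blast
qed

lemma J_hinge_fun_uncrossed:
  fixes al :: "real^2" and bl :: real
  assumes k: "k < N"
  defines "p \<equiv> al \<bullet> \<gamma> k (lo k) + bl" and "q \<equiv> al \<bullet> \<gamma> k (hi k) + bl"
  assumes "\<not> (p < 0 \<and> 0 < q)" "\<not> (q < 0 \<and> 0 < p)"
  shows "J k (hinge_fun al bl) = (if p > 0 \<or> q > 0 then (hi k - lo k) * (p + q) / 2 else 0)"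
proof (cases "p > 0 \<or> q > 0")
  case True
  then have pq: "p \<ge> 0" "q \<ge> 0" using assms by auto
  have "J k (hinge_fun al bl) = J k (\<lambda>x. al \<bullet> x + bl)"
  proof (rule J_cong[OF k])
    fix x assume "x \<in> E k"
    then obtain t where t: "x = \<gamma> k t" "lo k \<le> t" "t \<le> hi k" unfolding E_eq[OF k] by auto
    obtain r where r: "0 \<le> r" "r \<le> 1" "al \<bullet> \<gamma> k t + bl = (1 - r) * p + r * q"
      using affine_on_edge[OF k t(2,3), of al bl] unfolding p_def q_def by blast
    have "(1 - r) * p + r * q \<ge> 0" using r pq by simp
    then show "hinge_fun al bl x = al \<bullet> x + bl" unfolding hinge_fun_def t(1) r(3) by simp
  qed
  then show ?thesis using True by (simp add: J_affine[OF k] p_def q_def)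
next
  case False
  then have pq: "- p \<ge> 0" "- q \<ge> 0" by auto
  have "J k (hinge_fun al bl) = J k (\<lambda>x. 0)"
  proof (rule J_cong[OF k])
    fix x assume "x \<in> E k"
    then obtain t where t: "x = \<gamma> k t" "lo k \<le> t" "t \<le> hi k" unfolding E_eq[OF k] by auto
    obtain r where r: "0 \<le> r" "r \<le> 1" "al \<bullet> \<gamma> k t + bl = (1 - r) * p + r * q"
      using affine_on_edge[OF k t(2,3), of al bl] unfolding p_def q_def by blast
    have "(1 - r) * (- p) + r * (- q) \<ge> 0" using r pq by (intro add_nonneg_nonneg mult_nonneg_nonneg) auto
    then have "(1 - r) * p + r * q \<le> 0" by (simp add: algebra_simps)
    then show "hinge_fun al bl x = 0" unfolding hinge_fun_def t(1) r(3) by simp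
  qed
  then show ?thesis using False J_const[OF k, of 0] by simp
qed

lemma J_hinge_fun_up:
  fixes al :: "real^2" and bl :: real
  assumes k: "k < N"
  defines "p \<equiv> al \<bullet> \<gamma> k (lo k) + bl" and "q \<equiv> al \<bullet> \<gamma> k (hi k) + bl"
  assumes "p < 0" "0 < q"
  shows "J k (hinge_fun al bl) = (hi k - lo k) * q^2 / (2 * (q - p))"
proof -
  obtain u v where uv: "\<And>t. al \<bullet> \<gamma> k t + bl = u + v * t" using affine_gamma[OF k] by blast
  show ?thesis
    using J_integral[OF continuous_hinge_fun k] has_integral_hinge_real(1)[OF lo_hi(1)[OF k], of u v] assms(4,5)
    by (simp add: hinge_fun_def uv p_def q_def)
qed

lemma J_hinge_fun_down:
  fixes al :: "real^2" and bl :: real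
  assumes k: "k < N"
  defines "p \<equiv> al \<bullet> \<gamma> k (lo k) + bl" and "q \<equiv> al \<bullet> \<gamma> k (hi k) + bl"
  assumes "q < 0" "0 < p"
  shows "J k (hinge_fun al bl) = (hi k - lo k) * p^2 / (2 * (p - q))"
proof -
  obtain u v where uv: "\<And>t. (- al) \<bullet> \<gamma> k t + (- bl) = u + v * t" using affine_gamma[OF k] by blast
  have uv': "al \<bullet> \<gamma> k t + bl = - (u + v * t)" for t using uv[of t] by simp
  have "(- (u + v * lo k))^2 = (u + v * lo k)^2" by (rule power2_minus)
  then show ?thesis
    using J_integral[OF continuous_hinge_fun k, of al bl] has_integral_hinge_real(2)[OF lo_hi(1)[OF k], of u v] assms(4,5)
    unfolding hinge_fun_def uv' p_def q_def by simp
qed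

lemma V_hinge_fun:
  assumes p: "p \<in> P" "al \<bullet> p + bl = 0"
  shows "V (hinge_fun al bl) = (\<Sum>k<N. (h k \<bullet> p - c k) / 3 * J k (hinge_fun al bl))"
proof (rule cone_formula[OF p(1) continuous_hinge_fun hinge_fun_nonneg])
  fix r :: real and x assume r: "r \<ge> 0"
  have b: "bl = - (al \<bullet> p)" using p(2) by simp
  have "al \<bullet> (p + r *\<^sub>R (x - p)) + bl = r * (al \<bullet> x + bl)"
    unfolding b by (simp add: inner_add_right inner_diff_right)
  then show "hinge_fun al bl (p + r *\<^sub>R (x - p)) = r * hinge_fun al bl x"
    unfolding hinge_fun_def using r by (simp add: max_mult_distrib_left)
qed

text \<open>A hinge is homogeneous about every point of its crease, so the apex \<open>p\<close> is
  free. At a vertex the weights are rational constants; at a point moving along an edge they are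
  affine in its parameter.\<close>

lemma L_hinge_fun:
  assumes p: "p \<in> P" "al \<bullet> p + bl = 0"
  shows "L (hinge_fun al bl) = (\<Sum>k<N. (1 - a / 3 * (h k \<bullet> p - c k)) * J k (hinge_fun al bl))"
  unfolding L_def B_def V_hinge_fun[OF p] by (simp add: sum_distrib_left sum_subtractf[symmetric] algebra_simps)

lemma rat_vec_vertex:
  assumes "k < N" shows "rat_vec (\<gamma> k (lo k))" "rat_vec (\<gamma> k (hi k))"
  using lattice_vertex[OF assms] Ints_subset_Rats by (auto simp: lattice_point_def rat_vec_def)

lemma rat_vec_h: assumes "k < N" shows "rat_vec (h k)"
proof -
  obtain p q :: int where "h k = vector [of_int p, of_int q]"
    using moment_polygon assms unfolding moment_polygon_def primitive_covector_def by blast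
  then show ?thesis by (simp add: rat_vec_def forall_2)
qed

lemma c_rat: assumes "k < N" shows "c k \<in> \<rat>"
  using inner_gamma[OF assms, of "lo k"] rat_vec_inner[OF rat_vec_h rat_vec_vertex(1)] assms by metis

lemma gamma_inner_rot90: "rot90 (h k) \<bullet> \<gamma> k t = t * (h k \<bullet> h k)"
  using inner_rot90[of "h k"] by (simp add: \<gamma>_def inner_add_right rot90_inner_rot90 inner_commute)

lemma lo_hi_rat: assumes k: "k < N" shows "lo k \<in> \<rat>" "hi k \<in> \<rat>"
proof -
  have "t \<in> \<rat>" if "rat_vec (\<gamma> k t)" for t
  proof -
    have "t = (rot90 (h k) \<bullet> \<gamma> k t) / (h k \<bullet> h k)" using gamma_inner_rot90 h_pos[OF k] by simp
    moreover have "(rot90 (h k) \<bullet> \<gamma> k t) / (h k \<bullet> h k) \<in> \<rat>"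
      by (intro Rats_divide rat_vec_inner rat_vec_rot90 rat_vec_h k that)
    ultimately show ?thesis by simp
  qed
  then show "lo k \<in> \<rat>" "hi k \<in> \<rat>" using rat_vec_vertex[OF k] by blast+
qed

end

section \<open>Stability tested on rational affine functions and rational hinges\<close>

locale stable = moment +
  assumes stable: "\<And>f. rational_pl_convex_on (polygon N h c) f \<Longrightarrow>
           futaki N h c f \<ge> 0 \<and> (futaki N h c f = 0 \<longleftrightarrow> affine_linear_on (polygon N h c) f)"
begin

lemma L_rational_affine:
  assumes "rat_vec al" "bl \<in> \<rat>" shows "L (\<lambda>x. al \<bullet> x + bl) = 0"
proof -
  have "rational_pl_convex_on P (\<lambda>x. al \<bullet> x + bl)"
    unfolding rational_pl_convex_on_def using assms
    by (intro exI[of _ "{(al, bl)}"]) (simp add: rat_vec_def)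
  moreover have "affine_linear_on P (\<lambda>x. al \<bullet> x + bl)"
    unfolding affine_linear_on_def affine_linear_def
    by (intro exI[of _ "\<lambda>x. al \<bullet> x + bl"] conjI ballI refl) blast
  ultimately have "futaki N h c (\<lambda>x. al \<bullet> x + bl) = 0" using stable by blast
  moreover have "continuous_on P (\<lambda>x. al \<bullet> x + bl)" by (intro continuous_intros)
  ultimately show ?thesis by (simp add: futaki_eq)
qed

text \<open>\<open>L\<close> is linear, and the coordinates and the constant 1 have rational
  coefficients.\<close>

lemma L_affine: "L (\<lambda>x. al \<bullet> x + bl) = 0"
proof -
  have e: "L (\<lambda>x. axis i 1 \<bullet> x + 0) = 0" for i
    by (rule L_rational_affine) (auto simp: rat_vec_def axis_def)
  have one: "L (\<lambda>x. 0 \<bullet> x + 1) = 0"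
    by (rule L_rational_affine) (auto simp: rat_vec_def)
  have "(\<lambda>x. al \<bullet> x + bl) = (\<lambda>x. (al$1 * (axis 1 1 \<bullet> x + 0) + al$2 * (axis 2 1 \<bullet> x + 0)) + bl * (0 \<bullet> x + 1))"
    by (auto simp: inner_real2 axis_def)
  then have "L (\<lambda>x. al \<bullet> x + bl) = (al$1 * L (\<lambda>x. axis 1 1 \<bullet> x + 0) + al$2 * L (\<lambda>x. axis 2 1 \<bullet> x + 0)) + bl * L (\<lambda>x. 0 \<bullet> x + 1)"
    by (simp only:) (subst L_add, (intro continuous_intros)+, subst L_add, (intro continuous_intros)+, simp only: L_cmult)
  then show ?thesis by (simp only: e one)
qed

lemma L_affine_linear: "affine_linear l \<Longrightarrow> L l = 0"
proof -
  assume "affine_linear l"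
  then obtain al bl where "\<forall>x. l x = al \<bullet> x + bl" unfolding affine_linear_def by blast
  then have "l = (\<lambda>x. al \<bullet> x + bl)" by auto
  then show ?thesis using L_affine by simp
qed

lemma rational_pl_hinge_fun:
  assumes "rat_vec al" "bl \<in> \<rat>" shows "rational_pl_convex_on P (hinge_fun al bl)"
  unfolding rational_pl_convex_on_def using assms
  by (intro exI[of _ "{(0, 0), (al, bl)}"]) (auto simp: rat_vec_def hinge_fun_def)

lemma L_hinge_fun_rational_nonneg:
  assumes "rat_vec al" "bl \<in> \<rat>" shows "L (hinge_fun al bl) \<ge> 0"
  using stable[OF rational_pl_hinge_fun[OF assms]] futaki_eq[OF continuous_hinge_fun] by simp

text \<open>Equality in the stability hypothesis would make the hinge affine linear on
  \<open>P\<close>, although on the segment from \<open>v\<close> to \<open>w\<close> it is zero up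
  to the crease and positive after it.\<close>

lemma L_hinge_fun_rational_pos:
  assumes "rat_vec al" "bl \<in> \<rat>" and v: "v \<in> P" "al \<bullet> v + bl < 0" and w: "w \<in> P" "0 < al \<bullet> w + bl"
  shows "L (hinge_fun al bl) > 0"
proof (rule ccontr)
  assume "\<not> ?thesis"
  then have "L (hinge_fun al bl) = 0" using L_hinge_fun_rational_nonneg[OF assms(1,2)] by simp
  then have "affine_linear_on P (hinge_fun al bl)"
    using stable[OF rational_pl_hinge_fun[OF assms(1,2)]] futaki_eq[OF continuous_hinge_fun] by simp
  then obtain g where g: "affine_linear g" "\<And>x. x \<in> P \<Longrightarrow> hinge_fun al bl x = g x"
    unfolding affine_linear_on_def by blast
  define p q where "p = al \<bullet> v + bl" and "q = al \<bullet> w + bl"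
  have pq: "p < 0" "0 < q" using v w by (simp_all add: p_def q_def)
  define u where "u = - p / (q - p)"
  have u: "0 < u" "u < 1"
    using divide_pos_pos[of "- p" "q - p"] pos_divide_less_eq[of "q - p" "- p" 1] pq by (simp_all add: u_def)
  have z: "(1 - u) *\<^sub>R v + u *\<^sub>R w \<in> P" using convexD[OF convex_P v(1) w(1), of "1 - u" u] u by simp
  have "al \<bullet> ((1 - u) *\<^sub>R v + u *\<^sub>R w) + bl = (1 - u) * p + u * q"
    by (simp add: p_def q_def algebra_simps)
  also have "\<dots> = p + u * (q - p)" by (simp add: algebra_simps)
  also have "\<dots> = 0" using pq by (simp add: u_def)
  finally have "g ((1 - u) *\<^sub>R v + u *\<^sub>R w) = 0" using g(2)[OF z] by (simp add: hinge_fun_def)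
  moreover have "g v = 0" "g w = q" using g(2)[OF v(1)] g(2)[OF w(1)] pq by (simp_all add: hinge_fun_def p_def q_def)
  moreover have "g ((1 - u) *\<^sub>R v + u *\<^sub>R w) = (1 - u) * g v + u * g w"
    by (rule affine_linear_combination2[OF g(1)]) simp
  ultimately show False using u pq by simp
qed

text \<open>On \<open>P\<close> the affine function \<open>h 0 \<bullet> x - c 0\<close> coincides
  with a hinge that has a vertex on its crease. As \<open>L\<close> vanishes on it, \<open>a\<close>
  is the quotient of its boundary and area integrals. The former is a sum of rational edge
  integrals, and the cone formula expresses the latter by the same integrals.\<close>

lemma a_rat: "a \<in> \<rat>"
proof -
  define p where "p = \<gamma> 0 (lo 0)"
  have N0: "0 < N" by (rule N_pos)
  have pP: "p \<in> P" "h 0 \<bullet> p + (- c 0) = 0" using gamma_P[OF N0] lo_hi(1)[OF N0] inner_gamma[OF N0] by (auto simp: p_def)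
  have eq: "hinge_fun (h 0) (- c 0) x = h 0 \<bullet> x + (- c 0)" if "x \<in> P" for x
  proof -
    have "c 0 \<le> h 0 \<bullet> x" using that N0 unfolding P_iff by blast
    then show ?thesis by (simp add: hinge_fun_def)
  qed
  have "L (hinge_fun (h 0) (- c 0)) = L (\<lambda>x. h 0 \<bullet> x + (- c 0))"
    unfolding L_def by (simp only: B_cong[OF eq] V_cong[OF eq])
  then have BV: "B (hinge_fun (h 0) (- c 0)) = a * V (hinge_fun (h 0) (- c 0))" unfolding L_affine by (simp add: L_def)
  obtain x where x: "x \<in> P" "hinge_fun (h 0) (- c 0) x > 0"
  proof -
    obtain x where x: "x \<in> interior P" using interior_P by blast
    have "h 0 \<bullet> x \<noteq> c 0"
    proof
      assume e: "h 0 \<bullet> x = c 0"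
      obtain d where d: "d > 0" "ball x d \<subseteq> P" using x mem_interior by blast
      define y where "y = x - (d / 2 / norm (h 0)) *\<^sub>R h 0"
      have "norm (y - x) = d / 2" using h_nonzero[OF N0] d by (simp add: y_def)
      then have "y \<in> P" using d by (auto simp: dist_norm norm_minus_commute)
      moreover have "h 0 \<bullet> y < c 0" using h_pos[OF N0] h_nonzero[OF N0] d e by (simp add: y_def inner_diff_right)
      moreover have "y \<in> P \<Longrightarrow> c 0 \<le> h 0 \<bullet> y" using N0 unfolding P_iff by blast
      ultimately show False by simp
    qed
    moreover have xP: "x \<in> P" using x interior_subset by blast
    moreover from xP have "c 0 \<le> h 0 \<bullet> x" using N0 unfolding P_iff by blast
    ultimately have "h 0 \<bullet> x > c 0" by simp
    then show thesis using that xP by (simp add: hinge_fun_def)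
  qed
  have Vp: "V (hinge_fun (h 0) (- c 0)) > 0" by (rule V_pos[OF continuous_hinge_fun hinge_fun_nonneg x])
  have Jr: "J k (hinge_fun (h 0) (- c 0)) \<in> \<rat>" if k: "k < N" for k
  proof -
    have "J k (hinge_fun (h 0) (- c 0)) = J k (\<lambda>x. h 0 \<bullet> x + (- c 0))"
      using E_subset eq by (intro J_cong[OF k]) blast
    also have "\<dots> \<in> \<rat>" unfolding J_affine[OF k]
      by (intro Rats_divide Rats_mult Rats_diff Rats_add lo_hi_rat k rat_vec_inner rat_vec_h N0 rat_vec_vertex)
        (simp_all add: c_rat N0)
    finally show ?thesis .
  qed
  have "B (hinge_fun (h 0) (- c 0)) \<in> \<rat>" unfolding B_def by (intro Rats_sum Jr) simp
  moreover have "V (hinge_fun (h 0) (- c 0)) \<in> \<rat>" unfolding V_hinge_fun[OF pP]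
    by (intro Rats_sum Rats_mult Rats_divide Rats_diff Jr rat_vec_inner rat_vec_h c_rat)
      (auto simp: p_def rat_vec_vertex N0)
  ultimately have "B (hinge_fun (h 0) (- c 0)) / V (hinge_fun (h 0) (- c 0)) \<in> \<rat>" by simp
  then show ?thesis using BV Vp by simp
qed

end

section \<open>Positivity on hinge functions\<close>

lemma rational_sequence: obtains q :: "nat \<Rightarrow> rat" where "(\<lambda>n. of_rat (q n)) \<longlonglongrightarrow> (x::real)"
proof -
  have "\<exists>q::rat. \<bar>of_rat q - x\<bar> < inverse (real (Suc n))" for n
    using rational_approx[of "inverse (real (Suc n))" x] by auto
  then obtain q :: "nat \<Rightarrow> rat" where q: "\<And>n. \<bar>of_rat (q n) - x\<bar> < inverse (real (Suc n))" by metis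
  have "norm (of_rat (q n) - x) \<le> inverse (real (Suc n))" for n
    using less_imp_le[OF q[of n]] unfolding real_norm_def .
  then have "(\<lambda>n. of_rat (q n) - x) \<longlonglongrightarrow> 0"
    by (intro Lim_null_comparison[OF always_eventually[OF allI] LIMSEQ_inverse_real_of_nat])
  then show thesis by (rule that[OF LIM_zero_cancel])
qed

definition crossing :: "(real^2) set \<Rightarrow> real^2 \<Rightarrow> real \<Rightarrow> bool" where
  "crossing S al bl \<longleftrightarrow> (\<exists>v\<in>S. \<exists>w\<in>S. al \<bullet> v + bl < 0 \<and> 0 < al \<bullet> w + bl)"

context moment
begin

lemma B_lipschitz:
  assumes "continuous_on P f" "continuous_on P g" "\<And>x. x \<in> P \<Longrightarrow> \<bar>f x - g x\<bar> \<le> e"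
  shows "\<bar>B f - B g\<bar> \<le> e * B (\<lambda>_. 1)"
proof -
  have le: "B f \<le> B g + e * B (\<lambda>_. 1)"
    if "continuous_on P f" "continuous_on P g" "\<And>x. x \<in> P \<Longrightarrow> f x \<le> g x + e * 1" for f g
  proof -
    have "B f \<le> B (\<lambda>x. g x + e * 1)"
      by (rule B_mono) (use that E_subset in \<open>auto intro!: continuous_intros\<close>)
    also have "\<dots> = B g + e * B (\<lambda>_. 1)"
      using B_add[of g "\<lambda>_. e * 1"] B_cmult[of e "\<lambda>_. 1"] that(2) by simp
    finally show ?thesis .
  qed
  have "f x \<le> g x + e * 1" "g x \<le> f x + e * 1" if "x \<in> P" for x using assms(3)[OF that] by auto
  then show ?thesis using le[OF assms(1,2)] le[OF assms(2,1)] by (simp add: abs_le_iff)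
qed

lemma V_lipschitz:
  assumes "continuous_on P f" "continuous_on P g" "\<And>x. x \<in> P \<Longrightarrow> \<bar>f x - g x\<bar> \<le> e"
  shows "\<bar>V f - V g\<bar> \<le> e * V (\<lambda>_. 1)"
proof -
  have le: "V f \<le> V g + e * V (\<lambda>_. 1)"
    if "continuous_on P f" "continuous_on P g" "\<And>x. x \<in> P \<Longrightarrow> f x \<le> g x + e * 1" for f g
  proof -
    have "V f \<le> V (\<lambda>x. g x + e * 1)"
      by (rule V_mono) (use that in \<open>auto intro!: continuous_intros\<close>)
    also have "\<dots> = V g + e * V (\<lambda>_. 1)"
      using V_add[of g "\<lambda>_. e * 1"] V_cmult[of e "\<lambda>_. 1"] that(2) by simp
    finally show ?thesis .
  qed
  have "f x \<le> g x + e * 1" "g x \<le> f x + e * 1" if "x \<in> P" for x using assms(3)[OF that] by auto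
  then show ?thesis using le[OF assms(1,2)] le[OF assms(2,1)] by (simp add: abs_le_iff)
qed

lemma tendsto_hinge_fun:
  assumes "an \<longlonglongrightarrow> al" "bn \<longlonglongrightarrow> bl"
  shows "(\<lambda>n. B (hinge_fun (an n) (bn n))) \<longlonglongrightarrow> B (hinge_fun al bl)"
    and "(\<lambda>n. V (hinge_fun (an n) (bn n))) \<longlonglongrightarrow> V (hinge_fun al bl)"
    and "(\<lambda>n. V (\<lambda>x. an n \<bullet> x + bn n)) \<longlonglongrightarrow> V (\<lambda>x. al \<bullet> x + bl)"
proof -
  obtain R where R: "\<And>x. x \<in> P \<Longrightarrow> norm x \<le> R" using bounded_P by (auto simp: bounded_iff)
  define e where "e = (\<lambda>n. norm (an n - al) * R + \<bar>bn n - bl\<bar>)"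
  have e0: "e \<longlonglongrightarrow> 0"
    unfolding e_def
    using tendsto_add[OF tendsto_mult_left_zero[OF tendsto_norm_zero[OF LIM_zero[OF assms(1)]], of R]
        tendsto_rabs_zero[OF LIM_zero[OF assms(2)]]] by simp
  have aff: "\<bar>(an n \<bullet> x + bn n) - (al \<bullet> x + bl)\<bar> \<le> e n" if "x \<in> P" for x n
  proof -
    have "\<bar>(an n - al) \<bullet> x\<bar> \<le> norm (an n - al) * norm x" by (rule Cauchy_Schwarz_ineq2)
    also have "\<dots> \<le> norm (an n - al) * R" by (intro mult_left_mono R that) simp
    finally show ?thesis by (simp add: e_def inner_diff_left)
  qed
  then have hgd: "\<bar>hinge_fun (an n) (bn n) x - hinge_fun al bl x\<bar> \<le> e n" if "x \<in> P" for x n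
    using aff[OF that, of n] by (auto simp: hinge_fun_def max_def abs_le_iff)
  have lim: "X \<longlonglongrightarrow> x" if "\<And>n. \<bar>X n - x\<bar> \<le> e n * C" for X x C
  proof -
    have "(\<lambda>n. e n * C) \<longlonglongrightarrow> 0" using tendsto_mult_left_zero[OF e0] .
    then have "(\<lambda>n. X n - x) \<longlonglongrightarrow> 0"
      by (rule Lim_null_comparison[rotated]) (use that in auto)
    then show ?thesis by (rule LIM_zero_cancel)
  qed
  show "(\<lambda>n. B (hinge_fun (an n) (bn n))) \<longlonglongrightarrow> B (hinge_fun al bl)"
    by (rule lim, rule B_lipschitz) (use hgd continuous_hinge_fun in auto)
  show "(\<lambda>n. V (hinge_fun (an n) (bn n))) \<longlonglongrightarrow> V (hinge_fun al bl)"
    by (rule lim, rule V_lipschitz) (use hgd continuous_hinge_fun in auto)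
  show "(\<lambda>n. V (\<lambda>x. an n \<bullet> x + bn n)) \<longlonglongrightarrow> V (\<lambda>x. al \<bullet> x + bl)"
    by (rule lim, rule V_lipschitz) (use aff in \<open>auto intro!: continuous_intros\<close>)
qed

lemma tendsto_L_hinge_fun:
  assumes "an \<longlonglongrightarrow> al" "bn \<longlonglongrightarrow> bl"
  shows "(\<lambda>n. L (hinge_fun (an n) (bn n))) \<longlonglongrightarrow> L (hinge_fun al bl)"
  unfolding L_def by (intro tendsto_intros tendsto_hinge_fun assms)

text \<open>Otherwise the affine function would be a multiple of
  \<open>h k \<bullet> x - c k\<close>, which cannot take both signs on \<open>P\<close>.\<close>

lemma no_flat_zero:
  assumes cr: "crossing P al bl" and k: "k < N" and x: "x \<in> E k" "z \<in> E k" "x \<noteq> z"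
    and zero: "al \<bullet> x + bl = 0" "al \<bullet> z + bl = 0"
  shows False
proof -
  obtain s t where st: "x = \<gamma> k s" "z = \<gamma> k t" using x unfolding E_eq[OF k] by blast
  then have "s \<noteq> t" using x by auto
  have "(s - t) * (al \<bullet> rot90 (h k)) = 0"
    unfolding inner_gamma_diff[symmetric] using zero unfolding st by linarith
  then have o: "rot90 (h k) \<bullet> al = 0" using \<open>s \<noteq> t\<close> by (simp add: inner_commute)
  define m where "m = (h k \<bullet> al) / (h k \<bullet> h k)"
  have al: "al = m *\<^sub>R h k" using rot90_decomposition[OF h_nonzero[OF k], of al] o by (simp add: m_def)
  have bl: "bl = - m * c k" using zero(1) inner_gamma[OF k, of s] unfolding st(1) by (simp add: al)
  obtain v w where vw: "v \<in> P" "w \<in> P" "al \<bullet> v + bl < 0" "0 < al \<bullet> w + bl"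
    using cr unfolding crossing_def by blast
  have "h k \<bullet> v - c k \<ge> 0" "h k \<bullet> w - c k \<ge> 0" using vw(1,2) k unfolding P_iff by auto
  moreover have "m * (h k \<bullet> v - c k) < 0" "0 < m * (h k \<bullet> w - c k)"
    using vw(3,4) by (simp_all add: al bl algebra_simps)
  ultimately show False by (auto simp: mult_less_0_iff zero_less_mult_iff)
qed

lemma strict_between_E:
  assumes k: "k < N" and x: "x \<in> P" "z \<in> P" and u: "0 < u" "u < 1" and y: "(1 - u) *\<^sub>R x + u *\<^sub>R z \<in> E k"
  shows "x \<in> E k" "z \<in> E k"
proof -
  have nn: "h k \<bullet> x - c k \<ge> 0" "h k \<bullet> z - c k \<ge> 0" using x k unfolding P_iff by auto
  have "h k \<bullet> ((1 - u) *\<^sub>R x + u *\<^sub>R z) = c k" using y by (simp add: edge_def)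
  then have "(1 - u) * (h k \<bullet> x) + u * (h k \<bullet> z) = c k" by (simp only: inner_add_right inner_scaleR_right)
  then have sum0: "(1 - u) * (h k \<bullet> x - c k) + u * (h k \<bullet> z - c k) = 0" by argo
  have "(1 - u) * (h k \<bullet> x - c k) \<ge> 0" "u * (h k \<bullet> z - c k) \<ge> 0" using nn u by auto
  then have "(1 - u) * (h k \<bullet> x - c k) = 0" "u * (h k \<bullet> z - c k) = 0" using sum0 by linarith+
  then have "h k \<bullet> x = c k" "h k \<bullet> z = c k" using u by auto
  then show "x \<in> E k" "z \<in> E k" using x by (simp_all add: edge_def)
qed

text \<open>The crease leaves \<open>P\<close> in both directions, at \<open>x1\<close> and
  \<open>x2\<close>. A third boundary zero would lie strictly between them, and
  \<open>strict_between_E\<close> would put both ends on one edge, against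
  \<open>no_flat_zero\<close>.\<close>

lemma boundary_zeros:
  assumes cr: "crossing P al bl"
  obtains x1 x2 k1 k2 where "k1 < N" "k2 < N" "x1 \<in> E k1" "x2 \<in> E k2" "x1 \<noteq> x2"
    "al \<bullet> x1 + bl = 0" "al \<bullet> x2 + bl = 0"
    "\<And>y k. k < N \<Longrightarrow> y \<in> E k \<Longrightarrow> al \<bullet> y + bl = 0 \<Longrightarrow> y = x1 \<or> y = x2"
proof -
  obtain v w where vw: "v \<in> P" "w \<in> P" "al \<bullet> v + bl < 0" "0 < al \<bullet> w + bl"
    using cr unfolding crossing_def by blast
  define p q where "p = al \<bullet> v + bl" and "q = al \<bullet> w + bl"
  have pq: "p < 0" "0 < q" using vw by (simp_all add: p_def q_def)
  define u where "u = - p / (q - p)"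
  have u: "0 < u" "u < 1"
    using divide_pos_pos[of "- p" "q - p"] pos_divide_less_eq[of "q - p" "- p" 1] pq by (simp_all add: u_def)
  define z where "z = (1 - u) *\<^sub>R v + u *\<^sub>R w"
  have zP: "z \<in> P" unfolding z_def using convexD[OF convex_P vw(1,2), of "1 - u" u] u by simp
  have "al \<bullet> z + bl = (1 - u) * p + u * q"
    by (simp add: p_def q_def z_def algebra_simps)
  also have "\<dots> = p + u * (q - p)" by (simp add: algebra_simps)
  also have "\<dots> = 0" using pq by (simp add: u_def)
  finally have z0: "al \<bullet> z + bl = 0" .
  have al0: "al \<noteq> 0" using vw by auto
  define d where "d = rot90 al"
  have ald: "al \<bullet> d = 0" by (simp add: d_def inner_rot90)
  have d0: "d \<noteq> 0" "- d \<noteq> 0" using rot90_inner_rot90[of al] al0 by (auto simp: d_def)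
  obtain t1 k1 where 1: "t1 \<ge> 0" "k1 < N" "z + t1 *\<^sub>R d \<in> E k1" "h k1 \<bullet> d < 0"
    using ray_exit[OF zP d0(1)] by blast
  obtain t2 k2 where 2: "t2 \<ge> 0" "k2 < N" "z + t2 *\<^sub>R (- d) \<in> E k2" "h k2 \<bullet> (- d) < 0"
    using ray_exit[OF zP d0(2)] by blast
  define x1 x2 where "x1 = z + t1 *\<^sub>R d" and "x2 = z + t2 *\<^sub>R (- d)"
  have x12: "x1 - x2 = (t1 + t2) *\<^sub>R d" by (simp add: x1_def x2_def algebra_simps)
  \<comment> \<open>If both exits were \<open>z\<close> itself, the points \<open>v\<close> and
    \<open>w\<close> would lie on both exit edges, so these would coincide, although
    \<open>d\<close> points outwards at one and \<open>- d\<close> at the other.\<close>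
  have tpos: "t1 + t2 > 0"
  proof (rule ccontr)
    assume "\<not> ?thesis"
    then have t0: "t1 = 0" "t2 = 0" using 1(1) 2(1) by auto
    have in1: "v \<in> E k1" "w \<in> E k1"
      using strict_between_E[OF 1(2) vw(1,2) u] 1(3) t0 by (simp_all add: z_def)
    have in2: "v \<in> E k2" "w \<in> E k2"
      using strict_between_E[OF 2(2) vw(1,2) u] 2(3) t0 by (simp_all add: z_def)
    obtain s t where st: "v = \<gamma> k1 s" "w = \<gamma> k1 t" using in1 unfolding E_eq[OF 1(2)] by blast
    have "v \<noteq> w" using vw(3,4) by auto
    then have "s \<noteq> t" using st by auto
    then have "k1 = k2" using edge_unique[OF 1(2) 2(2)] in2 st by blast
    then show False using 1(4) 2(4) by simp
  qed
  have zx: "al \<bullet> x1 + bl = 0" "al \<bullet> x2 + bl = 0" using z0 ald by (simp_all add: x1_def x2_def inner_add_right inner_diff_right)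
  have xP: "x1 \<in> P" "x2 \<in> P" using 1(3) 2(3) E_subset by (auto simp: x1_def x2_def)
  have only: "y = x1 \<or> y = x2" if y: "k < N" "y \<in> E k" "al \<bullet> y + bl = 0" for y k
  proof (rule ccontr)
    assume ne: "\<not> ?thesis"
    have yP: "y \<in> P" using y(2) E_subset by blast
    have "al \<bullet> (y - z) = 0" using y(3) z0 by (simp add: inner_diff_right)
    then have "y - z = ((rot90 al \<bullet> (y - z)) / (al \<bullet> al)) *\<^sub>R rot90 al"
      using rot90_decomposition[OF al0, of "y - z"] by simp
    then obtain t where t: "y = z + t *\<^sub>R d" unfolding d_def by (metis add.commute diff_add_cancel)
    have "c k1 \<le> h k1 \<bullet> y" "h k1 \<bullet> x1 = c k1" using yP 1 unfolding P_iff by (auto simp: edge_def x1_def)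
    then have "(t1 - t) * (h k1 \<bullet> d) \<le> 0" unfolding t x1_def by (simp add: inner_add_right algebra_simps)
    then have "t \<le> t1" using 1(4) by (simp add: mult_le_0_iff)
    moreover have "t \<noteq> t1" using ne t by (auto simp: x1_def)
    ultimately have tt1: "t < t1" by simp
    have "c k2 \<le> h k2 \<bullet> y" "h k2 \<bullet> x2 = c k2" using yP 2 unfolding P_iff by (auto simp: edge_def x2_def)
    then have "(t2 + t) * (h k2 \<bullet> d) \<ge> 0" unfolding t x2_def by (simp add: inner_add_right inner_diff_right algebra_simps)
    then have "- t2 \<le> t" using 2(4) by (simp add: zero_le_mult_iff)
    moreover have "t \<noteq> - t2" using ne t by (auto simp: x2_def)
    ultimately have tt2: "- t2 < t" by simp
    define r where "r = (t + t2) / (t1 + t2)"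
    have r: "0 < r" "r < 1" using tt1 tt2 tpos by (simp_all add: r_def)
    have rt: "r * (t1 + t2) = t + t2" using tpos by (simp add: r_def)
    have "(1 - r) *\<^sub>R x2 + r *\<^sub>R x1 = x2 + r *\<^sub>R (x1 - x2)" by (simp add: algebra_simps)
    also have "\<dots> = x2 + (t + t2) *\<^sub>R d" unfolding x12 scaleR_scaleR rt ..
    also have "\<dots> = y" by (simp add: x2_def t algebra_simps)
    finally have "(1 - r) *\<^sub>R x2 + r *\<^sub>R x1 \<in> E k" using y(2) by simp
    then have "x2 \<in> E k" "x1 \<in> E k" using strict_between_E[OF y(1) xP(2,1) r] by auto
    moreover have "x2 \<noteq> x1" using x12 tpos d0 by auto
    ultimately show False using no_flat_zero[OF cr y(1)] zx by blast
  qed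
  show thesis
    by (rule that[OF 1(2) 2(2) 1(3)[folded x1_def] 2(3)[folded x2_def] _ zx only])
      (use x12 tpos d0 in auto)
qed

lemma nonvertex_unique:
  assumes j: "j < N" "lo j < t" "t < hi j" and k: "k < N" and tk: "\<gamma> j t \<in> E k"
  shows "k = j"
proof -
  define u where "u = (t - lo j) / (hi j - lo j)"
  have u: "0 < u" "u < 1" using j by (simp_all add: u_def)
  have "u * (hi j - lo j) = t - lo j" using j by (simp add: u_def)
  then have "t = (1 - u) * lo j + u * hi j" by (simp add: algebra_simps)
  then have "\<gamma> j t = (1 - u) *\<^sub>R \<gamma> j (lo j) + u *\<^sub>R \<gamma> j (hi j)" using gamma_affine[of "1 - u" u] by simp
  moreover have "\<gamma> j (lo j) \<in> P" "\<gamma> j (hi j) \<in> P" using lo_hi[OF j(1)] by auto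
  ultimately have "\<gamma> j (lo j) \<in> E k" "\<gamma> j (hi j) \<in> E k"
    using strict_between_E[OF k _ _ u] tk by auto
  then show ?thesis using edge_unique[OF j(1) k, of "lo j" "hi j"] j by auto
qed

lemma crossed_edge_zero:
  assumes k: "k < N"
    and cr: "(al \<bullet> \<gamma> k (lo k) + bl) * (al \<bullet> \<gamma> k (hi k) + bl) < 0"
  obtains t where "lo k < t" "t < hi k" "al \<bullet> \<gamma> k t + bl = 0"
proof -
  obtain u v where uv: "\<And>t. al \<bullet> \<gamma> k t + bl = u + v * t" using affine_gamma[OF k] by blast
  have lh: "lo k < hi k" using lo_hi(1)[OF k] .
  have c: "(u + v * lo k) * (u + v * hi k) < 0" using cr unfolding uv .
  have v: "v \<noteq> 0"
  proof
    assume "v = 0"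
    then show False using c zero_le_square[of u] by simp
  qed
  define t where "t = - u / v"
  have uvt: "u + v * s = v * (s - t)" for s using v by (simp add: t_def field_simps)
  have "v^2 * ((lo k - t) * (hi k - t)) < 0" using c unfolding uvt by (simp add: power2_eq_square mult_ac)
  then have "(lo k - t) * (hi k - t) < 0" using v by (simp add: mult_less_0_iff)
  then have "lo k < t" "t < hi k" using lh by (auto simp: mult_less_0_iff)
  then show thesis using that[of t] v unfolding uv by (simp add: t_def)
qed

end

context stable
begin

text \<open>Rational coefficients are dense, and \<open>L\<close> is continuous in the
  coefficients.\<close>

lemma L_hinge_fun_nonneg: "L (hinge_fun al bl) \<ge> 0"
proof -
  obtain q1 where q1: "(\<lambda>n. of_rat (q1 n)) \<longlonglongrightarrow> al $ 1" by (rule rational_sequence)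
  obtain q2 where q2: "(\<lambda>n. of_rat (q2 n)) \<longlonglongrightarrow> al $ 2" by (rule rational_sequence)
  obtain q3 where q3: "(\<lambda>n. of_rat (q3 n)) \<longlonglongrightarrow> bl" by (rule rational_sequence)
  have "(\<lambda>n. vector [of_rat (q1 n), of_rat (q2 n)] :: real^2) \<longlonglongrightarrow> al"
  proof (rule vec_tendstoI)
    fix i :: 2
    show "(\<lambda>n. (vector [of_rat (q1 n), of_rat (q2 n)] :: real^2) $ i) \<longlonglongrightarrow> al $ i"
      using exhaust_2[of i] q1 q2 by auto
  qed
  from tendsto_L_hinge_fun[OF this q3] show ?thesis
    by (rule LIMSEQ_le_const) (intro exI allI impI L_hinge_fun_rational_nonneg, auto simp: rat_vec_def forall_2)
qed

lemma L_hinge_fun_uminus: "L (hinge_fun (- al) (- bl)) = L (hinge_fun al bl)"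
proof -
  have "hinge_fun al bl = (\<lambda>x. (al \<bullet> x + bl) + hinge_fun (- al) (- bl) x)"
    by (auto simp: hinge_fun_def max_def)
  then have "L (hinge_fun al bl) = L (\<lambda>x. (al \<bullet> x + bl) + hinge_fun (- al) (- bl) x)" by (rule arg_cong)
  also have "\<dots> = L (\<lambda>x. al \<bullet> x + bl) + L (hinge_fun (- al) (- bl))"
    by (rule L_add) (intro continuous_intros continuous_hinge_fun)+
  finally show ?thesis by (simp only: L_affine)
qed

text \<open>Up to a nonnegative factor \<open>L\<close> sees only the crease: reversing the sign of
  the affine function changes the hinge by an affine linear function, on which \<open>L\<close>
  vanishes.\<close>

lemma L_hinge_fun_scale: "L (hinge_fun (m *\<^sub>R al) (m * bl)) = \<bar>m\<bar> * L (hinge_fun al bl)"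
proof -
  have pos: "L (hinge_fun (r *\<^sub>R al) (r * bl)) = r * L (hinge_fun al bl)" if "r \<ge> 0" for r and al :: "real^2" and bl
  proof -
    have "hinge_fun (r *\<^sub>R al) (r * bl) = (\<lambda>x. r * hinge_fun al bl x)"
      using that by (auto simp: hinge_fun_def max_mult_distrib_left distrib_left)
    then show ?thesis by (simp add: L_cmult)
  qed
  show ?thesis
  proof (cases "m \<ge> 0")
    case True then show ?thesis by (simp add: pos)
  next
    case False
    have "L (hinge_fun (m *\<^sub>R al) (m * bl)) = L (hinge_fun (- (m *\<^sub>R al)) (- (m * bl)))" by (rule L_hinge_fun_uminus[symmetric])
    also have "\<dots> = L (hinge_fun ((- m) *\<^sub>R al) ((- m) * bl))" by simp
    also have "\<dots> = (- m) * L (hinge_fun al bl)" using False by (intro pos) simp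
    finally show ?thesis using False by simp
  qed
qed

end

section \<open>Polynomial dependence of the edge integrals on the crease\<close>

definition ratpoly_fun :: "nat \<Rightarrow> (real \<Rightarrow> real) \<Rightarrow> bool" where
  "ratpoly_fun d F \<longleftrightarrow> (\<exists>p. degree p \<le> d \<and> (\<forall>x. F x = ratpoly_eval x p))"

lemma ratpoly_fun_const: assumes "r \<in> \<rat>" shows "ratpoly_fun d (\<lambda>x. r)"
proof -
  obtain q where "r = of_rat q" using assms by (auto elim: Rats_cases)
  then show ?thesis unfolding ratpoly_fun_def by (intro exI[of _ "[:q:]"]) simp
qed

lemma ratpoly_fun_affine: assumes "u \<in> \<rat>" "v \<in> \<rat>" shows "ratpoly_fun 1 (\<lambda>x. u + v * x)"
proof -
  obtain p q where "u = of_rat p" "v = of_rat q" using assms by (auto elim!: Rats_cases)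
  then show ?thesis unfolding ratpoly_fun_def by (intro exI[of _ "[:p, q:]"]) (simp add: mult.commute)
qed

lemma ratpoly_fun_add: "ratpoly_fun d F \<Longrightarrow> ratpoly_fun d G \<Longrightarrow> ratpoly_fun d (\<lambda>x. F x + G x)"
  unfolding ratpoly_fun_def by (metis degree_add_le ratpoly_eval_add)

lemma ratpoly_fun_mult:
  assumes "ratpoly_fun d F" "ratpoly_fun e G" shows "ratpoly_fun (d + e) (\<lambda>x. F x * G x)"
proof -
  obtain p q where "degree p \<le> d" "degree q \<le> e" "\<forall>x. F x = ratpoly_eval x p" "\<forall>x. G x = ratpoly_eval x q"
    using assms unfolding ratpoly_fun_def by blast
  then show ?thesis unfolding ratpoly_fun_def
    by (intro exI[of _ "p * q"]) (auto intro: order.trans[OF degree_mult_le])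
qed

lemma ratpoly_fun_mono: "ratpoly_fun d F \<Longrightarrow> d \<le> e \<Longrightarrow> ratpoly_fun e F"
  unfolding ratpoly_fun_def using order_trans by blast

lemma ratpoly_fun_sum:
  "finite I \<Longrightarrow> (\<And>i. i \<in> I \<Longrightarrow> ratpoly_fun d (F i)) \<Longrightarrow> ratpoly_fun d (\<lambda>x. \<Sum>i\<in>I. F i x)"
  by (induction I rule: finite_induct) (auto intro: ratpoly_fun_const ratpoly_fun_add)

definition rat_affine2 :: "(real \<Rightarrow> real \<Rightarrow> real) \<Rightarrow> bool" where
  "rat_affine2 f \<longleftrightarrow> (\<exists>u v w::rat. \<forall>x y. f x y = of_rat u + of_rat v * x + of_rat w * y)"

text \<open>The polynomials of \<open>rational_zero_cubic\<close>: total degree at most 3 without the monomial \<open>y\<^sup>3\<close>.\<close>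

definition rat_cubic :: "(real \<Rightarrow> real \<Rightarrow> real) \<Rightarrow> bool" where
  "rat_cubic g \<longleftrightarrow> (\<exists>a0 a1 b0 b1 b2 c0 c1 c2 c3 :: rat. \<forall>x y. g x y =
      (of_rat a0 + of_rat a1 * x) * y^2
      + (of_rat b0 + of_rat b1 * x + of_rat b2 * x^2) * y
      + (of_rat c0 + of_rat c1 * x + of_rat c2 * x^2 + of_rat c3 * x^3))"

lemma rat_affine2I:
  assumes "u \<in> \<rat>" "v \<in> \<rat>" "w \<in> \<rat>" "\<And>x y. f x y = u + v * x + w * y" shows "rat_affine2 f"
  using assms unfolding rat_affine2_def by (metis Rats_cases)

lemma rat_cubic_zero: "rat_cubic (\<lambda>x y. 0)"
  unfolding rat_cubic_def by (intro exI[of _ 0]) simp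

lemma rat_cubic_add:
  assumes "rat_cubic f" "rat_cubic g" shows "rat_cubic (\<lambda>x y. f x y + g x y)"
proof -
  obtain a0 a1 b0 b1 b2 c0 c1 c2 c3 where f: "\<And>x y. f x y =
      (of_rat a0 + of_rat a1 * x) * y^2 + (of_rat b0 + of_rat b1 * x + of_rat b2 * x^2) * y
      + (of_rat c0 + of_rat c1 * x + of_rat c2 * x^2 + of_rat c3 * x^3)"
    using assms(1) unfolding rat_cubic_def by auto
  obtain a0' a1' b0' b1' b2' c0' c1' c2' c3' where g: "\<And>x y. g x y =
      (of_rat a0' + of_rat a1' * x) * y^2 + (of_rat b0' + of_rat b1' * x + of_rat b2' * x^2) * y
      + (of_rat c0' + of_rat c1' * x + of_rat c2' * x^2 + of_rat c3' * x^3)"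
    using assms(2) unfolding rat_cubic_def by auto
  show ?thesis unfolding rat_cubic_def f g
    by (rule exI[of _ "a0 + a0'"], rule exI[of _ "a1 + a1'"], rule exI[of _ "b0 + b0'"], rule exI[of _ "b1 + b1'"],
        rule exI[of _ "b2 + b2'"], rule exI[of _ "c0 + c0'"], rule exI[of _ "c1 + c1'"], rule exI[of _ "c2 + c2'"],
        rule exI[of _ "c3 + c3'"]) (simp add: of_rat_add algebra_simps)
qed

lemma rat_cubic_sum:
  "finite I \<Longrightarrow> (\<And>i. i \<in> I \<Longrightarrow> rat_cubic (F i)) \<Longrightarrow> rat_cubic (\<lambda>x y. \<Sum>i\<in>I. F i x y)"
  by (induction I rule: finite_induct) (auto intro: rat_cubic_zero rat_cubic_add)

text \<open>The factor \<open>f\<close> depends on \<open>x\<close> alone, which is what excludes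
  the monomial \<open>y\<^sup>3\<close>.\<close>

lemma rat_cubic_prod:
  assumes "u \<in> \<rat>" "v \<in> \<rat>" and f: "\<And>x. f x = u + v * x" and gk: "rat_affine2 g" "rat_affine2 k"
  shows "rat_cubic (\<lambda>x y. f x * g x y * k x y)"
proof -
  obtain r s where uv: "u = of_rat r" "v = of_rat s" using assms(1,2) by (auto elim!: Rats_cases)
  obtain u1 v1 w1 where g: "\<And>x y. g x y = of_rat u1 + of_rat v1 * x + of_rat w1 * y"
    using gk(1) unfolding rat_affine2_def by auto
  obtain u2 v2 w2 where k: "\<And>x y. k x y = of_rat u2 + of_rat v2 * x + of_rat w2 * y"
    using gk(2) unfolding rat_affine2_def by auto
  show ?thesis unfolding rat_cubic_def f g k uv
    by (rule exI[of _ "r * w1 * w2"], rule exI[of _ "s * w1 * w2"],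
        rule exI[of _ "r * (u1 * w2 + u2 * w1)"],
        rule exI[of _ "r * (v1 * w2 + v2 * w1) + s * (u1 * w2 + u2 * w1)"],
        rule exI[of _ "s * (v1 * w2 + v2 * w1)"],
        rule exI[of _ "r * u1 * u2"], rule exI[of _ "s * u1 * u2 + r * (u1 * v2 + v1 * u2)"],
        rule exI[of _ "r * v1 * v2 + s * (u1 * v2 + v1 * u2)"], rule exI[of _ "s * v1 * v2"])
      (simp add: of_rat_add of_rat_mult algebra_simps power2_eq_square power3_eq_cube)
qed

lemma rat_cubic_rational_zero:
  assumes "rat_cubic g" "e > 0" "g x0 y0 = 0"
    "\<And>x y. \<bar>x - x0\<bar> < e \<Longrightarrow> \<bar>y - y0\<bar> < e \<Longrightarrow> g x y \<ge> 0"
  obtains x y :: rat where "\<bar>of_rat x - x0\<bar> < e" "\<bar>of_rat y - y0\<bar> < e" "g (of_rat x) (of_rat y) = 0"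
proof -
  obtain a0 a1 b0 b1 b2 c0 c1 c2 c3 where g: "\<And>x y. g x y =
      (of_rat a0 + of_rat a1 * x) * y^2 + (of_rat b0 + of_rat b1 * x + of_rat b2 * x^2) * y
      + (of_rat c0 + of_rat c1 * x + of_rat c2 * x^2 + of_rat c3 * x^3)"
    using assms(1) unfolding rat_cubic_def by auto
  show thesis
    using rational_zero_cubic[OF assms(2) assms(3)[unfolded g] assms(4)[unfolded g]] that unfolding g by blast
qed

text \<open>The second hypothesis covers the value at a vertex through which a whole family of
  creases passes: it is zero for all parameters.\<close>

lemma eventually_sgn_eq:
  fixes f :: "'a::t2_space \<Rightarrow> real"
  assumes "continuous_on UNIV f" "f x0 = 0 \<Longrightarrow> (\<And>x. f x = 0)"
  shows "\<forall>\<^sub>F x in nhds x0. sgn (f x) = sgn (f x0)"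
proof -
  have lim: "(f \<longlongrightarrow> f x0) (nhds x0)"
    using assms(1) continuous_on_eq_continuous_at[OF open_UNIV, of f] tendsto_at_iff_tendsto_nhds[of f x0]
    by (simp add: isCont_def)
  consider "f x0 = 0" | "f x0 > 0" | "f x0 < 0" by linarith
  then show ?thesis
  proof cases
    case 1 then show ?thesis using assms(2) by simp
  next
    case 2 then show ?thesis using order_tendstoD(1)[OF lim 2] by (auto elim: eventually_mono)
  next
    case 3 then show ?thesis using order_tendstoD(2)[OF lim 3] by (auto elim: eventually_mono)
  qed
qed

lemma crossing_scale: "m \<noteq> 0 \<Longrightarrow> crossing S al bl \<Longrightarrow> crossing S (m *\<^sub>R al) (m * bl)"
proof -
  assume m: "m \<noteq> 0" and "crossing S al bl"
  then obtain v w where vw: "v \<in> S" "w \<in> S" "al \<bullet> v + bl < 0" "0 < al \<bullet> w + bl" unfolding crossing_def by blast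
  have e: "(m *\<^sub>R al) \<bullet> x + m * bl = m * (al \<bullet> x + bl)" for x by (simp add: distrib_left)
  show ?thesis
  proof (cases "m > 0")
    case True
    then have "m * (al \<bullet> v + bl) < 0" "0 < m * (al \<bullet> w + bl)" using vw by (simp_all add: mult_less_0_iff zero_less_mult_iff)
    then show ?thesis unfolding crossing_def e using vw by blast
  next
    case False
    then have "m * (al \<bullet> w + bl) < 0" "0 < m * (al \<bullet> v + bl)" using vw m by (simp_all add: mult_less_0_iff zero_less_mult_iff)
    then show ?thesis unfolding crossing_def e using vw by blast
  qed
qed

context moment
begin

definition lo_val :: "real^2 \<Rightarrow> real \<Rightarrow> nat \<Rightarrow> real" where "lo_val al bl k = al \<bullet> \<gamma> k (lo k) + bl"
definition hi_val :: "real^2 \<Rightarrow> real \<Rightarrow> nat \<Rightarrow> real" where "hi_val al bl k = al \<bullet> \<gamma> k (hi k) + bl"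
text \<open>The covector that reads off the parameter of a point on edge \<open>k\<close>, as
  \<open>xi_gamma\<close> states.\<close>

definition \<xi> :: "nat \<Rightarrow> real^2" where "\<xi> k = (1 / (h k \<bullet> h k)) *\<^sub>R rot90 (h k)"

lemma xi_gamma: "k < N \<Longrightarrow> \<xi> k \<bullet> \<gamma> k s = s"
  using gamma_inner_rot90[of k s] h_pos[of k] by (simp add: \<xi>_def)

lemma rat_vec_xi: "k < N \<Longrightarrow> rat_vec (\<xi> k)"
  unfolding \<xi>_def by (intro rat_vec_scaleR rat_vec_rot90 rat_vec_h Rats_divide rat_vec_inner) auto

lemma J_same_sign:
  assumes k: "k < N" and s: "sgn (lo_val al bl k) = sgn p" "sgn (hi_val al bl k) = sgn q" and pq: "\<not> p * q < 0"
  shows "J k (hinge_fun al bl) = (if p > 0 \<or> q > 0 then hi k - lo k else 0) * (lo_val al bl k + hi_val al bl k) / 2"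
proof -
  have pos: "lo_val al bl k > 0 \<longleftrightarrow> p > 0" "hi_val al bl k > 0 \<longleftrightarrow> q > 0"
    "lo_val al bl k < 0 \<longleftrightarrow> p < 0" "hi_val al bl k < 0 \<longleftrightarrow> q < 0"
    using s by (metis sgn_greater sgn_less)+
  have "\<not> (p < 0 \<and> 0 < q)" "\<not> (q < 0 \<and> 0 < p)" using pq by (auto simp: mult_less_0_iff)
  then show ?thesis
    using J_hinge_fun_uncrossed[OF k, of al bl] pos unfolding lo_val_def[symmetric] hi_val_def[symmetric] by auto
qed

text \<open>On a crossed edge the integral has the slope \<open>D\<close> in its denominator;
  multiplication by \<open>2 * D\<close> leaves the square of a vertex value. On an edge crossed
  downwards \<open>D\<close> is negative, whence the minus sign in \<open>J_down\<close>.\<close>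

lemma J_up:
  assumes k: "k < N" and "lo_val al bl k < 0" "0 < hi_val al bl k"
    and d: "hi_val al bl k - lo_val al bl k = (hi k - lo k) * D"
  shows "2 * D * J k (hinge_fun al bl) = (hi_val al bl k)^2"
proof -
  have "J k (hinge_fun al bl) = (hi k - lo k) * (hi_val al bl k)^2 / (2 * ((hi k - lo k) * D))"
    using J_hinge_fun_up[OF k, of al bl] assms(2,3) unfolding d[symmetric] lo_val_def hi_val_def by simp
  moreover have "(hi k - lo k) * D \<noteq> 0" using assms unfolding d[symmetric] by simp
  moreover have "2 * D * (r * t / (2 * (r * D))) = t" "2 * D * (r * t / (2 * (- (r * D)))) = - t" if "r * D \<noteq> 0" for r t :: real
    using that by simp_all
  ultimately show ?thesis by metis
qed

lemma J_down:
  assumes k: "k < N" and "hi_val al bl k < 0" "0 < lo_val al bl k"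
    and d: "hi_val al bl k - lo_val al bl k = (hi k - lo k) * D"
  shows "2 * D * J k (hinge_fun al bl) = - ((lo_val al bl k)^2)"
proof -
  have "J k (hinge_fun al bl) = (hi k - lo k) * (lo_val al bl k)^2 / (2 * (- ((hi k - lo k) * D)))"
    using J_hinge_fun_down[OF k, of al bl] assms(2,3) unfolding d[symmetric] lo_val_def hi_val_def by simp
  moreover have "(hi k - lo k) * D \<noteq> 0" using assms unfolding d[symmetric] by simp
  moreover have "2 * D * (r * t / (2 * (r * D))) = t" "2 * D * (r * t / (2 * (- (r * D)))) = - t" if "r * D \<noteq> 0" for r t :: real
    using that by simp_all
  ultimately show ?thesis by metis
qed

lemma hi_val_lo_val_diff: "hi_val al bl k - lo_val al bl k = (hi k - lo k) * (al \<bullet> rot90 (h k))"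
  using inner_gamma_diff[of al k "hi k" "lo k"] by (simp add: hi_val_def lo_val_def)

text \<open>The equation of the crease is rescaled to have speed 1 in the parameter of edge
  \<open>i\<close>; the free data are then the endpoint \<open>s\<close> and the component
  \<open>\<kappa>\<close> along \<open>h i\<close>.\<close>

lemma chart:
  assumes i: "i < N" "lo i < s" "s < hi i" and cr: "crossing P al bl" and zero: "al \<bullet> \<gamma> i s + bl = 0"
  obtains m \<kappa> where "m \<noteq> 0" "m *\<^sub>R al = \<xi> i + \<kappa> *\<^sub>R h i" "m * bl = - (s + \<kappa> * c i)"
proof -
  define d where "d = al \<bullet> rot90 (h i)"
  have "d \<noteq> 0"
  proof
    assume "d = 0"
    then have "al \<bullet> \<gamma> i t + bl = 0" for t using inner_gamma_diff[of al i t s] zero by (simp add: d_def)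
    moreover have "\<gamma> i (lo i) \<in> E i" "\<gamma> i (hi i) \<in> E i" "\<gamma> i (lo i) \<noteq> \<gamma> i (hi i)"
      using gamma_in_E[OF i(1)] gamma_inj[OF i(1)] lo_hi(1)[OF i(1)] by auto
    ultimately show False using no_flat_zero[OF cr i(1)] by blast
  qed
  define \<kappa> where "\<kappa> = (h i \<bullet> ((1/d) *\<^sub>R al)) / (h i \<bullet> h i)"
  have o: "rot90 (h i) \<bullet> ((1/d) *\<^sub>R al) = 1" using \<open>d \<noteq> 0\<close> by (simp add: d_def inner_commute)
  have e: "(1/d) *\<^sub>R al = \<xi> i + \<kappa> *\<^sub>R h i"
    using rot90_decomposition[OF h_nonzero[OF i(1)], of "(1/d) *\<^sub>R al"]
    unfolding o \<kappa>_def[symmetric] \<xi>_def[symmetric] by (subst add.commute)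
  have bl: "bl = - (al \<bullet> \<gamma> i s)" using zero by linarith
  have "(1/d) * bl = - (((1/d) *\<^sub>R al) \<bullet> \<gamma> i s)" by (simp add: bl)
  also have "\<dots> = - (s + \<kappa> * c i)" unfolding e using xi_gamma[OF i(1)] inner_gamma[OF i(1)] by (simp add: inner_add_left)
  finally show thesis using that[of "1/d" \<kappa>] e \<open>d \<noteq> 0\<close> by simp
qed

end

context stable
begin

text \<open>A line through two rational points has a rational equation, up to a factor.\<close>

lemma L_hinge_fun_pos_rational_zeros:
  assumes cr: "crossing P al bl" and x: "rat_vec x" "rat_vec z" "x \<noteq> z"
    and zero: "al \<bullet> x + bl = 0" "al \<bullet> z + bl = 0"
  shows "L (hinge_fun al bl) > 0"
proof -
  define e where "e = z - x"
  have e0: "e \<noteq> 0" using x by (simp add: e_def)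
  have "al \<bullet> z - al \<bullet> x = 0" using zero by linarith
  then have "e \<bullet> al = 0" by (simp add: e_def inner_diff_right inner_commute[of _ al])
  define m where "m = (rot90 e \<bullet> al) / (e \<bullet> e)"
  have al: "al = m *\<^sub>R rot90 e" using rot90_decomposition[OF e0, of al] \<open>e \<bullet> al = 0\<close> by (simp add: m_def)
  have bl: "bl = m * (- (rot90 e \<bullet> x))" using zero by (simp add: al)
  have rat: "rat_vec (rot90 e)" "- (rot90 e \<bullet> x) \<in> \<rat>"
    by (auto simp: e_def intro!: rat_vec_rot90 rat_vec_diff rat_vec_inner x)
  have m0: "m \<noteq> 0" using cr unfolding crossing_def al bl by auto
  have "crossing P ((1/m) *\<^sub>R al) ((1/m) * bl)" by (rule crossing_scale[OF _ cr]) (use m0 in simp)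
  then have "crossing P (rot90 e) (- (rot90 e \<bullet> x))" using m0 by (simp add: al bl)
  then have "L (hinge_fun (rot90 e) (- (rot90 e \<bullet> x))) > 0"
    using L_hinge_fun_rational_pos[OF rat] unfolding crossing_def by blast
  then show ?thesis unfolding al bl L_hinge_fun_scale using m0 by simp
qed

text \<open>The creases through the vertex \<open>v\<close> form a family in the single parameter
  \<open>\<kappa>\<close>. With apex \<open>v\<close> the weights are constant, and only edge
  \<open>i\<close> is crossed, with slope 1, so no denominator arises: near
  \<open>\<kappa>0\<close>, \<open>L\<close> is a rational polynomial of degree at most 2. If it is
  zero at \<open>\<kappa>0\<close>, then it has a rational zero nearby, which contradicts strict
  positivity on rational hinges.\<close>

lemma L_hinge_fun_pos_one_vertex:
  assumes cr: "crossing P al bl" and i: "i < N" "lo i < s0" "s0 < hi i" "al \<bullet> \<gamma> i s0 + bl = 0"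
    and v: "v \<in> P" "rat_vec v" "al \<bullet> v + bl = 0"
    and lz: "\<And>k. k < N \<Longrightarrow> lo_val al bl k = 0 \<Longrightarrow> \<gamma> k (lo k) = v"
    and hz: "\<And>k. k < N \<Longrightarrow> hi_val al bl k = 0 \<Longrightarrow> \<gamma> k (hi k) = v"
    and unc: "\<And>k. k < N \<Longrightarrow> lo_val al bl k * hi_val al bl k < 0 \<Longrightarrow> k = i"
  shows "L (hinge_fun al bl) > 0"
proof (rule ccontr)
  assume "\<not> ?thesis"
  then have L0: "L (hinge_fun al bl) = 0" using L_hinge_fun_nonneg[of al bl] by linarith
  obtain m \<kappa>0 where m: "m \<noteq> 0" "m *\<^sub>R al = \<xi> i + \<kappa>0 *\<^sub>R h i" "m * bl = - (s0 + \<kappa>0 * c i)"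
    using chart[OF i(1-3) cr i(4)] .
  define al' where "al' = (\<lambda>\<kappa>. \<xi> i + \<kappa> *\<^sub>R h i)"
  define bl' where "bl' = (\<lambda>\<kappa>. - (al' \<kappa> \<bullet> v))"
  have mval: "(m *\<^sub>R al) \<bullet> x + m * bl = m * (al \<bullet> x + bl)" for x by (simp add: distrib_left)
  have "m * bl = - ((m *\<^sub>R al) \<bullet> v)" using mval[of v] v(3) by simp
  then have al0: "al' \<kappa>0 = m *\<^sub>R al" "bl' \<kappa>0 = m * bl" by (simp_all add: al'_def bl'_def m)
  have L0': "L (hinge_fun (al' \<kappa>0) (bl' \<kappa>0)) = 0" unfolding al0 L_hinge_fun_scale L0 by simp
  define A where "A = (\<lambda>k \<kappa>. lo_val (al' \<kappa>) (bl' \<kappa>) k)"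
  define Bv where "Bv = (\<lambda>k \<kappa>. hi_val (al' \<kappa>) (bl' \<kappa>) k)"
  have A: "A k \<kappa> = \<xi> i \<bullet> (\<gamma> k (lo k) - v) + (h i \<bullet> (\<gamma> k (lo k) - v)) * \<kappa>" for k \<kappa>
    by (simp add: A_def lo_val_def al'_def bl'_def algebra_simps)
  have Bv: "Bv k \<kappa> = \<xi> i \<bullet> (\<gamma> k (hi k) - v) + (h i \<bullet> (\<gamma> k (hi k) - v)) * \<kappa>" for k \<kappa>
    by (simp add: Bv_def hi_val_def al'_def bl'_def algebra_simps)
  have A0: "A k \<kappa>0 = m * lo_val al bl k" "Bv k \<kappa>0 = m * hi_val al bl k" for k
    unfolding A_def Bv_def al0 lo_val_def hi_val_def by (rule mval)+
  \<comment> \<open>An edge end with value 0 is \<open>v\<close>, where the whole family vanishes;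
    all other end values keep their sign near \<open>\<kappa>0\<close>. So the same formula for each
    edge integral holds in a neighbourhood.\<close>
  have sg: "\<forall>\<^sub>F \<kappa> in nhds \<kappa>0. sgn (A k \<kappa>) = sgn (A k \<kappa>0) \<and> sgn (Bv k \<kappa>) = sgn (Bv k \<kappa>0)" if k: "k < N" for k
  proof (intro eventually_conj eventually_sgn_eq)
    show "continuous_on UNIV (A k)" "continuous_on UNIV (Bv k)"
      unfolding A Bv by (intro continuous_intros)+
    show "A k x = 0" if "A k \<kappa>0 = 0" for x
    proof -
      have "lo_val al bl k = 0" using that m(1) unfolding A0 by simp
      then show ?thesis unfolding A lz[OF k \<open>lo_val al bl k = 0\<close>] by simp
    qed
    show "Bv k x = 0" if "Bv k \<kappa>0 = 0" for x
    proof -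
      have "hi_val al bl k = 0" using that m(1) unfolding A0 by simp
      then show ?thesis unfolding Bv hz[OF k \<open>hi_val al bl k = 0\<close>] by simp
    qed
  qed
  have "\<forall>\<^sub>F \<kappa> in nhds \<kappa>0. \<forall>k\<in>{..<N}. sgn (A k \<kappa>) = sgn (A k \<kappa>0) \<and> sgn (Bv k \<kappa>) = sgn (Bv k \<kappa>0)"
    by (rule eventually_ball_finite) (use sg in auto)
  then obtain e where e: "e > 0"
    "\<And>\<kappa> k. \<bar>\<kappa> - \<kappa>0\<bar> < e \<Longrightarrow> k < N \<Longrightarrow> sgn (A k \<kappa>) = sgn (A k \<kappa>0) \<and> sgn (Bv k \<kappa>) = sgn (Bv k \<kappa>0)"
    unfolding eventually_nhds_metric dist_real_def by blast
  have Ai: "A i \<kappa>0 = lo i - s0" "Bv i \<kappa>0 = hi i - s0"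
    unfolding A_def Bv_def lo_val_def hi_val_def al0 m
    using xi_gamma[OF i(1)] inner_gamma[OF i(1)] by (simp_all add: inner_add_left)
  have up: "A i \<kappa> < 0 \<and> 0 < Bv i \<kappa>" if "\<bar>\<kappa> - \<kappa>0\<bar> < e" for \<kappa>
    using e(2)[OF that i(1)] i(2,3) unfolding Ai by (metis diff_gt_0_iff_gt diff_less_0_iff_less sgn_greater sgn_less)
  have tau: "al' \<kappa> \<bullet> rot90 (h i) = 1" for \<kappa>
    using h_pos[OF i(1)] by (simp add: al'_def \<xi>_def inner_add_left inner_rot90 rot90_inner_rot90)
  define W where "W = (\<lambda>k. 1 - a / 3 * (h k \<bullet> v - c k))"
  define G where "G = (\<lambda>k \<kappa>. if k = i then (1/2) * (Bv i \<kappa> * Bv i \<kappa>)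
     else ((if A k \<kappa>0 > 0 \<or> Bv k \<kappa>0 > 0 then hi k - lo k else 0) / 2) * (A k \<kappa> + Bv k \<kappa>))"
  have LG: "L (hinge_fun (al' \<kappa>) (bl' \<kappa>)) = (\<Sum>k<N. W k * G k \<kappa>)" if \<kappa>: "\<bar>\<kappa> - \<kappa>0\<bar> < e" for \<kappa>
  proof -
    have "J k (hinge_fun (al' \<kappa>) (bl' \<kappa>)) = G k \<kappa>" if k: "k < N" for k
    proof (cases "k = i")
      case True
      have "2 * 1 * J i (hinge_fun (al' \<kappa>) (bl' \<kappa>)) = (Bv i \<kappa>)^2"
        unfolding Bv_def using up[OF \<kappa>] i(1) hi_val_lo_val_diff[of "al' \<kappa>" "bl' \<kappa>" i] tau[of \<kappa>]
        by (intro J_up) (auto simp: A_def Bv_def)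
      then show ?thesis using True by (simp add: G_def power2_eq_square)
    next
      case False
      have "\<not> A k \<kappa>0 * Bv k \<kappa>0 < 0"
      proof
        assume "A k \<kappa>0 * Bv k \<kappa>0 < 0"
        then have "m^2 * (lo_val al bl k * hi_val al bl k) < 0" unfolding A0 by (simp add: power2_eq_square mult_ac)
        then have "lo_val al bl k * hi_val al bl k < 0" using m(1) by (simp add: mult_less_0_iff)
        then show False using unc[OF k] False by simp
      qed
      then show ?thesis
        using J_same_sign[OF k, of "al' \<kappa>" "bl' \<kappa>" "A k \<kappa>0" "Bv k \<kappa>0"] e(2)[OF \<kappa> k] False
        unfolding G_def A_def Bv_def by simp
    qed
    then show ?thesis
      using L_hinge_fun[OF v(1), of "al' \<kappa>" "bl' \<kappa>"] by (simp add: W_def bl'_def)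
  qed
  have "ratpoly_fun 2 (\<lambda>\<kappa>. \<Sum>k<N. W k * G k \<kappa>)"
  proof (rule ratpoly_fun_sum)
    fix k assume "k \<in> {..<N}"
    then have k: "k < N" by simp
    have W: "W k \<in> \<rat>" unfolding W_def
      by (intro Rats_diff Rats_mult Rats_divide rat_vec_inner rat_vec_h k v a_rat c_rat) auto
    have rA: "ratpoly_fun 1 (A k)" unfolding A[abs_def]
      by (intro ratpoly_fun_affine rat_vec_inner rat_vec_diff rat_vec_xi rat_vec_h rat_vec_vertex k i v)
    have rB: "ratpoly_fun 1 (Bv j)" if j: "j < N" for j unfolding Bv[abs_def]
      by (intro ratpoly_fun_affine rat_vec_inner rat_vec_diff rat_vec_xi rat_vec_h rat_vec_vertex j i v)
    have "ratpoly_fun 2 (G k)"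
    proof (cases "k = i")
      case True
      have "ratpoly_fun (0 + (1 + 1)) (\<lambda>\<kappa>. (1/2) * (Bv i \<kappa> * Bv i \<kappa>))"
        by (intro ratpoly_fun_mult ratpoly_fun_const rB i) simp
      then show ?thesis using True by (simp add: G_def numeral_2_eq_2)
    next
      case False
      have "ratpoly_fun (0 + 1) (\<lambda>\<kappa>. ((if A k \<kappa>0 > 0 \<or> Bv k \<kappa>0 > 0 then hi k - lo k else 0) / 2) * (A k \<kappa> + Bv k \<kappa>))"
        by (intro ratpoly_fun_mult ratpoly_fun_const ratpoly_fun_add rA rB k) (auto intro!: Rats_divide Rats_diff lo_hi_rat k)
      then have "ratpoly_fun 2 (\<lambda>\<kappa>. ((if A k \<kappa>0 > 0 \<or> Bv k \<kappa>0 > 0 then hi k - lo k else 0) / 2) * (A k \<kappa> + Bv k \<kappa>))"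
        by (rule ratpoly_fun_mono) simp
      then show ?thesis using False by (simp add: G_def)
    qed
    then have "ratpoly_fun (0 + 2) (\<lambda>\<kappa>. W k * G k \<kappa>)" by (intro ratpoly_fun_mult ratpoly_fun_const W)
    then show "ratpoly_fun 2 (\<lambda>\<kappa>. W k * G k \<kappa>)" by (simp only: add_0)
  qed simp
  then obtain p where p: "degree p \<le> 2" "\<And>\<kappa>. (\<Sum>k<N. W k * G k \<kappa>) = ratpoly_eval \<kappa> p"
    unfolding ratpoly_fun_def by blast
  have pL: "ratpoly_eval \<kappa> p = L (hinge_fun (al' \<kappa>) (bl' \<kappa>))" if "\<bar>\<kappa> - \<kappa>0\<bar> < e" for \<kappa>
    using LG[OF that] p(2) by simp
  have "ratpoly_eval \<kappa>0 p = 0" using pL[of \<kappa>0] L0' e(1) by simp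
  moreover have "ratpoly_eval \<kappa> p \<ge> 0" if "\<bar>\<kappa> - \<kappa>0\<bar> < e" for \<kappa> unfolding pL[OF that] by (rule L_hinge_fun_nonneg)
  ultimately obtain q :: rat where q: "\<bar>of_rat q - \<kappa>0\<bar> < e" "ratpoly_eval (of_rat q) p = 0"
    using rational_zero_degree_3[of p \<kappa>0 e] p(1) e(1) by auto
  have "L (hinge_fun (al' (of_rat q)) (bl' (of_rat q))) > 0"
  proof (rule L_hinge_fun_rational_pos)
    show r: "rat_vec (al' (of_rat q))" unfolding al'_def by (intro rat_vec_add rat_vec_scaleR rat_vec_xi rat_vec_h i) simp
    show "bl' (of_rat q) \<in> \<rat>" unfolding bl'_def by (simp add: rat_vec_inner r v)
    show "al' (of_rat q) \<bullet> \<gamma> i (lo i) + bl' (of_rat q) < 0" "0 < al' (of_rat q) \<bullet> \<gamma> i (hi i) + bl' (of_rat q)"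
      using up[OF q(1)] by (simp_all add: A_def Bv_def lo_val_def hi_val_def)
    show "\<gamma> i (lo i) \<in> P" "\<gamma> i (hi i) \<in> P" using lo_hi[OF i(1)] by auto
  qed
  then show False using pL[OF q(1)] q(2) by simp
qed

text \<open>
  The creases near the given one are parametrised by the position \<open>s\<close> of their endpoint on edge
  \<open>i\<close> and by \<open>\<kappa>\<close>, where \<open>l x = (\<xi> i + \<kappa> *\<^sub>R h i) \<bullet> (x - \<gamma> i s)\<close>. The cone
  formula with apex \<open>\<gamma> i s\<close> makes \<open>2 * D \<kappa> * L\<close> a polynomial without the monomial
  \<open>\<kappa>\<^sup>3\<close>, where \<open>D \<kappa>\<close> is the slope of \<open>l\<close> along edge \<open>j\<close>.
\<close>

lemma L_hinge_fun_pos_no_vertex: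
  assumes cr: "crossing P al bl" and i: "i < N" "lo i < s0" "s0 < hi i" "al \<bullet> \<gamma> i s0 + bl = 0"
    and j: "j < N" "lo j < t0" "t0 < hi j" "al \<bullet> \<gamma> j t0 + bl = 0" and ij: "i \<noteq> j"
    and nz: "\<And>k. k < N \<Longrightarrow> lo_val al bl k \<noteq> 0 \<and> hi_val al bl k \<noteq> 0"
    and unc: "\<And>k. k < N \<Longrightarrow> lo_val al bl k * hi_val al bl k < 0 \<Longrightarrow> k = i \<or> k = j"
  shows "L (hinge_fun al bl) > 0"
proof (rule ccontr)
  assume "\<not> ?thesis"
  then have L0: "L (hinge_fun al bl) = 0" using L_hinge_fun_nonneg[of al bl] by linarith
  obtain m \<kappa>0 where m: "m \<noteq> 0" "m *\<^sub>R al = \<xi> i + \<kappa>0 *\<^sub>R h i" "m * bl = - (s0 + \<kappa>0 * c i)"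
    using chart[OF i(1-3) cr i(4)] .
  define al' where "al' = (\<lambda>\<kappa>. \<xi> i + \<kappa> *\<^sub>R h i)"
  define bl' where "bl' = (\<lambda>s \<kappa>. - (s + \<kappa> * c i))"
  have mval: "(m *\<^sub>R al) \<bullet> x + m * bl = m * (al \<bullet> x + bl)" for x by (simp add: distrib_left)
  have al0: "al' \<kappa>0 = m *\<^sub>R al" "bl' s0 \<kappa>0 = m * bl" by (simp_all add: al'_def bl'_def m)
  have L0': "L (hinge_fun (al' \<kappa>0) (bl' s0 \<kappa>0)) = 0" unfolding al0 L_hinge_fun_scale L0 by simp
  define A where "A = (\<lambda>k s \<kappa>. lo_val (al' \<kappa>) (bl' s \<kappa>) k)"
  define Bv where "Bv = (\<lambda>k s \<kappa>. hi_val (al' \<kappa>) (bl' s \<kappa>) k)"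
  define D where "D = (\<lambda>\<kappa>. al' \<kappa> \<bullet> rot90 (h j))"
  have A: "A k s \<kappa> = \<xi> i \<bullet> \<gamma> k (lo k) + (- 1) * s + (h i \<bullet> \<gamma> k (lo k) - c i) * \<kappa>" for k s \<kappa>
    by (simp add: A_def lo_val_def al'_def bl'_def algebra_simps)
  have Bv: "Bv k s \<kappa> = \<xi> i \<bullet> \<gamma> k (hi k) + (- 1) * s + (h i \<bullet> \<gamma> k (hi k) - c i) * \<kappa>" for k s \<kappa>
    by (simp add: Bv_def hi_val_def al'_def bl'_def algebra_simps)
  have D: "D \<kappa> = \<xi> i \<bullet> rot90 (h j) + 0 * s + (h i \<bullet> rot90 (h j)) * \<kappa>" for s \<kappa>
    by (simp add: D_def al'_def algebra_simps)
  have A0: "A k s0 \<kappa>0 = m * lo_val al bl k" "Bv k s0 \<kappa>0 = m * hi_val al bl k" for k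
    unfolding A_def Bv_def al0 lo_val_def hi_val_def by (rule mval)+
  have nz0: "A k s0 \<kappa>0 \<noteq> 0" "Bv k s0 \<kappa>0 \<noteq> 0" if "k < N" for k
    unfolding A0 using nz[OF that] m(1) by simp_all
  have BA: "Bv k s \<kappa> - A k s \<kappa> = (hi k - lo k) * (al' \<kappa> \<bullet> rot90 (h k))" for k s \<kappa>
    unfolding A_def Bv_def by (rule hi_val_lo_val_diff)
  have jend: "A j s0 \<kappa>0 = (lo j - t0) * D \<kappa>0" "Bv j s0 \<kappa>0 = (hi j - t0) * D \<kappa>0"
  proof -
    have z: "al' \<kappa>0 \<bullet> \<gamma> j t0 + bl' s0 \<kappa>0 = 0" unfolding al0 mval j(4) by simp
    show "A j s0 \<kappa>0 = (lo j - t0) * D \<kappa>0" "Bv j s0 \<kappa>0 = (hi j - t0) * D \<kappa>0"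
      unfolding A_def Bv_def D_def lo_val_def hi_val_def inner_gamma_diff[symmetric] using z by linarith+
  qed
  have Dnz: "D \<kappa>0 \<noteq> 0" using nz0[OF j(1)] jend by auto
  have sg: "\<forall>\<^sub>F p in nhds (s0, \<kappa>0). sgn (A k (fst p) (snd p)) = sgn (A k s0 \<kappa>0) \<and>
      sgn (Bv k (fst p) (snd p)) = sgn (Bv k s0 \<kappa>0) \<and> sgn (D (snd p)) = sgn (D \<kappa>0)" if k: "k < N" for k
  proof -
    have cont: "continuous_on UNIV (\<lambda>p. A k (fst p) (snd p))" "continuous_on UNIV (\<lambda>p. Bv k (fst p) (snd p))"
      "continuous_on UNIV (\<lambda>p :: real \<times> real. D (snd p))"
      unfolding A Bv D[of _ 0] by (intro continuous_intros)+
    show ?thesis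
      using eventually_sgn_eq[OF cont(1), of "(s0, \<kappa>0)"] eventually_sgn_eq[OF cont(2), of "(s0, \<kappa>0)"]
        eventually_sgn_eq[OF cont(3), of "(s0, \<kappa>0)"] nz0[OF k] Dnz
      by (simp add: eventually_conj)
  qed
  have "\<forall>\<^sub>F p in nhds (s0, \<kappa>0). \<forall>k\<in>{..<N}. sgn (A k (fst p) (snd p)) = sgn (A k s0 \<kappa>0) \<and>
      sgn (Bv k (fst p) (snd p)) = sgn (Bv k s0 \<kappa>0) \<and> sgn (D (snd p)) = sgn (D \<kappa>0)"
    by (rule eventually_ball_finite) (use sg in auto)
  then obtain d where d: "d > 0"
    "\<And>p k. dist p (s0, \<kappa>0) < d \<Longrightarrow> k < N \<Longrightarrow> sgn (A k (fst p) (snd p)) = sgn (A k s0 \<kappa>0) \<and>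
      sgn (Bv k (fst p) (snd p)) = sgn (Bv k s0 \<kappa>0) \<and> sgn (D (snd p)) = sgn (D \<kappa>0)"
    unfolding eventually_nhds_metric by (metis lessThan_iff)
  \<comment> \<open>Half the radius, so that the square box fits into the disc on which all signs
    are constant.\<close>
  define e where "e = d / 2"
  have e: "e > 0" using d by (simp add: e_def)
  have sgn_eq: "sgn (A k s \<kappa>) = sgn (A k s0 \<kappa>0)" "sgn (Bv k s \<kappa>) = sgn (Bv k s0 \<kappa>0)" "sgn (D \<kappa>) = sgn (D \<kappa>0)"
    if "\<bar>s - s0\<bar> < e" "\<bar>\<kappa> - \<kappa>0\<bar> < e" "k < N" for s \<kappa> k
  proof -
    have "dist (s, \<kappa>) (s0, \<kappa>0) \<le> \<bar>s - s0\<bar> + \<bar>\<kappa> - \<kappa>0\<bar>"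
      by (simp add: dist_Pair_Pair dist_real_def) (metis power2_abs sqrt_sum_squares_le_sum_abs abs_abs)
    then have "dist (s, \<kappa>) (s0, \<kappa>0) < d" using that(1,2) by (simp add: e_def)
    from d(2)[OF this that(3)]
    show "sgn (A k s \<kappa>) = sgn (A k s0 \<kappa>0)" "sgn (Bv k s \<kappa>) = sgn (Bv k s0 \<kappa>0)" "sgn (D \<kappa>) = sgn (D \<kappa>0)" by simp_all
  qed
  have Ai: "A i s \<kappa> = lo i - s" "Bv i s \<kappa> = hi i - s" for s \<kappa>
    unfolding A Bv using xi_gamma[OF i(1)] inner_gamma[OF i(1)] by simp_all
  have up: "A i s \<kappa> < 0" "0 < Bv i s \<kappa>" "lo i < s" "s < hi i" if "\<bar>s - s0\<bar> < e" "\<bar>\<kappa> - \<kappa>0\<bar> < e" for s \<kappa>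
  proof -
    have "sgn (lo i - s) = sgn (lo i - s0)" "sgn (hi i - s) = sgn (hi i - s0)"
      using sgn_eq(1,2)[OF that i(1)] unfolding Ai by auto
    then have "lo i - s < 0" "hi i - s > 0" using i(2,3) by (metis diff_gt_0_iff_gt diff_less_0_iff_less sgn_greater sgn_less)+
    then show "A i s \<kappa> < 0" "0 < Bv i s \<kappa>" "lo i < s" "s < hi i" unfolding Ai by simp_all
  qed
  have tau: "al' \<kappa> \<bullet> rot90 (h i) = 1" for \<kappa>
    using h_pos[OF i(1)] by (simp add: al'_def \<xi>_def inner_add_left inner_rot90 rot90_inner_rot90)
  define W where "W = (\<lambda>k s. 1 - a / 3 * (h k \<bullet> \<gamma> i s - c k))"
  have W: "W k s = (1 - a / 3 * (h k \<bullet> \<gamma> i 0 - c k)) + (- (a / 3 * (h k \<bullet> rot90 (h i)))) * s" for k s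
    by (simp add: W_def \<gamma>_def algebra_simps)
  \<comment> \<open>The slope \<open>D\<close> may be negative; the factor \<open>\<epsilon>\<close>
    keeps the polynomial nonnegative near the given crease.\<close>
  define \<epsilon> where "\<epsilon> = sgn (D \<kappa>0)"
  have eps: "\<epsilon> = 1 \<or> \<epsilon> = - 1" using Dnz by (auto simp: \<epsilon>_def sgn_if)
  define \<sigma> where "\<sigma> = (\<lambda>k. if A k s0 \<kappa>0 > 0 \<or> Bv k s0 \<kappa>0 > 0 then hi k - lo k else 0)"
  \<comment> \<open>The factor that depends on \<open>s\<close> alone is written first. For edge
    \<open>i\<close>, where the weight is 1, it is one copy of \<open>Bv i\<close>, which equals
    \<open>hi i - s\<close>; for the other edges it contains the weight. In the term of edge
    \<open>j\<close> one \<open>\<epsilon>\<close> is the global sign and the other the direction in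
    which \<open>j\<close> is crossed. The integrals over uncrossed edges are affine and keep the
    factor \<open>D\<close>.\<close>
  define T where "T = (\<lambda>k s \<kappa>. if k = i then (\<epsilon> * (hi i - s)) * D \<kappa> * Bv i s \<kappa>
     else if k = j then (\<epsilon> * \<epsilon> * W j s) * (if \<epsilon> = 1 then Bv j s \<kappa> else A j s \<kappa>) * (if \<epsilon> = 1 then Bv j s \<kappa> else A j s \<kappa>)
     else (\<epsilon> * \<sigma> k * W k s) * (A k s \<kappa> + Bv k s \<kappa>) * D \<kappa>)"
  have TL: "\<epsilon> * (2 * D \<kappa> * L (hinge_fun (al' \<kappa>) (bl' s \<kappa>))) = (\<Sum>k<N. T k s \<kappa>)"
    if near: "\<bar>s - s0\<bar> < e" "\<bar>\<kappa> - \<kappa>0\<bar> < e" for s \<kappa>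
  proof -
    have "\<epsilon> * (2 * D \<kappa> * (W k s * J k (hinge_fun (al' \<kappa>) (bl' s \<kappa>)))) = T k s \<kappa>" if k: "k < N" for k
    proof -
      consider "k = i" | "k = j" "k \<noteq> i" | "k \<noteq> i" "k \<noteq> j" by blast
      then show ?thesis
      proof cases
        case 1
        have "2 * 1 * J i (hinge_fun (al' \<kappa>) (bl' s \<kappa>)) = (Bv i s \<kappa>)^2"
          unfolding Bv_def using up[OF near] i(1) BA[of i s \<kappa>] tau[of \<kappa>]
          by (intro J_up) (auto simp: A_def Bv_def)
        moreover have "W i s = 1" unfolding W_def using inner_gamma[OF i(1)] by simp
        ultimately show ?thesis unfolding 1 T_def by (simp add: power2_eq_square Ai)
      next
        case 2
        have "2 * D \<kappa> * J j (hinge_fun (al' \<kappa>) (bl' s \<kappa>)) = \<epsilon> * (if \<epsilon> = 1 then Bv j s \<kappa> else A j s \<kappa>)^2"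
        proof (cases "\<epsilon> = 1")
          case True
          then have "D \<kappa>0 > 0" by (simp add: \<epsilon>_def sgn_if split: if_splits)
          then have "A j s0 \<kappa>0 < 0" "Bv j s0 \<kappa>0 > 0" using j(2,3) unfolding jend
            by (simp_all add: mult_less_0_iff)
          then have "A j s \<kappa> < 0" "Bv j s \<kappa> > 0"
            using sgn_eq(1,2)[OF near j(1)] by (metis sgn_greater sgn_less)+
          then have "2 * D \<kappa> * J j (hinge_fun (al' \<kappa>) (bl' s \<kappa>)) = (Bv j s \<kappa>)^2"
            unfolding Bv_def using BA[of j s \<kappa>] j(1)
            by (intro J_up) (auto simp: A_def Bv_def D_def)
          then show ?thesis using True by simp
        next
          case False
          then have "D \<kappa>0 < 0" using Dnz by (simp add: \<epsilon>_def sgn_if split: if_splits)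
          then have "A j s0 \<kappa>0 > 0" "Bv j s0 \<kappa>0 < 0" using j(2,3) unfolding jend
            by (simp_all add: mult_less_0_iff zero_less_mult_iff)
          then have "A j s \<kappa> > 0" "Bv j s \<kappa> < 0"
            using sgn_eq(1,2)[OF near j(1)] by (metis sgn_greater sgn_less)+
          then have "2 * D \<kappa> * J j (hinge_fun (al' \<kappa>) (bl' s \<kappa>)) = - ((A j s \<kappa>)^2)"
            unfolding A_def using BA[of j s \<kappa>] j(1)
            by (intro J_down) (auto simp: A_def Bv_def D_def)
          then show ?thesis using False eps by simp
        qed
        then have "\<epsilon> * (W j s * (2 * D \<kappa> * J j (hinge_fun (al' \<kappa>) (bl' s \<kappa>))))
            = \<epsilon> * (W j s * (\<epsilon> * (if \<epsilon> = 1 then Bv j s \<kappa> else A j s \<kappa>)^2))" by (rule arg_cong)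
        then show ?thesis using 2 unfolding T_def by (simp add: power2_eq_square mult_ac)
      next
        case 3
        have "\<not> A k s0 \<kappa>0 * Bv k s0 \<kappa>0 < 0"
        proof
          assume "A k s0 \<kappa>0 * Bv k s0 \<kappa>0 < 0"
          then have "m^2 * (lo_val al bl k * hi_val al bl k) < 0" unfolding A0 by (simp add: power2_eq_square mult_ac)
          then have "lo_val al bl k * hi_val al bl k < 0" using m(1) by (simp add: mult_less_0_iff)
          then show False using unc[OF k] 3 by simp
        qed
        then have "J k (hinge_fun (al' \<kappa>) (bl' s \<kappa>)) = \<sigma> k * (A k s \<kappa> + Bv k s \<kappa>) / 2"
          using J_same_sign[OF k, of "al' \<kappa>" "bl' s \<kappa>" "A k s0 \<kappa>0" "Bv k s0 \<kappa>0"] sgn_eq(1,2)[OF near k]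
          unfolding \<sigma>_def A_def Bv_def by simp
        then show ?thesis using 3 unfolding T_def by simp
      qed
    qed
    note terms = this
    have p: "\<gamma> i s \<in> P" "al' \<kappa> \<bullet> \<gamma> i s + bl' s \<kappa> = 0"
      using up[OF near] lo_hi(2)[OF i(1)] xi_gamma[OF i(1)] inner_gamma[OF i(1)]
      by (simp_all add: al'_def bl'_def inner_add_left)
    have "\<epsilon> * (2 * D \<kappa> * L (hinge_fun (al' \<kappa>) (bl' s \<kappa>))) = (\<Sum>k<N. \<epsilon> * (2 * D \<kappa> * (W k s * J k (hinge_fun (al' \<kappa>) (bl' s \<kappa>)))))"
      unfolding L_hinge_fun[OF p] W_def by (simp add: sum_distrib_left)
    also have "\<dots> = (\<Sum>k<N. T k s \<kappa>)" by (intro sum.cong terms) auto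
    finally show ?thesis .
  qed
  have "rat_cubic (\<lambda>s \<kappa>. \<Sum>k<N. T k s \<kappa>)"
  proof (rule rat_cubic_sum)
    fix k assume "k \<in> {..<N}"
    then have k: "k < N" by simp
    have er: "\<epsilon> \<in> \<rat>" using eps by auto
    have g0: "rat_vec (\<gamma> i 0)" unfolding \<gamma>_def
      by (intro rat_vec_add rat_vec_scaleR rat_vec_h rat_vec_rot90 Rats_divide c_rat rat_vec_inner i) simp
    have Wr: "1 - a / 3 * (h k \<bullet> \<gamma> i 0 - c k) \<in> \<rat>" "- (a / 3 * (h k \<bullet> rot90 (h i))) \<in> \<rat>" if "k < N" for k
      by (auto intro!: Rats_diff Rats_mult Rats_divide rat_vec_inner rat_vec_h rat_vec_rot90 that i a_rat c_rat g0)
    have rA: "rat_affine2 (A k)" if "k < N" for k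
      by (rule rat_affine2I[OF _ _ _ A])
        (auto intro!: Rats_diff rat_vec_inner rat_vec_xi rat_vec_h rat_vec_vertex c_rat that i)
    have rB: "rat_affine2 (Bv k)" if "k < N" for k
      by (rule rat_affine2I[OF _ _ _ Bv])
        (auto intro!: Rats_diff rat_vec_inner rat_vec_xi rat_vec_h rat_vec_vertex c_rat that i)
    have rD: "rat_affine2 (\<lambda>s. D)"
      by (rule rat_affine2I[OF _ _ _ D])
        (auto intro!: rat_vec_inner rat_vec_xi rat_vec_h rat_vec_rot90 i j)
    consider "k = i" | "k = j" "k \<noteq> i" | "k \<noteq> i" "k \<noteq> j" by blast
    then show "rat_cubic (T k)"
    proof cases
      case 1
      have "rat_cubic (\<lambda>s \<kappa>. (\<epsilon> * (hi i - s)) * D \<kappa> * Bv i s \<kappa>)"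
        by (rule rat_cubic_prod[where u = "\<epsilon> * hi i" and v = "- \<epsilon>"])
          (auto simp: algebra_simps er lo_hi_rat i rD rB)
      then show ?thesis using 1 by (simp add: T_def)
    next
      case 2
      have C: "rat_affine2 (\<lambda>s \<kappa>. if \<epsilon> = 1 then Bv j s \<kappa> else A j s \<kappa>)" using rA rB j by (cases "\<epsilon> = 1") simp_all
      have "rat_cubic (\<lambda>s \<kappa>. (\<epsilon> * \<epsilon> * W j s) * (if \<epsilon> = 1 then Bv j s \<kappa> else A j s \<kappa>) * (if \<epsilon> = 1 then Bv j s \<kappa> else A j s \<kappa>))"
      proof (rule rat_cubic_prod[OF _ _ _ C C])
        show "\<epsilon> * \<epsilon> * W j s = \<epsilon> * \<epsilon> * (1 - a / 3 * (h j \<bullet> \<gamma> i 0 - c j)) + (\<epsilon> * \<epsilon> * (- (a / 3 * (h j \<bullet> rot90 (h i))))) * s" for s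
          unfolding W by (simp only: distrib_left mult.assoc)
      qed (intro Rats_mult er Wr j)+
      then show ?thesis using 2 ij by (simp add: T_def)
    next
      case 3
      have C: "rat_affine2 (\<lambda>s \<kappa>. A k s \<kappa> + Bv k s \<kappa>)"
      proof (rule rat_affine2I)
        show "A k s \<kappa> + Bv k s \<kappa> = (\<xi> i \<bullet> \<gamma> k (lo k) + \<xi> i \<bullet> \<gamma> k (hi k)) + (- 2) * s
            + ((h i \<bullet> \<gamma> k (lo k) - c i) + (h i \<bullet> \<gamma> k (hi k) - c i)) * \<kappa>" for s \<kappa>
          unfolding A Bv by (simp add: algebra_simps)
      qed (auto intro!: Rats_add Rats_diff Rats_mult rat_vec_inner rat_vec_xi rat_vec_h rat_vec_vertex c_rat k i)
      have sr: "\<sigma> k \<in> \<rat>" by (simp add: \<sigma>_def lo_hi_rat k)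
      have "rat_cubic (\<lambda>s \<kappa>. (\<epsilon> * \<sigma> k * W k s) * (A k s \<kappa> + Bv k s \<kappa>) * D \<kappa>)"
      proof (rule rat_cubic_prod[OF _ _ _ C rD])
        show "\<epsilon> * \<sigma> k * W k s = \<epsilon> * \<sigma> k * (1 - a / 3 * (h k \<bullet> \<gamma> i 0 - c k)) + (\<epsilon> * \<sigma> k * (- (a / 3 * (h k \<bullet> rot90 (h i))))) * s" for s
          unfolding W by (simp only: distrib_left mult.assoc)
      qed (intro Rats_mult er Wr k sr)+
      then show ?thesis using 3 by (simp add: T_def)
    qed
  qed simp
  moreover have "(\<Sum>k<N. T k s0 \<kappa>0) = 0" using TL[of s0 \<kappa>0] L0' e by simp
  moreover have "(\<Sum>k<N. T k s \<kappa>) \<ge> 0" if near: "\<bar>s - s0\<bar> < e" "\<bar>\<kappa> - \<kappa>0\<bar> < e" for s \<kappa>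
  proof -
    have "\<epsilon> * D \<kappa> = \<bar>D \<kappa>\<bar>" unfolding \<epsilon>_def sgn_eq(3)[OF near i(1), symmetric] by (simp add: abs_sgn mult.commute)
    then have "\<epsilon> * (2 * D \<kappa> * L (hinge_fun (al' \<kappa>) (bl' s \<kappa>))) = 2 * \<bar>D \<kappa>\<bar> * L (hinge_fun (al' \<kappa>) (bl' s \<kappa>))"
      by (metis mult.assoc mult.left_commute)
    moreover have "2 * \<bar>D \<kappa>\<bar> * L (hinge_fun (al' \<kappa>) (bl' s \<kappa>)) \<ge> 0" by (simp add: L_hinge_fun_nonneg)
    ultimately show ?thesis using TL[OF near] by linarith
  qed
  ultimately obtain x y :: rat where xy: "\<bar>of_rat x - s0\<bar> < e" "\<bar>of_rat y - \<kappa>0\<bar> < e" "(\<Sum>k<N. T k (of_rat x) (of_rat y)) = 0"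
    using rat_cubic_rational_zero[OF _ e] by blast
  \<comment> \<open>The factor \<open>2 * D\<close> does not vanish there, so the rational zero of
    the polynomial is a zero of \<open>L\<close>.\<close>
  have "D (of_rat y) \<noteq> 0" using sgn_eq(3)[OF xy(1,2) i(1)] Dnz by (metis sgn_eq_0_iff)
  then have L00: "L (hinge_fun (al' (of_rat y)) (bl' (of_rat x) (of_rat y))) = 0"
    using TL[OF xy(1,2)] xy(3) eps by auto
  have "L (hinge_fun (al' (of_rat y)) (bl' (of_rat x) (of_rat y))) > 0"
  proof (rule L_hinge_fun_rational_pos)
    show "rat_vec (al' (of_rat y))" unfolding al'_def by (intro rat_vec_add rat_vec_scaleR rat_vec_xi rat_vec_h i) simp
    show "bl' (of_rat x) (of_rat y) \<in> \<rat>" unfolding bl'_def by (simp add: c_rat i)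
    show "al' (of_rat y) \<bullet> \<gamma> i (lo i) + bl' (of_rat x) (of_rat y) < 0" "0 < al' (of_rat y) \<bullet> \<gamma> i (hi i) + bl' (of_rat x) (of_rat y)"
      using up[OF xy(1,2)] by (simp_all add: A_def Bv_def lo_val_def hi_val_def)
    show "\<gamma> i (lo i) \<in> P" "\<gamma> i (hi i) \<in> P" using lo_hi[OF i(1)] by auto
  qed
  then show False using L00 by simp
qed

text \<open>Each end of the crease is a vertex, hence rational, or an inner point of an edge. The
  number of inner ends, zero, one or two, is the number of variables of the polynomial to be
  considered.\<close>

theorem L_hinge_fun_pos:
  assumes cr: "crossing P al bl" shows "L (hinge_fun al bl) > 0"
proof -
  obtain x1 x2 k1 k2 where k: "k1 < N" "k2 < N" "x1 \<in> E k1" "x2 \<in> E k2" "x1 \<noteq> x2"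
    and zero: "al \<bullet> x1 + bl = 0" "al \<bullet> x2 + bl = 0"
    and only: "\<And>y k. k < N \<Longrightarrow> y \<in> E k \<Longrightarrow> al \<bullet> y + bl = 0 \<Longrightarrow> y = x1 \<or> y = x2"
    by (rule boundary_zeros[OF cr], rule that; (assumption | fast))
  obtain s1 where s1: "x1 = \<gamma> k1 s1" "lo k1 \<le> s1" "s1 \<le> hi k1" using k(3) unfolding E_eq[OF k(1)] by auto
  obtain s2 where s2: "x2 = \<gamma> k2 s2" "lo k2 \<le> s2" "s2 \<le> hi k2" using k(4) unfolding E_eq[OF k(2)] by auto
  have endE: "\<gamma> m (lo m) \<in> E m" "\<gamma> m (hi m) \<in> E m" if "m < N" for m
    using gamma_in_E[OF that] lo_hi(1)[OF that] by auto
  have inner_not_vertex: "\<not> (lo i < s \<and> s < hi i)" if "i < N" "m < N" "\<gamma> i s = \<gamma> m (lo m) \<or> \<gamma> i s = \<gamma> m (hi m)" for i s m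
  proof -
    have "\<gamma> i s extreme_point_of P" using extreme_point_P[OF that(2)] that(3) by auto
    then have "s = lo i \<or> s = hi i" using extreme_point_P[OF that(1)] by simp
    then show ?thesis by auto
  qed
  have crossed: "(lo k1 < s1 \<and> s1 < hi k1 \<and> m = k1) \<or> (lo k2 < s2 \<and> s2 < hi k2 \<and> m = k2)"
    if m: "m < N" "lo_val al bl m * hi_val al bl m < 0" for m
  proof -
    obtain t where t: "lo m < t" "t < hi m" "al \<bullet> \<gamma> m t + bl = 0"
      using crossed_edge_zero[OF m(1)] m(2) unfolding lo_val_def hi_val_def by blast
    have tE: "\<gamma> m t \<in> E m" using gamma_in_E[OF m(1)] t by simp
    from only[OF m(1) tE t(3)] show ?thesis
    proof
      assume e: "\<gamma> m t = x1"
      then have "k1 = m" using nonvertex_unique[OF m(1) t(1,2) k(1)] k(3) by simp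
      then show ?thesis using e t s1(1) gamma_inj[OF m(1)] by auto
    next
      assume e: "\<gamma> m t = x2"
      then have "k2 = m" using nonvertex_unique[OF m(1) t(1,2) k(2)] k(4) by simp
      then show ?thesis using e t s2(1) gamma_inj[OF m(1)] by auto
    qed
  qed
  have rat1: "rat_vec x1" if "\<not> (lo k1 < s1 \<and> s1 < hi k1)"
    using that s1 rat_vec_vertex[OF k(1)] by (cases "s1 = lo k1") auto
  have rat2: "rat_vec x2" if "\<not> (lo k2 < s2 \<and> s2 < hi k2)"
    using that s2 rat_vec_vertex[OF k(2)] by (cases "s2 = lo k2") auto
  have P12: "x1 \<in> P" "x2 \<in> P" using k E_subset by auto
  consider "\<not> (lo k1 < s1 \<and> s1 < hi k1)" "\<not> (lo k2 < s2 \<and> s2 < hi k2)"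
    | "lo k1 < s1 \<and> s1 < hi k1" "\<not> (lo k2 < s2 \<and> s2 < hi k2)"
    | "\<not> (lo k1 < s1 \<and> s1 < hi k1)" "lo k2 < s2 \<and> s2 < hi k2"
    | "lo k1 < s1 \<and> s1 < hi k1" "lo k2 < s2 \<and> s2 < hi k2" by blast
  then show ?thesis
  proof cases
    case 1
    show ?thesis by (rule L_hinge_fun_pos_rational_zeros[OF cr rat1[OF 1(1)] rat2[OF 1(2)] k(5) zero])
  next
    case 2
    show ?thesis
    proof (rule L_hinge_fun_pos_one_vertex[OF cr k(1) _ _ _ P12(2) rat2[OF 2(2)] zero(2)])
      show "lo k1 < s1" "s1 < hi k1" "al \<bullet> \<gamma> k1 s1 + bl = 0" using 2 zero s1 by auto
      show "\<gamma> m (lo m) = x2" if "m < N" "lo_val al bl m = 0" for m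
        using only[OF that(1) endE(1)[OF that(1)]] that inner_not_vertex[OF k(1) that(1), of s1] 2(1) s1(1)
        unfolding lo_val_def by auto
      show "\<gamma> m (hi m) = x2" if "m < N" "hi_val al bl m = 0" for m
        using only[OF that(1) endE(2)[OF that(1)]] that inner_not_vertex[OF k(1) that(1), of s1] 2(1) s1(1)
        unfolding hi_val_def by auto
      show "m = k1" if "m < N" "lo_val al bl m * hi_val al bl m < 0" for m using crossed[OF that] 2 by blast
    qed
  next
    case 3
    show ?thesis
    proof (rule L_hinge_fun_pos_one_vertex[OF cr k(2) _ _ _ P12(1) rat1[OF 3(1)] zero(1)])
      show "lo k2 < s2" "s2 < hi k2" "al \<bullet> \<gamma> k2 s2 + bl = 0" using 3 zero s2 by auto
      show "\<gamma> m (lo m) = x1" if "m < N" "lo_val al bl m = 0" for m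
        using only[OF that(1) endE(1)[OF that(1)]] that inner_not_vertex[OF k(2) that(1), of s2] 3(2) s2(1)
        unfolding lo_val_def by auto
      show "\<gamma> m (hi m) = x1" if "m < N" "hi_val al bl m = 0" for m
        using only[OF that(1) endE(2)[OF that(1)]] that inner_not_vertex[OF k(2) that(1), of s2] 3(2) s2(1)
        unfolding hi_val_def by auto
      show "m = k2" if "m < N" "lo_val al bl m * hi_val al bl m < 0" for m using crossed[OF that] 3 by blast
    qed
  next
    case 4
    show ?thesis
    proof (rule L_hinge_fun_pos_no_vertex[OF cr k(1) _ _ _ k(2)])
      show "lo k1 < s1" "s1 < hi k1" "al \<bullet> \<gamma> k1 s1 + bl = 0" "lo k2 < s2" "s2 < hi k2" "al \<bullet> \<gamma> k2 s2 + bl = 0"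
        using 4 zero s1 s2 by auto
      show "k1 \<noteq> k2" using no_flat_zero[OF cr k(1) k(3)] k zero by auto
      show "lo_val al bl m \<noteq> 0 \<and> hi_val al bl m \<noteq> 0" if "m < N" for m
        using only[OF that endE(1)[OF that]] only[OF that endE(2)[OF that]]
          inner_not_vertex[OF k(1) that, of s1] inner_not_vertex[OF k(2) that, of s2] 4 s1(1) s2(1)
        unfolding lo_val_def hi_val_def by metis
      show "m = k1 \<or> m = k2" if "m < N" "lo_val al bl m * hi_val al bl m < 0" for m using crossed[OF that] by blast
    qed
  qed
qed

end

section \<open>A uniform bound on hinge functions\<close>

context moment
begin

lemma hinge_fun_scale: "r \<ge> 0 \<Longrightarrow> hinge_fun (r *\<^sub>R al) (r * bl) = (\<lambda>x. r * hinge_fun al bl x)"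
  by (auto simp: hinge_fun_def max_mult_distrib_left distrib_left)

lemma convex_on_hinge_fun: "convex S \<Longrightarrow> convex_on S (hinge_fun al bl)"
proof -
  assume "convex S"
  moreover have "affine_linear (\<lambda>x. al \<bullet> x + bl)" unfolding affine_linear_def by blast
  ultimately show ?thesis unfolding hinge_fun_def[abs_def] by (intro convex_on_hinge)
qed

text \<open>The inequality \<open>y \<le> \<theta> / 2 + y^2 / (2 * \<theta>)\<close> is integrated
  only over the set where the hinge is positive, so that a small support makes the area integral
  small against the boundary integral.\<close>

lemma V_hinge_fun_le:
  assumes "\<theta> > 0"
  shows "V (hinge_fun al bl) \<le> \<theta> / 2 * (LINT x|lborel. indicator P x * indicator {x. al \<bullet> x + bl > 0} x) + CG * (B (hinge_fun al bl))^2 / (2 * \<theta>)"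
proof -
  define S where "S = {x::real^2. al \<bullet> x + bl > 0}"
  have Sm [measurable]: "S \<in> sets borel"
    unfolding S_def by measurable
  have Pm [measurable]: "P \<in> sets borel" using closed_P by simp
  have c2: "continuous_on P (\<lambda>x. (hinge_fun al bl x)^2)" by (intro continuous_intros continuous_hinge_fun)
  have int1: "integrable lborel (\<lambda>x. indicator P x *\<^sub>R hinge_fun al bl x)"
    using set_integrable_P[OF continuous_hinge_fun] by (simp add: set_integrable_def)
  have int2: "integrable lborel (\<lambda>x. indicator P x *\<^sub>R (hinge_fun al bl x)^2)"
    using set_integrable_P[OF c2] by (simp add: set_integrable_def)
  have fin: "emeasure lborel P < \<infinity>" by (rule emeasure_compact_finite[OF compact_P])
  have intP: "integrable lborel (indicator P :: real^2 \<Rightarrow> real)" using fin by simp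
  have int3: "integrable lborel (\<lambda>x. indicator P x * indicator S x :: real)"
    by (rule Bochner_Integration.integrable_bound[OF intP]) (auto simp: indicator_def)
  have "V (hinge_fun al bl) \<le> (LINT x|lborel. \<theta> / 2 * (indicator P x * indicator S x) + (1 / (2 * \<theta>)) * (indicator P x *\<^sub>R (hinge_fun al bl x)^2))"
    unfolding V_def set_lebesgue_integral_def
  proof (rule integral_mono[OF int1])
    show "integrable lborel (\<lambda>x. \<theta> / 2 * (indicator P x * indicator S x) + (1 / (2 * \<theta>)) * (indicator P x *\<^sub>R (hinge_fun al bl x)^2))"
      by (intro Bochner_Integration.integrable_add integrable_mult_right int3 int2)
    fix x :: "real^2"
    have amgm: "y \<le> \<theta> / 2 + (1 / (2 * \<theta>)) * y^2" for y :: real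
    proof -
      have "0 \<le> (y - \<theta>)^2 / (2 * \<theta>)" using assms by simp
      also have "\<dots> = \<theta> / 2 + (1 / (2 * \<theta>)) * y^2 - y" using assms by (simp add: field_simps power2_eq_square)
      finally show ?thesis by simp
    qed
    show "indicator P x *\<^sub>R hinge_fun al bl x \<le> \<theta> / 2 * (indicator P x * indicator S x) + (1 / (2 * \<theta>)) * (indicator P x *\<^sub>R (hinge_fun al bl x)^2)"
      using amgm[of "hinge_fun al bl x"] by (auto simp: indicator_def S_def hinge_fun_def)
  qed
  also have "\<dots> = \<theta> / 2 * (LINT x|lborel. indicator P x * indicator S x) + (1 / (2 * \<theta>)) * V (\<lambda>x. (hinge_fun al bl x)^2)"
    unfolding V_def set_lebesgue_integral_def
    by (simp only: Bochner_Integration.integral_add[OF integrable_mult_right[OF int3] integrable_mult_right[OF int2]]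
        integral_mult_right_zero)
  also have "\<dots> \<le> \<theta> / 2 * (LINT x|lborel. indicator P x * indicator S x) + (1 / (2 * \<theta>)) * (CG * (B (hinge_fun al bl))^2)"
    by (intro add_left_mono mult_left_mono V_square_le continuous_hinge_fun hinge_fun_nonneg convex_on_hinge_fun convex_P) (use assms in auto)
  finally show ?thesis by (simp add: S_def)
qed

end

context stable
begin

text \<open>Compactness of the unit sphere of coefficients. For a limit of violations
  \<open>L \<le> 0\<close>, so its crease does not cross \<open>P\<close>, and
  \<open>V \<le> 0\<close> leaves only functions that are nonpositive on \<open>P\<close>. The
  condition on \<open>V\<close> selects the side of the hinge: on a positive affine function
  \<open>L\<close> vanishes while \<open>B\<close> does not. In the remaining case the supports
  shrink to a null set, and \<open>V_hinge_fun_le\<close> gives a contradiction.\<close>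

lemma hinge_gap:
  obtains \<mu> where "\<mu> > 0" "\<And>al bl. V (\<lambda>x. al \<bullet> x + bl) \<le> 0 \<Longrightarrow> L (hinge_fun al bl) \<ge> \<mu> * B (hinge_fun al bl)"
proof (rule ccontr)
  assume no: "\<not> thesis"
  have "\<exists>z :: (real^2) \<times> real. norm z = 1 \<and> V (\<lambda>x. fst z \<bullet> x + snd z) \<le> 0 \<and>
      L (hinge_fun (fst z) (snd z)) < inverse (real (Suc n)) * B (hinge_fun (fst z) (snd z))" for n
  proof -
    have "\<exists>al bl. V (\<lambda>x. al \<bullet> x + bl) \<le> 0 \<and> L (hinge_fun al bl) < inverse (real (Suc n)) * B (hinge_fun al bl)"
    proof (rule ccontr)
      assume "\<not> ?thesis"
      then have "\<And>al bl. V (\<lambda>x. al \<bullet> x + bl) \<le> 0 \<Longrightarrow> L (hinge_fun al bl) \<ge> inverse (real (Suc n)) * B (hinge_fun al bl)"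
        by (meson not_le)
      then show False using no that[of "inverse (real (Suc n))"] by simp
    qed
    then obtain al bl where ab: "V (\<lambda>x. al \<bullet> x + bl) \<le> 0" "L (hinge_fun al bl) < inverse (real (Suc n)) * B (hinge_fun al bl)" by blast
    have "(al, bl) \<noteq> 0"
    proof
      assume "(al, bl) = 0"
      then have "hinge_fun al bl = (\<lambda>x. 0 * 0)" by (auto simp: hinge_fun_def zero_prod_def)
      then have "L (hinge_fun al bl) = 0" "B (hinge_fun al bl) = 0" using L_cmult[of 0 "\<lambda>_. 0"] B_cmult[of 0 "\<lambda>_. 0"] by simp_all
      then show False using ab(2) by simp
    qed
    then have np: "norm (al, bl) > 0" by simp
    define r where "r = 1 / norm (al, bl)"
    have r: "r > 0" using np by (simp add: r_def)
    define z where "z = (r *\<^sub>R al, r * bl)"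
    have "z = r *\<^sub>R (al, bl)" by (simp add: z_def)
    then have "norm z = \<bar>r\<bar> * norm (al, bl)" by (simp only: norm_scaleR)
    also have "\<dots> = 1" using np r by (simp add: r_def)
    finally have "norm z = 1" .
    moreover have "V (\<lambda>x. fst z \<bullet> x + snd z) = r * V (\<lambda>x. al \<bullet> x + bl)"
      unfolding z_def V_cmult[symmetric] by (simp add: distrib_left)
    then have "V (\<lambda>x. fst z \<bullet> x + snd z) \<le> 0" using ab(1) r by (simp add: mult_le_0_iff)
    moreover have "L (hinge_fun (fst z) (snd z)) = r * L (hinge_fun al bl)" "B (hinge_fun (fst z) (snd z)) = r * B (hinge_fun al bl)"
      using r by (simp_all add: z_def hinge_fun_scale L_cmult B_cmult)
    moreover have "r * L (hinge_fun al bl) < r * (inverse (real (Suc n)) * B (hinge_fun al bl))"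
      using ab(2) r by (rule mult_strict_left_mono)
    ultimately show ?thesis by (intro exI[of _ z]) (simp add: mult.left_commute)
  qed
  then obtain z :: "nat \<Rightarrow> (real^2) \<times> real" where z: "\<And>n. norm (z n) = 1"
    "\<And>n. V (\<lambda>x. fst (z n) \<bullet> x + snd (z n)) \<le> 0"
    "\<And>n. L (hinge_fun (fst (z n)) (snd (z n))) < inverse (real (Suc n)) * B (hinge_fun (fst (z n)) (snd (z n)))"
    by metis
  have "compact (sphere 0 1 :: ((real^2) \<times> real) set)" by (rule compact_sphere)
  then obtain l r where l: "l \<in> sphere 0 1" "strict_mono r" "(z \<circ> r) \<longlonglongrightarrow> l"
    unfolding compact_def using z(1) by (metis (no_types, lifting) dist_0_norm mem_sphere)
  define an bn where "an = (\<lambda>n. fst (z (r n)))" and "bn = (\<lambda>n. snd (z (r n)))"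
  define al bl where "al = fst l" and "bl = snd l"
  have lim: "an \<longlonglongrightarrow> al" "bn \<longlonglongrightarrow> bl"
    using tendsto_fst[OF l(3)] tendsto_snd[OF l(3)] by (simp_all add: an_def bn_def al_def bl_def comp_def)
  have nn: "norm (al, bl) = 1" using l(1) by (simp add: al_def bl_def)
  have Vle: "V (\<lambda>x. al \<bullet> x + bl) \<le> 0"
    by (rule LIMSEQ_le_const2[OF tendsto_hinge_fun(3)[OF lim]]) (use z(2) in \<open>auto simp: an_def bn_def\<close>)
  have inv: "(\<lambda>n. inverse (real (Suc (r n)))) \<longlonglongrightarrow> 0"
    using LIMSEQ_subseq_LIMSEQ[OF LIMSEQ_inverse_real_of_nat l(2)] by (simp add: comp_def)
  have small: "L (hinge_fun (an n) (bn n)) < inverse (real (Suc (r n))) * B (hinge_fun (an n) (bn n))" for n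
    using z(3)[of "r n"] by (simp only: an_def bn_def)
  have Lle: "L (hinge_fun al bl) \<le> 0"
  proof (rule LIMSEQ_le[OF tendsto_L_hinge_fun[OF lim]])
    show "(\<lambda>n. inverse (real (Suc (r n))) * B (hinge_fun (an n) (bn n))) \<longlonglongrightarrow> 0"
      using tendsto_mult[OF inv tendsto_hinge_fun(1)[OF lim]] by simp
    show "\<exists>M. \<forall>n\<ge>M. L (hinge_fun (an n) (bn n)) \<le> inverse (real (Suc (r n))) * B (hinge_fun (an n) (bn n))"
      using small less_imp_le by blast
  qed
  have ca: "continuous_on P (\<lambda>x. al \<bullet> x + bl)" by (intro continuous_intros)
  have le0: "al \<bullet> x + bl \<le> 0" if x: "x \<in> P" for x
  proof (rule ccontr)
    assume "\<not> ?thesis"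
    then have pos: "al \<bullet> x + bl > 0" by simp
    have "\<exists>v\<in>P. al \<bullet> v + bl < 0"
    proof (rule ccontr)
      assume "\<not> ?thesis"
      then have "\<And>v. v \<in> P \<Longrightarrow> al \<bullet> v + bl \<ge> 0" by force
      then have "V (\<lambda>x. al \<bullet> x + bl) > 0" using V_pos[OF ca _ x pos] by blast
      then show False using Vle by simp
    qed
    then have "crossing P al bl" unfolding crossing_def using x pos by blast
    then show False using L_hinge_fun_pos Lle by (metis not_le)
  qed
  \<comment> \<open>The area of the part of \<open>P\<close> where the n-th hinge is positive. It
    tends to 0 because the limit function is negative almost everywhere on \<open>P\<close>.\<close>
  define M where "M = (\<lambda>n. LINT x|lborel. indicator P x * indicator {x. an n \<bullet> x + bn n > 0} x :: real)"
  have Pm [measurable]: "P \<in> sets borel" using closed_P by simp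
  have "M \<longlonglongrightarrow> (LINT x|(lborel :: (real^2) measure). 0)"
    unfolding M_def
  proof (rule integral_dominated_convergence[where w = "indicator P"])
    show "integrable lborel (indicator P :: real^2 \<Rightarrow> real)"
      using emeasure_compact_finite[OF compact_P] by simp
    have "{x. al \<bullet> x + bl = 0} \<in> null_sets lborel"
    proof (cases "al = 0")
      case True
      then have "bl \<noteq> 0" using nn by auto
      then show ?thesis using True by simp
    next
      case False
      have "{x. al \<bullet> x + bl = 0} = {x. al \<bullet> x = - bl}" by (auto simp: add_eq_0_iff)
      then show ?thesis using null_set_hyperplane[OF False] by simp
    qed
    then have "AE x in lborel. x \<notin> {x. al \<bullet> x + bl = 0}" by (rule AE_not_in)
    then show "AE x in lborel. (\<lambda>n. indicator P x * indicator {x. an n \<bullet> x + bn n > 0} x :: real) \<longlonglongrightarrow> 0"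
    proof (rule AE_mp, intro AE_I2 impI)
      fix x assume "x \<notin> {x. al \<bullet> x + bl = 0}"
      then have ne: "al \<bullet> x + bl \<noteq> 0" by simp
      show "(\<lambda>n. indicator P x * indicator {x. an n \<bullet> x + bn n > 0} x :: real) \<longlonglongrightarrow> 0"
      proof (cases "x \<in> P")
        case True
        then have neg: "al \<bullet> x + bl < 0" using le0 ne by force
        have "(\<lambda>n. an n \<bullet> x + bn n) \<longlonglongrightarrow> al \<bullet> x + bl" by (intro tendsto_intros lim)
        from order_tendstoD(2)[OF this neg]
        have "\<forall>\<^sub>F n in sequentially. indicator P x * indicator {x. an n \<bullet> x + bn n > 0} x = (0::real)"
          by (rule eventually_mono) auto
        then show ?thesis by (rule tendsto_eventually)
      qed simp
    qed
    show "(\<lambda>x. indicator P x * indicator {x. an n \<bullet> x + bn n > 0} x :: real) \<in> borel_measurable lborel" for n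
      by measurable
  qed (auto simp: indicator_def)
  then have M0: "M \<longlonglongrightarrow> 0" by simp
  define K where "K = CG + 1"
  have K: "K > 0" "CG \<le> K" using CG_nonneg by (simp_all add: K_def)
  have aK: "0 < 4 * a^2 * K" using a_pos K by (intro mult_pos_pos zero_less_power) auto
  \<comment> \<open>For \<open>n \<ge> 1\<close> the violation has constant at most 1/2, so
    \<open>a * V\<close> exceeds half of \<open>B\<close>; this needs a support of definite
    size.\<close>
  have Mlow: "M n \<ge> 1 / (4 * a^2 * K)" if n: "n \<ge> 1" for n
  proof -
    define b where "b = B (hinge_fun (an n) (bn n))"
    define v where "v = V (hinge_fun (an n) (bn n))"
    have "inverse (real (Suc (r n))) * b > 0" using small[of n] L_hinge_fun_nonneg[of "an n" "bn n"] unfolding b_def by linarith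
    then have b: "b > 0" by (simp add: zero_less_mult_iff)
    have "r n \<ge> 1" using seq_suble[OF l(2), of n] n by linarith
    then have "inverse (real (Suc (r n))) \<le> 1 / 2" by (simp add: field_simps)
    then have "inverse (real (Suc (r n))) * b \<le> 1 / 2 * b" using b by (intro mult_right_mono) auto
    then have "b - a * v < b / 2" using small[of n] unfolding L_def b_def v_def by linarith
    then have av: "b / 2 < a * v" by simp
    \<comment> \<open>Chosen so that the quadratic term contributes \<open>b / (4 * a)\<close>, half
      of the lower bound \<open>b / (2 * a)\<close> for \<open>v\<close>.\<close>
    define \<theta> where "\<theta> = 2 * a * K * b"
    have th: "\<theta> > 0" using a_pos K b by (simp add: \<theta>_def)
    have "v \<le> \<theta> / 2 * M n + CG * b^2 / (2 * \<theta>)"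
      using V_hinge_fun_le[OF th, of "an n" "bn n"] unfolding M_def v_def b_def .
    also have "CG * b^2 / (2 * \<theta>) \<le> K * b^2 / (2 * \<theta>)"
      using K th by (intro divide_right_mono mult_right_mono) auto
    also have "K * b^2 / (2 * \<theta>) = b / (4 * a)" using a_pos K b by (simp add: \<theta>_def field_simps power2_eq_square)
    also have "\<theta> / 2 * M n = a * K * b * M n" by (simp add: \<theta>_def)
    finally have "a * v \<le> a * (a * K * b * M n + b / (4 * a))" using a_pos by (intro mult_left_mono) auto
    also have "\<dots> = a^2 * K * b * M n + b / 4" using a_pos by (simp add: field_simps power2_eq_square)
    finally have "b / 4 < a^2 * K * b * M n" using av by linarith
    then have "b * (1 / 4) < b * (a^2 * K * M n)" by (simp add: mult_ac)
    then have "1 / 4 < a^2 * K * M n" using b by (simp only: mult_less_cancel_left_pos)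
    moreover note aK
    moreover have "M n * (4 * a^2 * K) = 4 * (a^2 * K * M n)" by simp
    ultimately show ?thesis by (simp only: pos_divide_le_eq)
  qed
  have "1 / (4 * a^2 * K) \<le> 0"
    by (rule LIMSEQ_le_const[OF M0]) (use Mlow in blast)
  moreover have "1 / (4 * a^2 * K) > 0" using aK by (intro divide_pos_pos) auto
  ultimately show False by linarith
qed

end

section \<open>Majorants of convex functions by hinge sums\<close>

context moment
begin

lemma off_edge_point:
  assumes k: "k < N" obtains x where "x \<in> P" "h k \<bullet> x > c k"
proof -
  obtain x where x: "x \<in> interior P" using interior_P by blast
  obtain d where d: "d > 0" "ball x d \<subseteq> P" using x mem_interior by blast
  define y where "y = x + (d / 2 / norm (h k)) *\<^sub>R h k"
  have "norm (y - x) = d / 2" using h_nonzero[OF k] d by (simp add: y_def)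
  then have "y \<in> P" using d by (auto simp: dist_norm norm_minus_commute)
  moreover have "x \<in> P" using x interior_subset by blast
  then have "c k \<le> h k \<bullet> x" using k unfolding P_iff by blast
  moreover have "(d / 2 / norm (h k)) * (h k \<bullet> h k) > 0"
    using h_pos[OF k] h_nonzero[OF k] d by (intro mult_pos_pos divide_pos_pos) auto
  ultimately show thesis using that[of y] by (simp add: y_def inner_add_right)
qed

text \<open>The function is interpolated at equidistant points of every edge, with a mesh below its
  modulus of continuity. The ends of the edges are included, so the sample points span
  \<open>P\<close>. Between neighbours the convex interpolant is at most the larger of two values of
  \<open>f\<close>, both at most \<open>f x + e\<close>.\<close>

lemma hinge_approximation:
  assumes f: "continuous_on P f" "convex_on P f" and e: "e > 0"
  obtains T H where "affine_linear T" "hinge_sum H" "\<And>x. x \<in> P \<Longrightarrow> f x \<le> T x + H x"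
    "\<And>k x. k < N \<Longrightarrow> x \<in> E k \<Longrightarrow> T x + H x \<le> f x + e"
proof -
  have "uniformly_continuous_on P f" by (rule compact_uniformly_continuous[OF f(1) compact_P])
  then obtain d where d: "d > 0" "\<And>x y. x \<in> P \<Longrightarrow> y \<in> P \<Longrightarrow> dist y x < d \<Longrightarrow> dist (f y) (f x) < e"
    unfolding uniformly_continuous_on_def using e by meson
  \<comment> \<open>The Euclidean perimeter, a common bound for the lengths of the edges.\<close>
  define S where "S = (\<Sum>k<N. (hi k - lo k) * norm (rot90 (h k)))"
  have Sk: "(hi k - lo k) * norm (rot90 (h k)) \<le> S" if "k < N" for k
    unfolding S_def
  proof (rule member_le_sum)
    fix j assume "j \<in> {..<N} - {k}"
    then show "0 \<le> (hi j - lo j) * norm (rot90 (h j))" using lo_hi(1)[of j] by (intro mult_nonneg_nonneg) auto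
  qed (use that in auto)
  obtain n :: nat where n: "real n > S / d" "n > 0"
    using reals_Archimedean2[of "max 1 (S / d)"] by (metis max_less_iff_conj of_nat_0_less_iff less_trans zero_less_one)
  have Sn: "S / real n < d" using n d by (simp add: field_simps)
  define pt where "pt = (\<lambda>k i. lo k + (real i / real n) * (hi k - lo k))"
  define Q where "Q = (\<Union>k\<in>{..<N}. (\<lambda>i. \<gamma> k (pt k i)) ` {0..n})"
  have fin: "finite Q" by (simp add: Q_def)
  have pt: "lo k \<le> pt k i" "pt k i \<le> hi k" if "k < N" "i \<le> n" for k i
  proof -
    have "0 \<le> real i / real n" "real i / real n \<le> 1" using that n by auto
    then have "0 \<le> (real i / real n) * (hi k - lo k)" "(real i / real n) * (hi k - lo k) \<le> 1 * (hi k - lo k)"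
      using lo_hi(1)[OF that(1)] by (intro mult_nonneg_nonneg mult_right_mono; simp)+
    then show "lo k \<le> pt k i" "pt k i \<le> hi k" by (simp_all add: pt_def)
  qed
  have QE: "\<exists>k<N. q \<in> E k" if "q \<in> Q" for q
  proof -
    from that obtain k i where "k < N" "i \<le> n" "q = \<gamma> k (pt k i)" by (auto simp: Q_def)
    then show ?thesis using gamma_in_E pt by blast
  qed
  have QP: "Q \<subseteq> P" using QE E_subset by blast
  have ends: "\<gamma> k (lo k) \<in> Q" "\<gamma> k (hi k) \<in> Q" if "k < N" for k
  proof -
    have "pt k 0 = lo k" "pt k n = hi k" using n by (simp_all add: pt_def)
    moreover have "\<gamma> k (pt k 0) \<in> Q" "\<gamma> k (pt k n) \<in> Q" using that unfolding Q_def by (intro UN_I[of k] imageI; simp)+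
    ultimately show "\<gamma> k (lo k) \<in> Q" "\<gamma> k (hi k) \<in> Q" by simp_all
  qed
  have PQ: "P = convex hull Q"
  proof
    have "{x. x extreme_point_of P} \<subseteq> Q"
    proof
      fix x assume "x \<in> {x. x extreme_point_of P}"
      then obtain k where "k < N" "x = \<gamma> k (lo k) \<or> x = \<gamma> k (hi k)" using extreme_point_obtain by blast
      then show "x \<in> Q" using ends by blast
    qed
    then show "P \<subseteq> convex hull Q" using hull_mono[of _ Q convex] P_hull by metis
    show "convex hull Q \<subseteq> P" using QP convex_P by (rule hull_minimal)
  qed
  have affh: "affine_linear (\<lambda>x. h k \<bullet> x - c k)" for k
    unfolding affine_linear_def by (rule exI[of _ "h k"], rule exI[of _ "- c k"]) simp
  have supp: "\<exists>u. affine_linear u \<and> u q = 0 \<and> (\<forall>x\<in>P. 0 \<le> u x) \<and> (\<exists>x. u x \<noteq> 0)" if q: "q \<in> Q" for q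
  proof -
    obtain k where k: "k < N" "q \<in> E k" using QE[OF q] by blast
    obtain x where "x \<in> P" "h k \<bullet> x > c k" using off_edge_point[OF k(1)] .
    then show ?thesis using affh[of k] k
      by (intro exI[of _ "\<lambda>x. h k \<bullet> x - c k"]) (auto simp: edge_def P_iff intro!: exI[of _ x])
  qed
  have N0: "0 < N" by (rule N_pos)
  define z where "z = \<gamma> 0 (lo 0)"
  define R where "R = {q \<in> Q. q \<in> E 0 \<and> q \<noteq> z}"
  have "\<gamma> 0 (hi 0) \<in> R"
    using ends(2)[OF N0] gamma_in_E[OF N0] gamma_inj[OF N0] lo_hi(1)[OF N0] by (auto simp: R_def z_def)
  then have "R \<noteq> {}" "finite R" using fin by (auto simp: R_def)
  \<comment> \<open>The neighbour of \<open>z\<close> among the sample points of edge 0, found as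
    the one with the least parameter.\<close>
  then obtain z' where z': "z' \<in> R" "\<And>q. q \<in> R \<Longrightarrow> \<xi> 0 \<bullet> z' \<le> \<xi> 0 \<bullet> q"
    using ex_is_arg_min_if_finite[of R "\<lambda>q. \<xi> 0 \<bullet> q"] unfolding is_arg_min_linorder by blast
  have Rg: "\<exists>t. q = \<gamma> 0 t \<and> lo 0 < t \<and> \<xi> 0 \<bullet> q = t" if q: "q \<in> R" for q
  proof -
    obtain t where t: "q = \<gamma> 0 t" "lo 0 \<le> t" using q unfolding R_def E_eq[OF N0] by auto
    then have "t \<noteq> lo 0" using q by (auto simp: R_def z_def)
    then show ?thesis using t xi_gamma[OF N0] by auto
  qed
  obtain t' where t': "z' = \<gamma> 0 t'" "lo 0 < t'" "\<xi> 0 \<bullet> z' = t'" using Rg[OF z'(1)] by blast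
  obtain x0 where x0: "x0 \<in> P" "h 0 \<bullet> x0 > c 0" using off_edge_point[OF N0] .
  have "\<exists>q0\<in>Q. h 0 \<bullet> q0 - c 0 \<noteq> 0"
  proof (rule ccontr)
    assume "\<not> ?thesis"
    then have "\<And>q. q \<in> Q \<Longrightarrow> h 0 \<bullet> q - c 0 \<le> 0" by force
    then have "h 0 \<bullet> x0 - c 0 \<le> 0" using affine_linear_nonpos_hull[OF affh[of 0]] x0(1) PQ by blast
    then show False using x0(2) by simp
  qed
  then obtain q0 where q0: "q0 \<in> Q" "h 0 \<bullet> q0 - c 0 \<noteq> 0" by blast
  have edge: "\<exists>t\<ge>1. q = z + t *\<^sub>R (z' - z)" if q: "q \<in> Q" "h 0 \<bullet> q - c 0 = 0" "q \<noteq> z" for q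
  proof -
    have "q \<in> R" using q QP by (auto simp: R_def edge_def)
    then obtain t where t: "q = \<gamma> 0 t" "lo 0 < t" "\<xi> 0 \<bullet> q = t" using Rg by blast
    have "t' \<le> t" using z'(2)[OF \<open>q \<in> R\<close>] t t' by simp
    define r where "r = (t - lo 0) / (t' - lo 0)"
    have r: "r \<ge> 1" using \<open>t' \<le> t\<close> t'(2) by (simp add: r_def)
    have "r * (t' - lo 0) = t - lo 0" using t'(2) by (simp add: r_def)
    then have "q = z + r *\<^sub>R (z' - z)"
      unfolding t(1) t'(1) z_def \<gamma>_def by (simp add: scaleR_diff_left[symmetric]) (simp add: scaleR_diff_left)
    then show ?thesis using r by blast
  qed
  obtain T H where TH: "affine_linear T" "hinge_sum H" "\<And>q. q \<in> Q \<Longrightarrow> f q = T q + H q"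
    "\<And>x. x \<in> P \<Longrightarrow> f x \<le> T x + H x"
  proof (rule hinge_interpolation[OF fin PQ supp affh[of 0] _ _ _ _ _ _ q0 edge f(2)])
    show "0 \<le> h 0 \<bullet> x - c 0" if "x \<in> P" for x using that N0 unfolding P_iff by auto
    show "z \<in> Q" using ends(1)[OF N0] by (simp add: z_def)
    show "z' \<in> Q" "z \<noteq> z'" using z'(1) by (auto simp: R_def)
    show "h 0 \<bullet> z - c 0 = 0" "h 0 \<bullet> z' - c 0 = 0" using inner_gamma[OF N0] by (simp_all add: z_def t'(1))
  qed (assumption | (rule that; (assumption | fast)))+
  have conv: "convex_on P (\<lambda>x. T x + H x)"
    by (intro convex_on_add affine_linear_convex_on TH hinge_sum_convex_on convex_P)
  have "T x + H x \<le> f x + e" if k: "k < N" and x: "x \<in> E k" for k x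
  proof -
    obtain t where t: "x = \<gamma> k t" "lo k \<le> t" "t \<le> hi k" using x unfolding E_eq[OF k] by auto
    have lh: "hi k - lo k > 0" using lo_hi(1)[OF k] by simp
    define \<tau> where "\<tau> = real n * ((t - lo k) / (hi k - lo k))"
    have tau: "0 \<le> \<tau>" "\<tau> \<le> real n"
    proof -
      have "0 \<le> (t - lo k) / (hi k - lo k)" "(t - lo k) / (hi k - lo k) \<le> 1" using t lh by auto
      then have "real n * 0 \<le> \<tau>" "\<tau> \<le> real n * 1" unfolding \<tau>_def by (intro mult_left_mono; simp)+
      then show "0 \<le> \<tau>" "\<tau> \<le> real n" by simp_all
    qed
    have tt: "t = lo k + (\<tau> / real n) * (hi k - lo k)" using n lh by (simp add: \<tau>_def)
    \<comment> \<open>The last subinterval is closed on the right, so \<open>\<tau> = n\<close> is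
      assigned to index \<open>n - 1\<close>.\<close>
    define i where "i = (if \<tau> = real n then n - 1 else nat \<lfloor>\<tau>\<rfloor>)"
    have i: "real i \<le> \<tau>" "\<tau> \<le> real i + 1" "i < n"
    proof -
      show "real i \<le> \<tau>" "\<tau> \<le> real i + 1" using tau n by (auto simp: i_def of_nat_diff)
      show "i < n" using tau n by (auto simp: i_def) linarith
    qed
    define u where "u = \<tau> - real i"
    have u: "0 \<le> u" "u \<le> 1" using i by (simp_all add: u_def)
    have "t = (1 - u) * pt k i + u * pt k (Suc i)"
      unfolding tt pt_def u_def using n by (simp add: field_simps)
    then have xc: "x = (1 - u) *\<^sub>R \<gamma> k (pt k i) + u *\<^sub>R \<gamma> k (pt k (Suc i))"
      using gamma_affine[of "1 - u" u] by (simp add: t(1))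
    define q1 q2 where "q1 = \<gamma> k (pt k i)" and "q2 = \<gamma> k (pt k (Suc i))"
    have q12: "q1 \<in> Q" "q2 \<in> Q" unfolding Q_def q1_def q2_def using i(3) k by (intro UN_I[of k] imageI; simp)+
    have xP: "x \<in> P" using x E_subset by blast
    have diff: "norm (\<gamma> k r - \<gamma> k s) \<le> \<bar>r - s\<bar> * norm (rot90 (h k))" for r s
      by (simp add: \<gamma>_def scaleR_diff_left[symmetric])
    have near: "dist (\<gamma> k r) x < d" if "\<bar>r - t\<bar> \<le> (hi k - lo k) / real n" for r
    proof -
      have "norm (\<gamma> k r - \<gamma> k t) \<le> (hi k - lo k) / real n * norm (rot90 (h k))"
        using diff[of r t] mult_right_mono[OF that, of "norm (rot90 (h k))"] by simp
      also have "\<dots> = ((hi k - lo k) * norm (rot90 (h k))) / real n" by simp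
      also have "\<dots> \<le> S / real n" using Sk[OF k] by (intro divide_right_mono) auto
      also have "\<dots> < d" by (rule Sn)
      finally show ?thesis by (simp add: t(1) dist_norm)
    qed
    have "pt k i - t = - (u / real n) * (hi k - lo k)" "pt k (Suc i) - t = ((1 - u) / real n) * (hi k - lo k)"
      unfolding tt pt_def u_def using n by (simp_all add: field_simps)
    then have "\<bar>pt k i - t\<bar> = u * ((hi k - lo k) / real n)" "\<bar>pt k (Suc i) - t\<bar> = (1 - u) * ((hi k - lo k) / real n)"
      using u lh by (simp_all add: abs_mult)
    moreover have "v * ((hi k - lo k) / real n) \<le> (hi k - lo k) / real n" if "0 \<le> v" "v \<le> 1" for v
      using that lh by (intro mult_left_le_one_le) auto
    ultimately have "dist q1 x < d" "dist q2 x < d" unfolding q1_def q2_def using u by (intro near; simp)+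
    then have fe: "f q1 \<le> f x + e" "f q2 \<le> f x + e"
      using d(2)[OF xP, of q1] d(2)[OF xP, of q2] q12 QP by (auto simp: dist_real_def)
    have "T x + H x \<le> max (T q1 + H q1) (T q2 + H q2)"
      using convex_lower[OF conv, of q1 q2 "1 - u" u] q12 QP u unfolding xc q1_def[symmetric] q2_def[symmetric] by auto
    also have "\<dots> \<le> f x + e" using TH(3)[OF q12(1)] TH(3)[OF q12(2)] fe by simp
    finally show ?thesis .
  qed
  then show thesis using that TH by blast
qed

end

section \<open>The projection\<close>

text \<open>The point \<open>(p, f p - e)\<close> is separated from the closed epigraph. The slack
  \<open>e\<close> puts it strictly below and makes the hyperplane nonvertical; at a boundary point
  an exact supporting function may fail to exist.\<close>

lemma affine_minorant:
  fixes f :: "real^2 \<Rightarrow> real"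
  assumes S: "closed S" "p \<in> S" and f: "continuous_on S f" "convex_on S f" and e: "e > 0"
  obtains T where "affine_linear T" "\<And>x. x \<in> S \<Longrightarrow> T x \<le> f x" "T p \<ge> f p - e"
proof -
  define G where "G = {z \<in> S \<times> UNIV. f (fst z) \<le> snd z}"
  have clo: "closed G" unfolding G_def
    by (intro continuous_on_closed_Collect_le continuous_intros closed_Times S continuous_on_compose2[OF f(1)]) auto
  have con: "convex G"
  proof -
    have "G = epigraph S f" by (auto simp: G_def epigraph_def)
    then show ?thesis using f(2) by (simp add: convex_epigraph convex_on_imp_convex)
  qed
  have nin: "(p, f p - e) \<notin> G" using e by (simp add: G_def)
  obtain ab b where ab: "ab \<bullet> (p, f p - e) < b" "\<forall>z\<in>G. ab \<bullet> z > b"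
    using separating_hyperplane_closed_point[OF con clo nin] by auto
  obtain \<alpha> \<beta> where ab': "ab = (\<alpha>, \<beta>)" by (cases ab)
  have 1: "\<alpha> \<bullet> p + \<beta> * (f p - e) < b" using ab(1) by (simp add: ab')
  have 2: "\<alpha> \<bullet> x + \<beta> * f x > b" if "x \<in> S" for x
    using bspec[OF ab(2), of "(x, f x)"] that by (simp add: ab' G_def)
  have "\<beta> * e > 0" using 1 2[OF S(2)] by (simp add: algebra_simps)
  then have b: "\<beta> > 0" using e by (simp add: zero_less_mult_iff)
  define T where "T = (\<lambda>x. (- (1/\<beta>) *\<^sub>R \<alpha>) \<bullet> x + b / \<beta>)"
  have T: "T x = (b - \<alpha> \<bullet> x) / \<beta>" for x using b by (simp add: T_def field_simps)
  show thesis
  proof (rule that)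
    show "affine_linear T" unfolding T_def affine_linear_def by blast
    show "T x \<le> f x" if "x \<in> S" for x using 2[OF that] b by (simp add: T field_simps)
    show "T p \<ge> f p - e" using 1 b by (simp add: T field_simps)
  qed
qed

context moment
begin

lemma affine_zero_on_P:
  assumes "\<And>x. x \<in> P \<Longrightarrow> al \<bullet> x + bl = 0" shows "al = 0" "bl = 0"
proof -
  obtain x where x: "x \<in> interior P" using interior_P by blast
  obtain d where d: "d > 0" "ball x d \<subseteq> P" using x mem_interior by blast
  have xP: "x \<in> P" using x interior_subset by blast
  show "al = 0"
  proof (rule ccontr)
    assume al: "al \<noteq> 0"
    define y where "y = x + (d / 2 / norm al) *\<^sub>R al"
    have "norm (y - x) = d / 2" using al d by (simp add: y_def)
    then have "y \<in> P" using d by (auto simp: dist_norm norm_minus_commute)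
    then have "al \<bullet> y - al \<bullet> x = 0" using assms[of y] assms[OF xP] by linarith
    then show False using al d by (simp add: y_def inner_add_right)
  qed
  then show "bl = 0" using assms[OF xP] by simp
qed

lemma affine_V_square:
  assumes "V (\<lambda>x. (al \<bullet> x + bl)^2) = 0" shows "al = 0" "bl = 0"
proof -
  have c: "continuous_on P (\<lambda>x. (al \<bullet> x + bl)^2)" by (intro continuous_intros)
  have "al \<bullet> x + bl = 0" if "x \<in> P" for x
  proof (rule ccontr)
    assume "al \<bullet> x + bl \<noteq> 0"
    then have "(al \<bullet> x + bl)^2 > 0" by simp
    then show False using V_pos[OF c _ that] assms by simp
  qed
  then show "al = 0" "bl = 0" using affine_zero_on_P by blast+
qed

lemma V_affine_mult:
  assumes "continuous_on P f"
  shows "V (\<lambda>x. f x * (al \<bullet> x + bl)) = al$1 * V (\<lambda>x. f x * x$1) + al$2 * V (\<lambda>x. f x * x$2) + bl * V f"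
proof -
  have c: "continuous_on P (\<lambda>x. f x * x$i)" for i by (intro continuous_intros assms)
  have "(\<lambda>x. f x * (al \<bullet> x + bl)) = (\<lambda>x. (al$1 * (f x * x$1) + al$2 * (f x * x$2)) + bl * f x)"
    by (auto simp: inner_real2 algebra_simps)
  then have "V (\<lambda>x. f x * (al \<bullet> x + bl)) = V (\<lambda>x. (al$1 * (f x * x$1) + al$2 * (f x * x$2)) + bl * f x)" by simp
  also have "\<dots> = V (\<lambda>x. al$1 * (f x * x$1) + al$2 * (f x * x$2)) + V (\<lambda>x. bl * f x)"
    by (intro V_add continuous_intros c assms)
  also have "V (\<lambda>x. al$1 * (f x * x$1) + al$2 * (f x * x$2)) = V (\<lambda>x. al$1 * (f x * x$1)) + V (\<lambda>x. al$2 * (f x * x$2))"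
    by (intro V_add continuous_intros c)
  finally show ?thesis by (simp only: V_cmult)
qed

text \<open>\<open>A\<close> is the Gram operator of the affine functions:
  \<open>z \<bullet> A z\<close> is the integral of the square of the function with coefficients
  \<open>z\<close>. It is injective since \<open>P\<close> has interior, hence surjective, which
  solves the normal equations. Uniqueness identifies the definite description in
  \<open>proj_affine_perp\<close>.\<close>

lemma L2_projection:
  assumes f: "continuous_on P f"
  obtains g where "affine_linear g" "proj_affine_perp P f = (\<lambda>x. f x - g x)"
    "\<And>l. affine_linear l \<Longrightarrow> V (\<lambda>x. (f x - g x) * l x) = 0"
proof -
  define A :: "(real^2) \<times> real \<Rightarrow> (real^2) \<times> real" where
    "A = (\<lambda>z. (vector [V (\<lambda>x. (fst z \<bullet> x + snd z) * x$1), V (\<lambda>x. (fst z \<bullet> x + snd z) * x$2)], V (\<lambda>x. fst z \<bullet> x + snd z)))"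
  have ca: "continuous_on P (\<lambda>x. al \<bullet> x + bl)" for al bl by (intro continuous_intros)
  have cx: "continuous_on P (\<lambda>x. (al \<bullet> x + bl) * x$i)" for al bl and i :: 2 by (intro continuous_intros)
  have quad: "z \<bullet> A z = V (\<lambda>x. (fst z \<bullet> x + snd z)^2)" for z
    using V_affine_mult[OF ca, of "fst z" "snd z" "fst z" "snd z"]
    by (simp add: A_def inner_prod_def inner_real2 power2_eq_square)
  have lin: "linear A"
  proof (rule linearI)
    fix z w :: "(real^2) \<times> real" and r :: real
    have "V (\<lambda>x. (fst (z + w) \<bullet> x + snd (z + w)) * x$i) = V (\<lambda>x. (fst z \<bullet> x + snd z) * x$i) + V (\<lambda>x. (fst w \<bullet> x + snd w) * x$i)" for i
      using V_add[OF cx cx, of "fst z" "snd z" i "fst w" "snd w" i] by (simp add: algebra_simps)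
    moreover have "V (\<lambda>x. fst (z + w) \<bullet> x + snd (z + w)) = V (\<lambda>x. fst z \<bullet> x + snd z) + V (\<lambda>x. fst w \<bullet> x + snd w)"
      using V_add[OF ca ca, of "fst z" "snd z" "fst w" "snd w"] by (simp add: algebra_simps)
    ultimately show "A (z + w) = A z + A w" by (simp add: A_def vec_eq_iff forall_2)
    have "V (\<lambda>x. (fst (r *\<^sub>R z) \<bullet> x + snd (r *\<^sub>R z)) * x$i) = r * V (\<lambda>x. (fst z \<bullet> x + snd z) * x$i)" for i
      unfolding V_cmult[symmetric] by (simp add: algebra_simps)
    moreover have "V (\<lambda>x. fst (r *\<^sub>R z) \<bullet> x + snd (r *\<^sub>R z)) = r * V (\<lambda>x. fst z \<bullet> x + snd z)"
      unfolding V_cmult[symmetric] by (simp add: algebra_simps)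
    ultimately show "A (r *\<^sub>R z) = r *\<^sub>R A z" by (simp add: A_def vec_eq_iff forall_2)
  qed
  have "inj A"
    unfolding linear_injective_0[OF lin]
  proof (intro allI impI)
    fix z assume "A z = 0"
    then have "V (\<lambda>x. (fst z \<bullet> x + snd z)^2) = 0" using quad[of z] by simp
    then show "z = 0" using affine_V_square[of "fst z" "snd z"] by (simp add: prod_eq_iff)
  qed
  then have "surj A" using linear_injective_imp_surjective[OF lin] by simp
  then obtain z where z: "(vector [V (\<lambda>x. f x * x$1), V (\<lambda>x. f x * x$2)], V f) = A z" by (meson surjD)
  define g where "g = (\<lambda>x. fst z \<bullet> x + snd z)"
  have ga: "affine_linear g" unfolding g_def affine_linear_def by blast
  have gc: "continuous_on P g" by (rule affine_linear_continuous_on[OF ga])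
  have moments: "V (\<lambda>x. f x * x$1) = V (\<lambda>x. g x * x$1)" "V (\<lambda>x. f x * x$2) = V (\<lambda>x. g x * x$2)" "V f = V g"
    using z by (auto simp: A_def g_def vec_eq_iff forall_2)
  have Vdiff: "V (\<lambda>x. u x - w x) = V u - V w" if "continuous_on P u" "continuous_on P w" for u w
    using V_add[OF that(1), of "\<lambda>x. (-1) * w x"] V_cmult[of "-1" w] that(2) by (simp add: continuous_on_minus)
  have orth: "V (\<lambda>x. (f x - g x) * l x) = 0" if l: "affine_linear l" for l
  proof -
    obtain al bl where le: "l = (\<lambda>x. al \<bullet> x + bl)" using l unfolding affine_linear_def by blast
    have "V (\<lambda>x. (f x - g x) * l x) = V (\<lambda>x. f x * (al \<bullet> x + bl) - g x * (al \<bullet> x + bl))"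
      by (simp add: le left_diff_distrib)
    also have "\<dots> = V (\<lambda>x. f x * (al \<bullet> x + bl)) - V (\<lambda>x. g x * (al \<bullet> x + bl))"
      by (intro Vdiff continuous_intros f gc)
    also have "\<dots> = 0" unfolding V_affine_mult[OF f] V_affine_mult[OF gc] moments by simp
    finally show ?thesis .
  qed
  have uniq: "g' = g" if g': "affine_linear g'" "\<And>l. affine_linear l \<Longrightarrow> V (\<lambda>x. (f x - g' x) * l x) = 0" for g'
  proof -
    have g'c: "continuous_on P g'" by (rule affine_linear_continuous_on[OF g'(1)])
    have d: "affine_linear (\<lambda>x. g' x - g x)" by (rule affine_linear_diff[OF g'(1) ga])
    have dc: "continuous_on P (\<lambda>x. g' x - g x)" by (rule affine_linear_continuous_on[OF d])
    have "V (\<lambda>x. (g' x - g x)^2) = V (\<lambda>x. (f x - g x) * (g' x - g x) - (f x - g' x) * (g' x - g x))"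
      by (rule arg_cong[of _ _ V]) (auto simp: power2_eq_square algebra_simps)
    also have "\<dots> = V (\<lambda>x. (f x - g x) * (g' x - g x)) - V (\<lambda>x. (f x - g' x) * (g' x - g x))"
      by (intro Vdiff continuous_intros f gc g'c)
    also have "\<dots> = 0" using orth[OF d] g'(2)[OF d] by simp
    finally have V0: "V (\<lambda>x. (g' x - g x)^2) = 0" .
    obtain al bl where de: "\<And>x. g' x - g x = al \<bullet> x + bl" using d unfolding affine_linear_def by blast
    have "al = 0" "bl = 0" using affine_V_square[of al bl] V0 unfolding de by auto
    then show "g' = g" using de by (auto simp: fun_eq_iff)
  qed
  have "(THE g. affine_linear g \<and> (\<forall>l. affine_linear l \<longrightarrow> (LINT x:P|lborel. (f x - g x) * l x) = 0)) = g"
    unfolding V_def[symmetric]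
    by (rule the_equality) (use ga orth uniq in blast)+
  then have "proj_affine_perp P f = (\<lambda>x. f x - g x)" by (simp add: proj_affine_perp_def)
  then show thesis using that[OF ga _ orth] by blast
qed

text \<open>Pythagoras: the projection minimises the distance to affine functions, so any convenient
  \<open>T\<close> bounds the norm.\<close>

lemma L2_norm_proj_le:
  assumes f: "continuous_on P f" and T: "affine_linear T"
  shows "L2_norm_on P (proj_affine_perp P f) \<le> sqrt (V (\<lambda>x. (f x - T x)^2))"
proof -
  obtain g where g: "affine_linear g" "proj_affine_perp P f = (\<lambda>x. f x - g x)"
    "\<And>l. affine_linear l \<Longrightarrow> V (\<lambda>x. (f x - g x) * l x) = 0"
    using L2_projection[OF f] by blast
  have gc: "continuous_on P g" and Tc: "continuous_on P T"
    using affine_linear_continuous_on g(1) T by auto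
  have "V (\<lambda>x. (f x - T x)^2) = V (\<lambda>x. ((f x - g x)^2 + 2 * ((f x - g x) * (g x - T x))) + (g x - T x)^2)"
    by (rule arg_cong[of _ _ V]) (auto simp: power2_eq_square algebra_simps)
  also have "\<dots> = V (\<lambda>x. (f x - g x)^2 + 2 * ((f x - g x) * (g x - T x))) + V (\<lambda>x. (g x - T x)^2)"
    by (intro V_add continuous_intros f gc Tc)
  also have "V (\<lambda>x. (f x - g x)^2 + 2 * ((f x - g x) * (g x - T x))) = V (\<lambda>x. (f x - g x)^2) + V (\<lambda>x. 2 * ((f x - g x) * (g x - T x)))"
    by (intro V_add continuous_intros f gc Tc)
  also have "V (\<lambda>x. 2 * ((f x - g x) * (g x - T x))) = 0"
    unfolding V_cmult using g(3)[OF affine_linear_diff[OF g(1) T]] by simp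
  finally have "V (\<lambda>x. (f x - g x)^2) \<le> V (\<lambda>x. (f x - T x)^2)"
    using V_nonneg[of "\<lambda>x. (g x - T x)^2"] gc Tc by (simp add: continuous_intros)
  then show ?thesis unfolding L2_norm_on_def g(2) V_def[symmetric] by simp
qed

text \<open>The contraction by 1/2 towards \<open>p\<close> maps \<open>P\<close> into itself and
  scales area by 1/4.\<close>

lemma V_half_le:
  assumes p: "p \<in> P" and u: "continuous_on P u" "\<And>x. x \<in> P \<Longrightarrow> u x \<ge> 0"
  shows "V (\<lambda>x. u ((1/2) *\<^sub>R (p + x))) \<le> 4 * V u"
proof -
  have half: "(1/2) *\<^sub>R (p + x) \<in> P" if "x \<in> P" for x
    using convexD[OF convex_P p that, of "1/2" "1/2"] by (simp add: scaleR_add_right)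
  have c: "continuous_on P (\<lambda>x. u ((1/2) *\<^sub>R (p + x)))"
    by (rule continuous_on_compose2[OF u(1)]) (use half in \<open>auto intro!: continuous_intros\<close>)
  define G where "G = (\<lambda>y. indicator P y * ennreal (u y))"
  have "(\<lambda>y. ennreal (indicator P y *\<^sub>R u y)) \<in> borel_measurable borel"
    using borel_measurable_continuous_on_indicator[OF _ u(1)] closed_P by measurable
  moreover have "ennreal (indicator P y *\<^sub>R u y) = G y" for y by (simp add: G_def indicator_def)
  ultimately have Gm [measurable]: "G \<in> borel_measurable borel" by simp
  have "ennreal (V (\<lambda>x. u ((1/2) *\<^sub>R (p + x)))) = (\<integral>\<^sup>+x. indicator P x * ennreal (u ((1/2) *\<^sub>R (p + x))) \<partial>lborel)"
    by (rule nn_integral_P[symmetric, OF c]) (use half u in auto)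
  also have "\<dots> \<le> (\<integral>\<^sup>+x. G ((1/2) *\<^sub>R p + (1/2) *\<^sub>R x) \<partial>lborel)"
    by (rule nn_integral_mono) (use half in \<open>auto simp: G_def indicator_def scaleR_add_right\<close>)
  finally have 1: "ennreal (V (\<lambda>x. u ((1/2) *\<^sub>R (p + x)))) \<le> (\<integral>\<^sup>+x. G ((1/2) *\<^sub>R p + (1/2) *\<^sub>R x) \<partial>lborel)" .
  have "ennreal (V u) = (\<integral>\<^sup>+y. G y \<partial>lborel)" unfolding G_def by (rule nn_integral_P[symmetric, OF u])
  also have "\<dots> = ennreal (1/4) * (\<integral>\<^sup>+x. G ((1/2) *\<^sub>R p + (1/2) *\<^sub>R x) \<partial>lborel)"
    by (subst lborel_affine[of "1/2" "(1/2) *\<^sub>R p"])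
      (simp_all add: nn_integral_density nn_integral_distr nn_integral_cmult power2_eq_square)
  finally have "ennreal 4 * ennreal (V u) = ennreal 4 * ennreal (1/4) * (\<integral>\<^sup>+x. G ((1/2) *\<^sub>R p + (1/2) *\<^sub>R x) \<partial>lborel)"
    by (simp add: mult.assoc)
  also have "ennreal 4 * ennreal (1/4) = ennreal (4 * (1/4))" by (rule ennreal_mult[symmetric]) simp_all
  also have "\<dots> = 1" by simp
  finally have "ennreal (V (\<lambda>x. u ((1/2) *\<^sub>R (p + x)))) \<le> ennreal 4 * ennreal (V u)" using 1 by simp
  also have "\<dots> = ennreal (4 * V u)" using V_nonneg[OF u] by (simp add: ennreal_mult)
  finally show ?thesis using V_nonneg[OF u] by (simp add: ennreal_le_iff)
qed

end

section \<open>Uniform stability\<close>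

lemma hinge_sum_continuous: "hinge_sum H \<Longrightarrow> continuous_on S H"
proof (induction rule: hinge_sum.induct)
  case zero then show ?case by simp
next
  case (hinge g l c)
  show ?case by (intro continuous_intros affine_linear_continuous_on[OF hinge.hyps(2)] hinge.IH)
qed

context moment
begin

text \<open>Integrating the defining inequalities shows that the center of mass satisfies
  them.\<close>

lemma barycenter:
  obtains p where "p \<in> P" "\<And>al bl. V (\<lambda>x. al \<bullet> x + bl) = V (\<lambda>_. 1) * (al \<bullet> p + bl)"
proof -
  define p :: "real^2" where "p = vector [V (\<lambda>x. 1 * x$1) / V (\<lambda>_. 1), V (\<lambda>x. 1 * x$2) / V (\<lambda>_. 1)]"
  have eq: "V (\<lambda>x. al \<bullet> x + bl) = V (\<lambda>_. 1) * (al \<bullet> p + bl)" for al bl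
    using V_affine_mult[of "\<lambda>_. 1" al bl] V1_pos by (simp add: p_def inner_real2 field_simps)
  have "p \<in> P" unfolding P_iff
  proof (intro allI impI)
    fix k assume k: "k < N"
    have "V (\<lambda>x. h k \<bullet> x + (- c k)) \<ge> 0"
      by (intro V_nonneg continuous_intros) (use k in \<open>auto simp: P_iff\<close>)
    then have "h k \<bullet> p + (- c k) \<ge> 0" unfolding eq using V1_pos by (simp add: zero_le_mult_iff)
    then show "c k \<le> h k \<bullet> p" by simp
  qed
  then show thesis using that eq by blast
qed

lemma half_in_P: "p \<in> P \<Longrightarrow> x \<in> P \<Longrightarrow> (1/2) *\<^sub>R (p + x) \<in> P"
  using convexD[OF convex_P, of p x "1/2" "1/2"] by (simp add: scaleR_add_right)

lemma continuous_half:
  fixes f :: "real^2 \<Rightarrow> real"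
  assumes "p \<in> P" "continuous_on P f" shows "continuous_on P (\<lambda>x. f ((1/2) *\<^sub>R (p + x)))"
  by (rule continuous_on_compose2[OF assms(2)]) (use half_in_P[OF assms(1)] in \<open>auto intro!: continuous_intros\<close>)

end

context stable
begin

text \<open>The functional \<open>f \<mapsto> B f - a * V (f \<circ> half)\<close> dominates \<open>B\<close> on
  convex functions that vanish at the barycenter, it vanishes on affine linear functions, and
  its negative part is dominated by \<open>V\<close>. The last property makes
  \<open>L - \<nu> * (B - a * V (_ \<circ> half))\<close> decrease when a convex function is replaced by a larger
  one with the same boundary values, which reduces the inequality to sums of hinges.\<close>

lemma L_convex_bound:
  obtains \<mu> p where "\<mu> > 0" "p \<in> P"
    "\<And>f \<nu>. continuous_on P f \<Longrightarrow> convex_on P f \<Longrightarrow> 0 \<le> \<nu> \<Longrightarrow> \<nu> \<le> \<mu> \<Longrightarrow>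
        L f \<ge> \<nu> * (B f - a * V (\<lambda>x. f ((1/2) *\<^sub>R (p + x))))"
proof -
  obtain \<mu>0 where mu0: "\<mu>0 > 0" "\<And>al bl. V (\<lambda>x. al \<bullet> x + bl) \<le> 0 \<Longrightarrow> L (hinge_fun al bl) \<ge> \<mu>0 * B (hinge_fun al bl)"
    by (rule hinge_gap, rule that; (assumption | fast))
  obtain p where p: "p \<in> P" and bary: "\<And>al bl. V (\<lambda>x. al \<bullet> x + bl) = V (\<lambda>_. 1) * (al \<bullet> p + bl)"
    by (rule barycenter, rule that; (assumption | fast))
  \<comment> \<open>The bound 1/4 matches the factor 4 in \<open>V_half_le\<close>: it makes
    \<open>V u - \<nu> * W u\<close> nonnegative for \<open>u \<ge> 0\<close>.\<close>
  define \<mu> where "\<mu> = min \<mu>0 (1/4)"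
  have mu: "\<mu> > 0" "\<mu> \<le> \<mu>0" "\<mu> \<le> 1/4" using mu0(1) by (simp_all add: \<mu>_def)
  define W where "W = (\<lambda>f :: real^2 \<Rightarrow> real. V (\<lambda>x. f ((1/2) *\<^sub>R (p + x))))"
  have W_add: "W (\<lambda>x. f x + g x) = W f + W g" if "continuous_on P f" "continuous_on P g" for f g
    unfolding W_def by (intro V_add continuous_half p that)
  have W_cmult: "W (\<lambda>x. r * f x) = r * W f" for r f unfolding W_def by (rule V_cmult)
  have W_nonneg: "W f \<ge> 0" if "continuous_on P f" "\<And>x. x \<in> P \<Longrightarrow> f x \<ge> 0" for f
    unfolding W_def by (intro V_nonneg continuous_half p that half_in_P)
  \<comment> \<open>Contraction towards the barycenter preserves the integrals of affine functions,
    and \<open>L\<close> vanishes on them.\<close>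
  have aff: "B (\<lambda>x. al \<bullet> x + bl) - a * W (\<lambda>x. al \<bullet> x + bl) = 0" for al bl
  proof -
    have "W (\<lambda>x. al \<bullet> x + bl) = V (\<lambda>x. ((1/2) *\<^sub>R al) \<bullet> x + ((1/2) * (al \<bullet> p) + bl))"
      unfolding W_def by (rule arg_cong[of _ _ V]) (auto simp: inner_add_right)
    also have "\<dots> = V (\<lambda>x. al \<bullet> x + bl)" unfolding bary by simp
    finally show ?thesis using L_affine[of al bl] by (simp add: L_def)
  qed
  have main: "L f \<ge> \<nu> * (B f - a * W f)"
    if f: "continuous_on P f" "convex_on P f" and nu: "0 \<le> \<nu>" "\<nu> \<le> \<mu>" for f \<nu>
  proof -
    define \<Lambda> where "\<Lambda> = (\<lambda>f. L f - \<nu> * (B f - a * W f))"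
    have Lam_add: "\<Lambda> (\<lambda>x. f x + g x) = \<Lambda> f + \<Lambda> g" if "continuous_on P f" "continuous_on P g" for f g
      unfolding \<Lambda>_def L_add[OF that] B_add[OF that] W_add[OF that] by (simp add: algebra_simps)
    have Lam_cmult: "\<Lambda> (\<lambda>x. r * f x) = r * \<Lambda> f" for r f
      unfolding \<Lambda>_def L_cmult B_cmult W_cmult by (simp add: algebra_simps)
    have Lam_aff: "\<Lambda> (\<lambda>x. al \<bullet> x + bl) = 0" for al bl
      unfolding \<Lambda>_def L_affine aff by simp
    have Lam_hinge_fun0: "\<Lambda> (hinge_fun al bl) \<ge> 0" if "V (\<lambda>x. al \<bullet> x + bl) \<le> 0" for al bl
    proof -
      have Bn: "B (hinge_fun al bl) \<ge> 0" by (rule B_nonneg[OF continuous_hinge_fun hinge_fun_nonneg])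
      have "a * W (hinge_fun al bl) \<ge> 0" using a_pos W_nonneg[OF continuous_hinge_fun hinge_fun_nonneg] by simp
      then have "\<nu> * (B (hinge_fun al bl) - a * W (hinge_fun al bl)) \<le> \<nu> * B (hinge_fun al bl)" using nu by (intro mult_left_mono) auto
      also have "\<dots> \<le> \<mu>0 * B (hinge_fun al bl)" using nu mu Bn by (intro mult_right_mono) auto
      also have "\<dots> \<le> L (hinge_fun al bl)" by (rule mu0(2)[OF that])
      finally show ?thesis by (simp add: \<Lambda>_def)
    qed
    have Lam_hinge_fun: "\<Lambda> (hinge_fun al bl) \<ge> 0" for al bl
    proof (cases "V (\<lambda>x. al \<bullet> x + bl) \<le> 0")
      case True then show ?thesis by (rule Lam_hinge_fun0)
    next
      case False
      \<comment> \<open>The opposite hinge differs from the given one by an affine linear function,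
        on which \<open>\<Lambda>\<close> vanishes.\<close>
      then have "V (\<lambda>x. (- al) \<bullet> x + (- bl)) \<le> 0" using V_cmult[of "-1" "\<lambda>x. al \<bullet> x + bl"] by simp
      then have "\<Lambda> (hinge_fun (- al) (- bl)) \<ge> 0" by (rule Lam_hinge_fun0)
      moreover have "hinge_fun al bl = (\<lambda>x. (al \<bullet> x + bl) + hinge_fun (- al) (- bl) x)"
        by (auto simp: hinge_fun_def max_def)
      then have "\<Lambda> (hinge_fun al bl) = \<Lambda> (\<lambda>x. (al \<bullet> x + bl) + hinge_fun (- al) (- bl) x)" by (rule arg_cong)
      then have "\<Lambda> (hinge_fun al bl) = \<Lambda> (\<lambda>x. al \<bullet> x + bl) + \<Lambda> (hinge_fun (- al) (- bl))"
        using Lam_add[of "\<lambda>x. al \<bullet> x + bl" "hinge_fun (- al) (- bl)"] continuous_hinge_fun by (simp add: continuous_intros)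
      ultimately show ?thesis using Lam_aff by simp
    qed
    have Lam_sum: "\<Lambda> H \<ge> 0" if "hinge_sum H" for H using that
    proof (induction rule: hinge_sum.induct)
      case zero
      show ?case using Lam_cmult[of 0 "\<lambda>_. 0"] by simp
    next
      case (hinge g l c)
      obtain al bl where l: "l = (\<lambda>x. al \<bullet> x + bl)" using hinge.hyps(2) unfolding affine_linear_def by blast
      have "\<Lambda> (\<lambda>x. c * max 0 (l x) + g x) = \<Lambda> (\<lambda>x. c * hinge_fun al bl x + g x)" by (simp add: l hinge_fun_def)
      also have "\<dots> = \<Lambda> (\<lambda>x. c * hinge_fun al bl x) + \<Lambda> g"
        by (rule Lam_add) (intro continuous_intros continuous_hinge_fun hinge_sum_continuous hinge.hyps)+
      also have "\<dots> = c * \<Lambda> (hinge_fun al bl) + \<Lambda> g" by (simp only: Lam_cmult)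
      finally show ?case using Lam_hinge_fun[of al bl] hinge.IH hinge.hyps(3) by simp
    qed
    have step: "\<Lambda> f \<ge> - ((1 - \<nu>) * (e * B (\<lambda>_. 1)))" if e: "e > 0" for e
    proof -
      obtain T H where TH: "affine_linear T" "hinge_sum H" "\<And>x. x \<in> P \<Longrightarrow> f x \<le> T x + H x"
        "\<And>k x. k < N \<Longrightarrow> x \<in> E k \<Longrightarrow> T x + H x \<le> f x + e"
        using hinge_approximation[OF f e] by blast
      define G where "G = (\<lambda>x. T x + H x)"
      have Tc: "continuous_on P T" and Hc: "continuous_on P H"
        using affine_linear_continuous_on[OF TH(1)] hinge_sum_continuous[OF TH(2)] by auto
      have Gc: "continuous_on P G" unfolding G_def by (intro continuous_intros Tc Hc)
      obtain al bl where T: "T = (\<lambda>x. al \<bullet> x + bl)" using TH(1) unfolding affine_linear_def by blast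
      have "\<Lambda> G = \<Lambda> T + \<Lambda> H" unfolding G_def by (rule Lam_add[OF Tc Hc])
      then have LG: "\<Lambda> G \<ge> 0" using Lam_aff Lam_sum[OF TH(2)] by (simp add: T)
      have "B G \<le> B (\<lambda>x. f x + e * 1)"
        by (rule B_mono) (use TH(4) Gc f in \<open>auto simp: G_def intro!: continuous_intros\<close>)
      also have "\<dots> = B f + e * B (\<lambda>_. 1)" using B_add[OF f(1), of "\<lambda>_. e * 1"] B_cmult[of e "\<lambda>_. 1"] by simp
      finally have BG: "B G \<le> B f + e * B (\<lambda>_. 1)" .
      \<comment> \<open>The defect of the majorant \<open>G\<close>. On the boundary it is at most
        \<open>e\<close>, and its interior part enters the passage from \<open>G\<close> to
        \<open>f\<close> with a favourable sign.\<close>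
      define u where "u = (\<lambda>x. G x + (-1) * f x)"
      have uc: "continuous_on P u" unfolding u_def by (intro continuous_intros Gc f)
      have mf: "continuous_on P (\<lambda>x. (-1) * f x)" by (intro continuous_intros f)
      have un: "u x \<ge> 0" if "x \<in> P" for x using TH(3)[OF that] by (simp add: u_def G_def)
      have "W u \<le> 4 * V u" unfolding W_def by (rule V_half_le[OF p uc un])
      moreover have "V u \<ge> 0" by (rule V_nonneg[OF uc un])
      moreover have "\<nu> * W u \<le> 1/4 * W u"
        using nu mu W_nonneg[OF uc un] by (intro mult_right_mono) auto
      ultimately have "V u - \<nu> * W u \<ge> 0" by linarith
      then have "a * (V u - \<nu> * W u) \<ge> 0" using a_pos by simp
      moreover have "V u = V G - V f" "W u = W G - W f"
        unfolding u_def V_add[OF Gc mf] W_add[OF Gc mf] V_cmult W_cmult by simp_all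
      ultimately have comp: "a * (V f - \<nu> * W f) \<le> a * (V G - \<nu> * W G)" by (simp add: algebra_simps)
      have "(1 - \<nu>) * B G \<le> (1 - \<nu>) * (B f + e * B (\<lambda>_. 1))" using BG nu mu by (intro mult_left_mono) auto
      then have "(1 - \<nu>) * B f - a * (V f - \<nu> * W f) + (1 - \<nu>) * (e * B (\<lambda>_. 1)) \<ge> (1 - \<nu>) * B G - a * (V G - \<nu> * W G)"
        using comp by (simp add: distrib_left)
      moreover have Lam: "\<Lambda> g = (1 - \<nu>) * B g - a * (V g - \<nu> * W g)" for g by (simp add: \<Lambda>_def L_def algebra_simps)
      ultimately show ?thesis using LG unfolding Lam by linarith
    qed
    have "\<Lambda> f \<ge> 0"
    proof (rule field_le_epsilon)
      fix d :: real assume d: "d > 0"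
      define C where "C = (1 - \<nu>) * B (\<lambda>_. 1)"
      have C: "C > 0" using B1_pos nu mu by (simp add: C_def)
      have "\<Lambda> f \<ge> - ((1 - \<nu>) * (d / C * B (\<lambda>_. 1)))" by (rule step) (use d C in simp)
      also have "(1 - \<nu>) * (d / C * B (\<lambda>_. 1)) = d / C * C" by (simp add: C_def)
      finally show "0 \<le> \<Lambda> f + d" using C by simp
    qed
    then show ?thesis by (simp add: \<Lambda>_def)
  qed
  show thesis by (rule that[OF mu(1) p]) (use main in \<open>simp add: W_def\<close>)
qed

text \<open>After subtraction of an almost supporting affine function at \<open>p\<close>, the
  function \<open>w\<close> is nonnegative and almost zero at \<open>p\<close>. Convexity bounds
  \<open>w\<close> at the midpoint of \<open>p\<close> and \<open>x\<close> by about half of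
  \<open>w x\<close>, so the functional of \<open>L_convex_bound\<close> is at least about half of
  \<open>B w\<close>, and \<open>B w\<close> controls the norm through
  \<open>V_square_le\<close>.\<close>

theorem uniform_stability:
  "\<exists>\<delta>>0. \<forall>f. continuous_on P f \<and> convex_on P f \<longrightarrow>
     futaki N h c f \<ge> \<delta> * L2_norm_on P (proj_affine_perp P f)"
proof -
  obtain \<mu> p where mu: "\<mu> > 0" and p: "p \<in> P" and bound:
    "\<And>f \<nu>. continuous_on P f \<Longrightarrow> convex_on P f \<Longrightarrow> 0 \<le> \<nu> \<Longrightarrow> \<nu> \<le> \<mu> \<Longrightarrow>
        L f \<ge> \<nu> * (B f - a * V (\<lambda>x. f ((1/2) *\<^sub>R (p + x))))"
    by (rule L_convex_bound, rule that; (assumption | fast))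
  define C where "C = sqrt CG + 1"
  have C: "C > 0" "sqrt CG \<le> C" using real_sqrt_ge_zero[OF CG_nonneg] unfolding C_def by linarith+
  define \<delta> where "\<delta> = \<mu> / (2 * C)"
  have d: "\<delta> > 0" using mu C by (simp add: \<delta>_def)
  have "L f \<ge> \<delta> * L2_norm_on P (proj_affine_perp P f)" if f: "continuous_on P f" "convex_on P f" for f
  proof (rule field_le_epsilon)
    fix e :: real assume e: "e > 0"
    \<comment> \<open>Makes the error \<open>\<mu> / 2 * \<eta> * B (\<lambda>_. 1)\<close> equal to
      \<open>e / 2\<close>.\<close>
    define \<eta> where "\<eta> = e / (\<mu> * B (\<lambda>_. 1))"
    have eta: "\<eta> > 0" using e mu B1_pos by (simp add: \<eta>_def)
    obtain T where T: "affine_linear T" "\<And>x. x \<in> P \<Longrightarrow> T x \<le> f x" "T p \<ge> f p - \<eta>"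
      using affine_minorant[OF closed_P p f eta] by blast
    define w where "w = (\<lambda>x. f x - T x)"
    have wv: "convex_on P w" unfolding w_def by (rule convex_on_diff_affine_linear[OF f(2) T(1)])
    have Tc: "continuous_on P T" by (rule affine_linear_continuous_on[OF T(1)])
    have wc: "continuous_on P w" unfolding w_def by (intro continuous_intros f Tc)
    have wn: "w x \<ge> 0" if "x \<in> P" for x using T(2)[OF that] by (simp add: w_def)
    have wp: "w p \<le> \<eta>" using T(3) by (simp add: w_def)
    have Lw: "L w = L f"
    proof -
      have "L w = L (\<lambda>x. f x + (-1) * T x)" by (simp add: w_def)
      also have "\<dots> = L f + L (\<lambda>x. (-1) * T x)" by (intro L_add continuous_intros f Tc)
      also have "L (\<lambda>x. (-1) * T x) = 0" by (simp only: L_cmult L_affine_linear[OF T(1)])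
      finally show ?thesis by simp
    qed
    \<comment> \<open>The choice 0 for \<open>\<nu>\<close> gives \<open>L w \<ge> 0\<close>, that
      is, \<open>a * V w \<le> B w\<close>.\<close>
    have "L w \<ge> 0 * (B w - a * V (\<lambda>x. w ((1/2) *\<^sub>R (p + x))))" using mu by (intro bound[OF wc wv]) auto
    then have aV: "a * V w \<le> B w" by (simp add: L_def)
    have "V (\<lambda>x. w ((1/2) *\<^sub>R (p + x))) \<le> V (\<lambda>x. (1/2) * w x + (1/2) * w p)"
    proof (rule V_mono[OF continuous_half[OF p wc]])
      show "continuous_on P (\<lambda>x. (1/2) * w x + (1/2) * w p)" by (intro continuous_intros wc)
      fix x assume x: "x \<in> P"
      have "w ((1 - 1/2) *\<^sub>R p + (1/2) *\<^sub>R x) \<le> (1 - 1/2) * w p + (1/2) * w x"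
        by (rule convex_onD[OF wv]) (use p x in auto)
      then show "w ((1/2) *\<^sub>R (p + x)) \<le> (1/2) * w x + (1/2) * w p" by (simp add: scaleR_add_right)
    qed
    also have "\<dots> = (1/2) * V w + (1/2) * w p * V (\<lambda>_. 1)"
      using V_add[of "\<lambda>x. (1/2) * w x" "\<lambda>_. ((1/2) * w p) * 1"] V_cmult[of "1/2" w] V_cmult[of "(1/2) * w p" "\<lambda>_. 1"] wc
      by (simp add: continuous_intros)
    also have "\<dots> \<le> (1/2) * V w + (1/2) * \<eta> * V (\<lambda>_. 1)"
      using wp V1_pos by (intro add_left_mono mult_right_mono) auto
    finally have "a * V (\<lambda>x. w ((1/2) *\<^sub>R (p + x))) \<le> a * ((1/2) * V w + (1/2) * \<eta> * V (\<lambda>_. 1))"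
      using a_pos by (intro mult_left_mono) auto
    also have "\<dots> = (1/2) * (a * V w) + (1/2) * \<eta> * (a * V (\<lambda>_. 1))" by (simp add: algebra_simps)
    also have "a * V (\<lambda>_. 1) = B (\<lambda>_. 1)" using V1_pos by (simp add: a_def)
    finally have half: "a * V (\<lambda>x. w ((1/2) *\<^sub>R (p + x))) \<le> (1/2) * B w + (1/2) * \<eta> * B (\<lambda>_. 1)"
      using aV by linarith
    have "L w \<ge> \<mu> * (B w - a * V (\<lambda>x. w ((1/2) *\<^sub>R (p + x))))" using mu by (intro bound[OF wc wv]) auto
    moreover have "\<mu> * (B w - a * V (\<lambda>x. w ((1/2) *\<^sub>R (p + x)))) \<ge> \<mu> * ((1/2) * B w - (1/2) * \<eta> * B (\<lambda>_. 1))"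
      using half mu by (intro mult_left_mono) auto
    moreover have "\<mu> * ((1/2) * B w - (1/2) * \<eta> * B (\<lambda>_. 1)) = \<mu> / 2 * B w - e / 2"
      using mu B1_pos by (simp add: \<eta>_def field_simps)
    ultimately have Lf: "L f \<ge> \<mu> / 2 * B w - e / 2" using Lw by linarith
    have Bw: "B w \<ge> 0" by (rule B_nonneg[OF wc wn])
    have "L2_norm_on P (proj_affine_perp P f) \<le> sqrt (V (\<lambda>x. (w x)^2))"
      unfolding w_def by (rule L2_norm_proj_le[OF f(1) T(1)])
    also have "\<dots> \<le> sqrt (CG * (B w)^2)" by (intro real_sqrt_le_mono V_square_le wc wn wv)
    also have "\<dots> = sqrt CG * B w" using Bw by (simp add: real_sqrt_mult)
    also have "\<dots> \<le> C * B w" using C Bw by (intro mult_right_mono) auto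
    finally have "\<delta> * L2_norm_on P (proj_affine_perp P f) \<le> \<delta> * (C * B w)" using d by (intro mult_left_mono) auto
    also have "\<delta> * (C * B w) = \<mu> / 2 * B w" using C by (simp add: \<delta>_def)
    finally show "\<delta> * L2_norm_on P (proj_affine_perp P f) \<le> L f + e" using Lf e by linarith
  qed
  then show ?thesis using d by (intro exI[of _ \<delta>]) (simp add: futaki_eq)
qed

end

theorem theorem4p2p1:
  fixes N :: nat and h :: "nat \<Rightarrow> real^2" and c :: "nat \<Rightarrow> real" and P :: "(real^2) set"
  assumes "moment_polygon N h c"
    and "P = polygon N h c"
    and "\<And>f. rational_pl_convex_on P f \<Longrightarrow>
           futaki N h c f \<ge> 0 \<and> (futaki N h c f = 0 \<longleftrightarrow> affine_linear_on P f)"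
  shows "\<exists>\<delta>>0. \<forall>f. continuous_on P f \<and> convex_on P f \<longrightarrow>
           futaki N h c f \<ge> \<delta> * L2_norm_on P (proj_affine_perp P f)"
proof -
  interpret stable N h c
    by unfold_locales (use assms(1) assms(3)[unfolded assms(2)] in blast)+
  show ?thesis unfolding assms(2) by (rule uniform_stability)
qed

end
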